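(* The subset $\mathfrak{grt}_1$ of $\mathfrak G$ is equal to the set of all elements $C\in\mathfrak G_{\mathrm{inert}}$ such that there exist a derivation $\vec D$ of $\mathfrak P_{\vec 5}$ and an element $\vec X\in\mathfrak P_{\vec 5}$ such that: (a') the morphism $\mathfrak P_{\vec 4}\to\mathfrak P_{\vec 5}$, $x\mapsto x^{1,2,3,45}$, intertwines $\vec D_C$ and $\vec D$; and (b') the morphism $\mathfrak P_{\vec 4}\to\mathfrak P_{\vec 5}$, $x\mapsto x^{1,2,4,35}$, intertwines $\vec D_C$ and $\vec D+\mathrm{ad}_{\vec X}$.
   Context: $\mathbf k$ is a commutative $\mathbb Q$-algebra with unit; Lie algebras are over $\mathbf k$. $[1,n]=\{1,\dots,n\}$; $\mathrm{ad}_X(x)=[X,x]$. A Lie algebra morphism $f:\mathfrak a\to\mathfrak b$ intertwines derivations $D$ of $\mathfrak a$ and $E$ of $\mathfrak b$ if $E\circ f=f\circ D$. For $n\ge2$, $\mathfrak t_n$ is the Lie algebra with generators $t_{ij}$ ($i\ne j\in[1,n]$) and relations $t_{ji}=t_{ij}$, $[t_{ij}+t_{ik},t_{jk}]=0$ for distinct $i,j,k$, and $[t_{ij},t_{kl}]=0$ for distinct $i,j,k,l$. A partially defined map $\phi:[1,m]\supset S_\phi\to[1,n]$, identified with the sequence of its fibers $\phi^{-1}(1),\dots,\phi^{-1}(n)$, defines a Lie algebra morphism $\mathfrak t_n\to\mathfrak t_m$, $x\mapsto x^\phi$, by $t_{ij}\mapsto\sum_{\phi(i')=i,\,\phi(j')=j}t_{i'j'}$.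 For $n\ge2$, $\mathfrak P_{\overrightarrow{n+1}}$ is the Lie algebra with generators $\vec X_{ij}$, $i,j\in[1,n+1]$ (including $i=j$), and relations: $\vec X_{ji}=\vec X_{ij}$ for all $i,j$; $[\vec X_{ij},\vec X_{kl}]=0$ for distinct $i,j,k,l$; $\sum_{j\in[1,n+1]}\vec X_{ij}=0$ for each $i$; and $\vec X_{ii}$ is central for each $i$. A map $\phi:[1,m+1]\to[1,n+1]$, identified with the sequence of its fibers $\phi^{-1}(1),\dots,\phi^{-1}(n+1)$, defines a Lie algebra morphism $\mathfrak P_{\overrightarrow{n+1}}\to\mathfrak P_{\overrightarrow{m+1}}$, $x\mapsto x^\phi$, by $\vec X_{ij}\mapsto\sum_{(i',j'):\,\phi(i')=i,\ \phi(j')=j}\vec X_{i'j'}$. (E.g. under $x\mapsto x^{1,2,3,45}$, $\vec X_{14}\mapsto\vec X_{14}+\vec X_{15}$ and $\vec X_{44}\mapsto\vec X_{44}+\vec X_{55}+2\vec X_{45}$.) $\mathfrak{lie}(e_0,e_1)$ is the free Lie algebra on $e_0,e_1$ (degree 1), $e_\infty:=-e_0-e_1$, and $\mathfrak G$ is the sum of its components of degree $>1$. $C(a,b)$ denotes the image of $C$ under $e_0\mapsto a,e_1\mapsto b$. $\mathfrak{lie}(e_0,e_1)$ is embedded in $\mathfrak t_3$ by $e_0\mapsto t_{23}$, $e_1\mapsto t_{12}$. Let $\mathrm{pent}:\mathfrak t_3\to\mathfrak t_4$, $C\mapsto C^{2,3,4}+C^{1,23,4}+C^{1,2,3}-C^{12,3,4}-C^{1,2,34}$.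 $\mathfrak{grt}_1$ is the set of $C\in\mathfrak{lie}(e_0,e_1)$ such that $C(e_0,e_1)+C(e_1,e_0)=0$, $C(e_0,e_1)+C(e_1,e_\infty)+C(e_\infty,e_0)=0$, $[e_1,C(e_0,e_1)]+[e_\infty,C(e_0,e_\infty)]=0$ and $\mathrm{pent}(C)=0$. $\mathfrak G_{\mathrm{inert}}$ is the set of $C\in\mathfrak G$ such that there exists $h_C\in\mathfrak G$ (necessarily unique) with $[C,e_0]+[h_C,e_\infty]=0$. For $C\in\mathfrak G_{\mathrm{inert}}$, $\vec D_C$ is the derivation of $\mathfrak P_{\vec4}$ such that $\vec X_{11},\vec X_{22},\vec X_{33},\vec X_{44}\mapsto0$; $\vec X_{12},\vec X_{34}\mapsto0$; $\vec X_{23},\vec X_{14}\mapsto[C(\vec X_{23},\vec X_{12}),\vec X_{23}]$; $\vec X_{13},\vec X_{24}\mapsto[h_C(\vec X_{23},\vec X_{12}),\vec X_{13}]$. *)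

theory Defs
  imports Complex_Main "HOL-Library.FuncSet"
begin

record ('k, 'a) lie_alg =
  lcarrier :: "'a set"
  lzero :: 'a
  ladd :: "'a \<Rightarrow> 'a \<Rightarrow> 'a"
  lscale :: "'k \<Rightarrow> 'a \<Rightarrow> 'a"
  lbrk :: "'a \<Rightarrow> 'a \<Rightarrow> 'a"

definition lminus :: "('k::comm_ring_1, 'a) lie_alg \<Rightarrow> 'a \<Rightarrow> 'a \<Rightarrow> 'a" where
  "lminus L x y = ladd L x (lscale L (- 1) y)"

definition lsum :: "('k, 'a) lie_alg \<Rightarrow> 'a list \<Rightarrow> 'a" where
  "lsum L xs = foldr (ladd L) xs (lzero L)"

definition lie_derivation :: "('k, 'a) lie_alg \<Rightarrow> ('a \<Rightarrow> 'a) \<Rightarrow> bool" where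
  "lie_derivation L D \<longleftrightarrow>
     D \<in> lcarrier L \<rightarrow> lcarrier L \<and>
     (\<forall>x\<in>lcarrier L. \<forall>y\<in>lcarrier L. D (ladd L x y) = ladd L (D x) (D y)) \<and>
     (\<forall>c. \<forall>x\<in>lcarrier L. D (lscale L c x) = lscale L c (D x)) \<and>
     (\<forall>x\<in>lcarrier L. \<forall>y\<in>lcarrier L.
        D (lbrk L x y) = ladd L (lbrk L (D x) y) (lbrk L x (D y)))"

definition intertwines ::
    "('k, 'a) lie_alg \<Rightarrow> ('a \<Rightarrow> 'b) \<Rightarrow> ('a \<Rightarrow> 'a) \<Rightarrow> ('b \<Rightarrow> 'b) \<Rightarrow> bool" where
  "intertwines A f D E \<longleftrightarrow> (\<forall>x\<in>lcarrier A. E (f x) = f (D x))"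


section \<open>Lie algebras given by generators and relations\<close>

datatype ('k, 'g) lterm =
    LGen 'g
  | LZero
  | LAdd "('k, 'g) lterm" "('k, 'g) lterm"
  | LScale 'k "('k, 'g) lterm"
  | LBrk "('k, 'g) lterm" "('k, 'g) lterm"

type_synonym ('k, 'g) lie_elt = "('k, 'g) lterm set"

text \<open>The least congruence that imposes the Lie algebra axioms and the relations \<open>s = t\<close>,
  \<open>(s, t) \<in> R\<close>. Symbols outside the generating set \<open>S\<close> are identified with zero, so that every
  term denotes an element of the Lie algebra generated by \<open>S\<close>.\<close>

inductive lie_cong ::
    "'g set \<Rightarrow> (('k::comm_ring_1, 'g) lterm \<times> ('k, 'g) lterm) set \<Rightarrow>
     ('k, 'g) lterm \<Rightarrow> ('k, 'g) lterm \<Rightarrow> bool"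
  for S R where
  relation: "(s, t) \<in> R \<Longrightarrow> lie_cong S R s t"
| outside: "g \<notin> S \<Longrightarrow> lie_cong S R (LGen g) LZero"
| refl: "lie_cong S R t t"
| sym: "lie_cong S R s t \<Longrightarrow> lie_cong S R t s"
| trans: "lie_cong S R s t \<Longrightarrow> lie_cong S R t u \<Longrightarrow> lie_cong S R s u"
| cong_add: "lie_cong S R s s' \<Longrightarrow> lie_cong S R t t' \<Longrightarrow> lie_cong S R (LAdd s t) (LAdd s' t')"
| cong_scale: "lie_cong S R t t' \<Longrightarrow> lie_cong S R (LScale c t) (LScale c t')"
| cong_brk: "lie_cong S R s s' \<Longrightarrow> lie_cong S R t t' \<Longrightarrow> lie_cong S R (LBrk s t) (LBrk s' t')"
| add_assoc: "lie_cong S R (LAdd (LAdd s t) u) (LAdd s (LAdd t u))"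
| add_comm: "lie_cong S R (LAdd s t) (LAdd t s)"
| add_zero: "lie_cong S R (LAdd LZero t) t"
| add_neg: "lie_cong S R (LAdd t (LScale (- 1) t)) LZero"
| scale_add: "lie_cong S R (LScale c (LAdd s t)) (LAdd (LScale c s) (LScale c t))"
| add_scale: "lie_cong S R (LScale (c + d) t) (LAdd (LScale c t) (LScale d t))"
| scale_scale: "lie_cong S R (LScale (c * d) t) (LScale c (LScale d t))"
| scale_one: "lie_cong S R (LScale 1 t) t"
| brk_add_left: "lie_cong S R (LBrk (LAdd s t) u) (LAdd (LBrk s u) (LBrk t u))"
| brk_add_right: "lie_cong S R (LBrk s (LAdd t u)) (LAdd (LBrk s t) (LBrk s u))"
| brk_scale_left: "lie_cong S R (LBrk (LScale c s) t) (LScale c (LBrk s t))"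
| brk_scale_right: "lie_cong S R (LBrk s (LScale c t)) (LScale c (LBrk s t))"
| brk_alt: "lie_cong S R (LBrk t t) LZero"
| jacobi: "lie_cong S R
     (LAdd (LBrk s (LBrk t u)) (LAdd (LBrk t (LBrk u s)) (LBrk u (LBrk s t)))) LZero"

definition lie_class ::
    "'g set \<Rightarrow> (('k::comm_ring_1, 'g) lterm \<times> ('k, 'g) lterm) set \<Rightarrow>
     ('k, 'g) lterm \<Rightarrow> ('k, 'g) lie_elt" where
  "lie_class S R t = {s. lie_cong S R t s}"

definition lie_rep :: "('k, 'g) lie_elt \<Rightarrow> ('k, 'g) lterm" where
  "lie_rep x = (SOME t. t \<in> x)"

definition lie_pres ::
    "'g set \<Rightarrow> (('k::comm_ring_1, 'g) lterm \<times> ('k, 'g) lterm) set \<Rightarrow>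
     ('k, ('k, 'g) lie_elt) lie_alg" where
  "lie_pres S R =
    \<lparr> lcarrier = range (lie_class S R),
      lzero = lie_class S R LZero,
      ladd = (\<lambda>x y. lie_class S R (LAdd (lie_rep x) (lie_rep y))),
      lscale = (\<lambda>c x. lie_class S R (LScale c (lie_rep x))),
      lbrk = (\<lambda>x y. lie_class S R (LBrk (lie_rep x) (lie_rep y))) \<rparr>"

primrec lie_eval :: "('k, 'a) lie_alg \<Rightarrow> ('g \<Rightarrow> 'a) \<Rightarrow> ('k, 'g) lterm \<Rightarrow> 'a" where
  "lie_eval L f (LGen g) = f g"
| "lie_eval L f LZero = lzero L"
| "lie_eval L f (LAdd s t) = ladd L (lie_eval L f s) (lie_eval L f t)"
| "lie_eval L f (LScale c t) = lscale L c (lie_eval L f t)"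
| "lie_eval L f (LBrk s t) = lbrk L (lie_eval L f s) (lie_eval L f t)"

text \<open>The morphism from \<open>lie_pres S R\<close> to \<open>L\<close> that sends each generator \<open>g \<in> S\<close> to \<open>f g\<close>
  (meaningful when \<open>f\<close> satisfies the relations \<open>R\<close>).\<close>

definition lie_lift ::
    "'g set \<Rightarrow> ('k, 'a) lie_alg \<Rightarrow> ('g \<Rightarrow> 'a) \<Rightarrow> ('k, 'g) lie_elt \<Rightarrow> 'a" where
  "lie_lift S L f x = lie_eval L (\<lambda>g. if g \<in> S then f g else lzero L) (lie_rep x)"


section \<open>The Lie algebras of infinitesimal braids\<close>

definition tt_gens :: "nat \<Rightarrow> (nat \<times> nat) set" where
  "tt_gens n = {(i, j). i \<in> {1..n} \<and> j \<in> {1..n} \<and> i \<noteq> j}"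

definition tt_rels ::
    "nat \<Rightarrow> (('k::comm_ring_1, nat \<times> nat) lterm \<times> ('k, nat \<times> nat) lterm) set" where
  "tt_rels n =
     {(LGen (j, i), LGen (i, j)) | i j. {i, j} \<subseteq> {1..n} \<and> i \<noteq> j} \<union>
     {(LBrk (LAdd (LGen (i, j)) (LGen (i, k))) (LGen (j, k)), LZero) | i j k.
        {i, j, k} \<subseteq> {1..n} \<and> distinct [i, j, k]} \<union>
     {(LBrk (LGen (i, j)) (LGen (k, l)), LZero) | i j k l.
        {i, j, k, l} \<subseteq> {1..n} \<and> distinct [i, j, k, l]}"

definition tt :: "nat \<Rightarrow> ('k::comm_ring_1, ('k, nat \<times> nat) lie_elt) lie_alg" where
  "tt n = lie_pres (tt_gens n) (tt_rels n)"

definition tgen :: "nat \<Rightarrow> nat \<Rightarrow> nat \<Rightarrow> ('k::comm_ring_1, nat \<times> nat) lie_elt" where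
  "tgen n i j = lie_class (tt_gens n) (tt_rels n) (LGen (i, j))"

text \<open>\<open>tt_pull m F\<close> is the morphism \<open>x \<mapsto> x\<^sup>\<phi>\<close> from \<open>tt (length F)\<close> to \<open>tt m\<close>, where the partially
  defined map \<open>\<phi>\<close> is given by the sequence \<open>F\<close> of its fibres (duplicate-free lists, pairwise
  disjoint, contained in \<open>{1..m}\<close>); the fibre over \<open>i\<close> is \<open>F ! (i - 1)\<close>.\<close>

definition tt_pull ::
    "nat \<Rightarrow> nat list list \<Rightarrow> ('k::comm_ring_1, nat \<times> nat) lie_elt \<Rightarrow> ('k, nat \<times> nat) lie_elt" where
  "tt_pull m F =
     lie_lift (tt_gens (length F)) (tt m)
       (\<lambda>(i, j). lsum (tt m) [tgen m i' j'. i' \<leftarrow> F ! (i - 1), j' \<leftarrow> F ! (j - 1)])"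


section \<open>The Lie algebras of framed spherical infinitesimal braids\<close>

text \<open>The argument \<open>N\<close> is the number of strands.\<close>

definition PP_gens :: "nat \<Rightarrow> (nat \<times> nat) set" where
  "PP_gens N = {1..N} \<times> {1..N}"

definition PP_rels ::
    "nat \<Rightarrow> (('k::comm_ring_1, nat \<times> nat) lterm \<times> ('k, nat \<times> nat) lterm) set" where
  "PP_rels N =
     {(LGen (j, i), LGen (i, j)) | i j. {i, j} \<subseteq> {1..N}} \<union>
     {(LBrk (LGen (i, j)) (LGen (k, l)), LZero) | i j k l.
        {i, j, k, l} \<subseteq> {1..N} \<and> distinct [i, j, k, l]} \<union>
     {(foldr LAdd [LGen (i, j). j \<leftarrow> [1..<Suc N]] LZero, LZero) | i. i \<in> {1..N}} \<union>
     {(LBrk (LGen (i, i)) t, LZero) | i t. i \<in> {1..N}}"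

definition PP :: "nat \<Rightarrow> ('k::comm_ring_1, ('k, nat \<times> nat) lie_elt) lie_alg" where
  "PP N = lie_pres (PP_gens N) (PP_rels N)"

definition Xgen :: "nat \<Rightarrow> nat \<Rightarrow> nat \<Rightarrow> ('k::comm_ring_1, nat \<times> nat) lie_elt" where
  "Xgen N i j = lie_class (PP_gens N) (PP_rels N) (LGen (i, j))"

text \<open>As \<open>tt_pull\<close>, for total maps (the fibres also cover \<open>{1..M}\<close>).\<close>

definition PP_pull ::
    "nat \<Rightarrow> nat list list \<Rightarrow> ('k::comm_ring_1, nat \<times> nat) lie_elt \<Rightarrow> ('k, nat \<times> nat) lie_elt" where
  "PP_pull M F =
     lie_lift (PP_gens (length F)) (PP M)
       (\<lambda>(i, j). lsum (PP M) [Xgen M i' j'. i' \<leftarrow> F ! (i - 1), j' \<leftarrow> F ! (j - 1)])"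


section \<open>The free Lie algebra on two generators\<close>

datatype egen = E0 | E1

definition flie :: "('k::comm_ring_1, ('k, egen) lie_elt) lie_alg" where
  "flie = lie_pres UNIV {}"

definition e0 :: "('k::comm_ring_1, egen) lie_elt" where
  "e0 = lie_class UNIV {} (LGen E0)"

definition e1 :: "('k::comm_ring_1, egen) lie_elt" where
  "e1 = lie_class UNIV {} (LGen E1)"

definition einf :: "('k::comm_ring_1, egen) lie_elt" where
  "einf = lminus flie (lscale flie (- 1) e0) e1"

text \<open>\<open>lsubst L C a b\<close> is \<open>C(a, b)\<close>, computed in \<open>L\<close>.\<close>

definition lsubst ::
    "('k, 'a) lie_alg \<Rightarrow> ('k::comm_ring_1, egen) lie_elt \<Rightarrow> 'a \<Rightarrow> 'a \<Rightarrow> 'a" where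
  "lsubst L C a b = lie_lift UNIV L (\<lambda>e. case e of E0 \<Rightarrow> a | E1 \<Rightarrow> b) C"

inductive homogeneous :: "nat \<Rightarrow> ('k, 'g) lterm \<Rightarrow> bool" where
  "homogeneous 1 (LGen g)"
| "homogeneous d LZero"
| "homogeneous d s \<Longrightarrow> homogeneous d t \<Longrightarrow> homogeneous d (LAdd s t)"
| "homogeneous d t \<Longrightarrow> homogeneous d (LScale c t)"
| "homogeneous d s \<Longrightarrow> homogeneous d' t \<Longrightarrow> homogeneous (d + d') (LBrk s t)"

definition flie_component :: "nat \<Rightarrow> ('k::comm_ring_1, egen) lie_elt set" where
  "flie_component d = {lie_class UNIV {} t | t. homogeneous d t}"

inductive_set GG :: "('k::comm_ring_1, egen) lie_elt set" where
  "d > 1 \<Longrightarrow> x \<in> flie_component d \<Longrightarrow> x \<in> GG"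
| "x \<in> GG \<Longrightarrow> y \<in> GG \<Longrightarrow> ladd flie x y \<in> GG"


section \<open>The Grothendieck--Teichmueller Lie algebra and the derivations of \<open>PP 4\<close>\<close>

definition pent :: "('k::comm_ring_1, nat \<times> nat) lie_elt \<Rightarrow> ('k, nat \<times> nat) lie_elt" where
  "pent x =
     lminus (tt 4)
       (lminus (tt 4)
         (ladd (tt 4)
           (ladd (tt 4) (tt_pull 4 [[2], [3], [4]] x) (tt_pull 4 [[1], [2, 3], [4]] x))
           (tt_pull 4 [[1], [2], [3]] x))
         (tt_pull 4 [[1, 2], [3], [4]] x))
       (tt_pull 4 [[1], [2], [3, 4]] x)"

definition grt1 :: "('k::comm_ring_1, egen) lie_elt set" where
  "grt1 = {C \<in> lcarrier flie.
     ladd flie C (lsubst flie C e1 e0) = lzero flie \<and>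
     ladd flie (ladd flie C (lsubst flie C e1 einf)) (lsubst flie C einf e0) = lzero flie \<and>
     ladd flie (lbrk flie e1 C) (lbrk flie einf (lsubst flie C e0 einf)) = lzero flie \<and>
     pent (lsubst (tt 3) C (tgen 3 2 3) (tgen 3 1 2)) = lzero (tt 4)}"

definition inert_witness :: "('k::comm_ring_1, egen) lie_elt \<Rightarrow> ('k, egen) lie_elt \<Rightarrow> bool" where
  "inert_witness C h \<longleftrightarrow>
     h \<in> GG \<and> ladd flie (lbrk flie C e0) (lbrk flie h einf) = lzero flie"

definition GG_inert :: "('k::comm_ring_1, egen) lie_elt set" where
  "GG_inert = {C \<in> GG. \<exists>h. inert_witness C h}"

definition hC :: "('k::comm_ring_1, egen) lie_elt \<Rightarrow> ('k, egen) lie_elt" where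
  "hC C = (THE h. inert_witness C h)"

text \<open>A derivation is determined on the carrier by its values on the generators; \<open>SOME\<close> only
  leaves its values outside the carrier open.\<close>

definition vecD ::
    "('k::comm_ring_1, egen) lie_elt \<Rightarrow> ('k, nat \<times> nat) lie_elt \<Rightarrow> ('k, nat \<times> nat) lie_elt" where
  "vecD C = (SOME D.
     let X = Xgen 4;
         u = lbrk (PP 4) (lsubst (PP 4) C (X 2 3) (X 1 2)) (X 2 3);
         v = lbrk (PP 4) (lsubst (PP 4) (hC C) (X 2 3) (X 1 2)) (X 1 3)
     in lie_derivation (PP 4) D \<and>
        (\<forall>i\<in>{1..4}. D (X i i) = lzero (PP 4)) \<and>
        D (X 1 2) = lzero (PP 4) \<and> D (X 3 4) = lzero (PP 4) \<and>
        D (X 2 3) = u \<and> D (X 1 4) = u \<and>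
        D (X 1 3) = v \<and> D (X 2 4) = v)"

end

theory Submission
  imports Defs "HOL-Library.Numeral_Type"
begin

text \<open>
  Free Lie algebras over \<open>\<rat>\<close>-algebras embed into the functions on words: the Dynkin operator recovers
  the degree \<open>d\<close> part of a Lie polynomial, multiplied by \<open>d\<close>, from its coefficients. Together with the
  decomposition of \<open>t\<^sub>4\<close> as the semidirect product of a free Lie algebra of rank three (the strand
  \<open>k\<close>) by the Lie algebra of the other strands, this yields the centraliser of a generator \<open>t\<^sub>i\<^sub>j\<close>:
  it is spanned by \<open>t\<^sub>i\<^sub>j\<close>, the centre and the Lie algebra generated by \<open>t\<^sub>k\<^sub>l\<close> and \<open>t\<^sub>i\<^sub>k + t\<^sub>j\<^sub>k\<close>.

  Let \<open>D\<close>, \<open>X\<close> satisfy (a') and (b'). Applying \<open>D\<close> to \<open>[X\<^sub>1\<^sub>3, X\<^sub>2\<^sub>4] = 0\<close> shows that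
  \<open>y = C(X\<^sub>2\<^sub>4, X\<^sub>1\<^sub>2) - X - h\<^sub>C(X\<^sub>2\<^sub>3, X\<^sub>1\<^sub>2)\<close> satisfies \<open>[X\<^sub>2\<^sub>4, [X\<^sub>1\<^sub>3, y]] = 0\<close>, while \<open>X\<close>
  commutes with \<open>X\<^sub>1\<^sub>2\<close>. By the description of centralisers, \<open>X\<close> and \<open>y\<close> are sums of Lie polynomials in
  consecutive generators of the pentagon 1, 2, 4, 5, 3; the five maps forgetting a strand identify
  all of these with \<open>C\<close> up to sign, which gives the pentagon equation, the antisymmetry of \<open>C\<close> and
  \<open>h\<^sub>C = C(e\<^sub>\<infinity>, e\<^sub>1)\<close>. The hexagon follows because its left hand side commutes with \<open>e\<^sub>0\<close>.

  Conversely, for \<open>C\<close> in \<open>grt\<^sub>1\<close> a derivation is attached to the tree \<open>(12)3(45)\<close>; the defining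
  relations of \<open>P\<^sub>5\<close> are preserved by the pentagon and hexagon equations, and \<open>X = C(X\<^sub>4\<^sub>5, X\<^sub>3\<^sub>5)\<close>.
\<close>

section \<open>Presented Lie algebras\<close>

text \<open>A presentation bounds an algebra only from above: that an element is nonzero, or that a
  centraliser is small, has to be seen in a target where the relations were checked. Free Lie
  algebras are detected by left multiplication on functions of words, where coefficients can be
  compared over any ring containing the inverses of the positive integers. For \<open>tt 4\<close>
  the semidirect decomposition is established as a spanning statement. Independence is supplied by
  two morphisms: one forgets strand \<open>k\<close>, the other lets the fibre act on words by left
  multiplication and the base by derivations, so that all brackets become commutators of operators.
  Nothing is proved about the size of \<open>PP 5\<close>. From (a') and (b') to the pentagon it is
  mapped to \<open>tt 4\<close>, where the centralisers are known; for the converse it is enough to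
  preserve its relations. Division enters twice: by the degree in the Dynkin formula, and by 2 when
  a sum over three strands of \<open>PP 5\<close> is traded for the complementary pair.\<close>

locale lie_algebra =
  fixes L :: "('k::comm_ring_1, 'a) lie_alg"
  assumes zero_closed: "lzero L \<in> lcarrier L"
    and add_closed: "x \<in> lcarrier L \<Longrightarrow> y \<in> lcarrier L \<Longrightarrow> ladd L x y \<in> lcarrier L"
    and scale_closed: "x \<in> lcarrier L \<Longrightarrow> lscale L c x \<in> lcarrier L"
    and brk_closed: "x \<in> lcarrier L \<Longrightarrow> y \<in> lcarrier L \<Longrightarrow> lbrk L x y \<in> lcarrier L"
    and add_assoc: "x \<in> lcarrier L \<Longrightarrow> y \<in> lcarrier L \<Longrightarrow> z \<in> lcarrier L \<Longrightarrow>
      ladd L (ladd L x y) z = ladd L x (ladd L y z)"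
    and add_comm: "x \<in> lcarrier L \<Longrightarrow> y \<in> lcarrier L \<Longrightarrow> ladd L x y = ladd L y x"
    and add_zero: "x \<in> lcarrier L \<Longrightarrow> ladd L (lzero L) x = x"
    and add_neg: "x \<in> lcarrier L \<Longrightarrow> ladd L x (lscale L (- 1) x) = lzero L"
    and scale_add: "x \<in> lcarrier L \<Longrightarrow> y \<in> lcarrier L \<Longrightarrow>
      lscale L c (ladd L x y) = ladd L (lscale L c x) (lscale L c y)"
    and add_scale: "x \<in> lcarrier L \<Longrightarrow> lscale L (c + d) x = ladd L (lscale L c x) (lscale L d x)"
    and scale_scale: "x \<in> lcarrier L \<Longrightarrow> lscale L (c * d) x = lscale L c (lscale L d x)"
    and scale_one: "x \<in> lcarrier L \<Longrightarrow> lscale L 1 x = x"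
    and brk_add_left: "x \<in> lcarrier L \<Longrightarrow> y \<in> lcarrier L \<Longrightarrow> z \<in> lcarrier L \<Longrightarrow>
      lbrk L (ladd L x y) z = ladd L (lbrk L x z) (lbrk L y z)"
    and brk_add_right: "x \<in> lcarrier L \<Longrightarrow> y \<in> lcarrier L \<Longrightarrow> z \<in> lcarrier L \<Longrightarrow>
      lbrk L x (ladd L y z) = ladd L (lbrk L x y) (lbrk L x z)"
    and brk_scale_left: "x \<in> lcarrier L \<Longrightarrow> y \<in> lcarrier L \<Longrightarrow>
      lbrk L (lscale L c x) y = lscale L c (lbrk L x y)"
    and brk_scale_right: "x \<in> lcarrier L \<Longrightarrow> y \<in> lcarrier L \<Longrightarrow>
      lbrk L x (lscale L c y) = lscale L c (lbrk L x y)"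
    and brk_alt: "x \<in> lcarrier L \<Longrightarrow> lbrk L x x = lzero L"
    and jacobi: "x \<in> lcarrier L \<Longrightarrow> y \<in> lcarrier L \<Longrightarrow> z \<in> lcarrier L \<Longrightarrow>
      ladd L (lbrk L x (lbrk L y z)) (ladd L (lbrk L y (lbrk L z x)) (lbrk L z (lbrk L x y))) = lzero L"
begin

lemma eval_closed: "(\<And>g. f g \<in> lcarrier L) \<Longrightarrow> lie_eval L f t \<in> lcarrier L"
  by (induction t) (auto simp: zero_closed add_closed scale_closed brk_closed)

text \<open>The axioms of \<open>L\<close> match the clauses of \<open>lie_cong\<close> one by one,
  so the least congruence lies in the kernel of every evaluation that satisfies the relations. This
  is the universal property behind all morphisms below.\<close>

lemma eval_cong:
  assumes "lie_cong S R s t" and f: "\<And>g. f g \<in> lcarrier L" "\<And>g. g \<notin> S \<Longrightarrow> f g = lzero L"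
    and rel: "\<And>s t. (s, t) \<in> R \<Longrightarrow> lie_eval L f s = lie_eval L f t"
  shows "lie_eval L f s = lie_eval L f t"
  using assms(1)
proof induction
  case (add_comm s t)
  show ?case by (simp add: lie_algebra.add_comm[OF lie_algebra_axioms] eval_closed f)
qed (simp_all add: rel f eval_closed zero_closed add_closed scale_closed brk_closed
    add_assoc add_zero add_neg scale_add add_scale scale_scale scale_one brk_add_left
    brk_add_right brk_scale_left brk_scale_right brk_alt jacobi)

end

lemma lie_class_eq_iff: "lie_class S R s = lie_class S R t \<longleftrightarrow> lie_cong S R s t"
proof
  assume "lie_class S R s = lie_class S R t"
  then have "t \<in> lie_class S R s"
    by (simp add: lie_class_def lie_cong.refl)
  then show "lie_cong S R s t" by (simp add: lie_class_def)
next
  assume "lie_cong S R s t"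
  then show "lie_class S R s = lie_class S R t"
    unfolding lie_class_def by (blast intro: lie_cong.sym lie_cong.trans)
qed

lemma lie_rep_class: "lie_cong S R (lie_rep (lie_class S R t)) t"
proof -
  have "lie_rep (lie_class S R t) \<in> lie_class S R t"
    unfolding lie_rep_def by (rule someI[of _ t]) (simp add: lie_class_def lie_cong.refl)
  then show ?thesis by (simp add: lie_class_def lie_cong.sym)
qed

text \<open>The operations go through the arbitrary representative \<open>lie_rep\<close>; since
  \<open>lie_cong\<close> is a congruence, they may be computed on any terms.\<close>

lemma lie_pres_simps:
  "lcarrier (lie_pres S R) = range (lie_class S R)"
  "lzero (lie_pres S R) = lie_class S R LZero"
  "ladd (lie_pres S R) (lie_class S R s) (lie_class S R t) = lie_class S R (LAdd s t)"
  "lscale (lie_pres S R) c (lie_class S R t) = lie_class S R (LScale c t)"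
  "lbrk (lie_pres S R) (lie_class S R s) (lie_class S R t) = lie_class S R (LBrk s t)"
  by (simp_all add: lie_pres_def lie_class_eq_iff lie_rep_class lie_cong.cong_add
      lie_cong.cong_scale lie_cong.cong_brk)

lemma lie_algebra_lie_pres: "lie_algebra (lie_pres S R)"
  by unfold_locales
    (clarsimp simp: lie_pres_simps rangeI lie_class_eq_iff lie_cong.add_assoc lie_cong.add_comm
      lie_cong.add_zero lie_cong.add_neg lie_cong.scale_add lie_cong.add_scale
      lie_cong.scale_scale lie_cong.scale_one lie_cong.brk_add_left lie_cong.brk_add_right
      lie_cong.brk_scale_left lie_cong.brk_scale_right lie_cong.brk_alt lie_cong.jacobi)+

definition lie_hom :: "('k, 'a) lie_alg \<Rightarrow> ('k, 'b) lie_alg \<Rightarrow> ('a \<Rightarrow> 'b) \<Rightarrow> bool" where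
  "lie_hom L M h \<longleftrightarrow> h \<in> lcarrier L \<rightarrow> lcarrier M \<and> h (lzero L) = lzero M \<and>
     (\<forall>x\<in>lcarrier L. \<forall>y\<in>lcarrier L. h (ladd L x y) = ladd M (h x) (h y)) \<and>
     (\<forall>c. \<forall>x\<in>lcarrier L. h (lscale L c x) = lscale M c (h x)) \<and>
     (\<forall>x\<in>lcarrier L. \<forall>y\<in>lcarrier L. h (lbrk L x y) = lbrk M (h x) (h y))"

lemma lie_hom_eval:
  assumes "lie_algebra L" "lie_hom L M h" "\<And>g. f g \<in> lcarrier L"
  shows "h (lie_eval L f t) = lie_eval M (\<lambda>g. h (f g)) t"
proof -
  interpret lie_algebra L by fact
  show ?thesis
    using assms(2) by (induction t) (auto simp: lie_hom_def eval_closed assms(3))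
qed

lemma lie_lift_class:
  assumes "lie_algebra L" and f: "\<And>g. g \<in> S \<Longrightarrow> f g \<in> lcarrier L"
    and rel: "\<And>s t. (s, t) \<in> R \<Longrightarrow> lie_eval L (\<lambda>g. if g \<in> S then f g else lzero L) s =
      lie_eval L (\<lambda>g. if g \<in> S then f g else lzero L) t"
  shows "lie_lift S L f (lie_class S R t) = lie_eval L (\<lambda>g. if g \<in> S then f g else lzero L) t"
proof -
  interpret lie_algebra L by fact
  show ?thesis
    unfolding lie_lift_def
    by (rule eval_cong[OF lie_rep_class]) (auto simp: f zero_closed rel)
qed

lemma lie_hom_lie_lift:
  assumes "lie_algebra L" and f: "\<And>g. g \<in> S \<Longrightarrow> f g \<in> lcarrier L"
    and rel: "\<And>s t. (s, t) \<in> R \<Longrightarrow> lie_eval L (\<lambda>g. if g \<in> S then f g else lzero L) s =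
      lie_eval L (\<lambda>g. if g \<in> S then f g else lzero L) t"
  shows "lie_hom (lie_pres S R) L (lie_lift S L f)"
proof -
  interpret lie_algebra L by fact
  have "lie_eval L (\<lambda>g. if g \<in> S then f g else lzero L) t \<in> lcarrier L" for t
    by (rule eval_closed) (simp add: f zero_closed)
  then show ?thesis
    unfolding lie_hom_def by (auto simp: lie_pres_simps lie_lift_class[OF assms])
qed

section \<open>Lie rings as a type class, with scalars supplied by a locale\<close>

class lie_ring = ab_group_add +
  fixes brk :: "'a \<Rightarrow> 'a \<Rightarrow> 'a"
  assumes brk_add_left: "brk (x + y) z = brk x z + brk y z"
    and brk_add_right: "brk x (y + z) = brk x y + brk x z"
    and brk_self: "brk x x = 0"
    and jacobi: "brk x (brk y z) + brk y (brk z x) + brk z (brk x y) = 0"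
begin

lemma brk_zero_left [simp]: "brk 0 x = 0"
  using brk_add_left[of 0 0 x] by simp

lemma brk_zero_right [simp]: "brk x 0 = 0"
  using brk_add_right[of x 0 0] by simp

lemma brk_minus_left: "brk (- x) y = - brk x y"
  using brk_add_left[of x "- x" y] by (simp add: eq_neg_iff_add_eq_0 add.commute)

lemma brk_minus_right: "brk x (- y) = - brk x y"
  using brk_add_right[of x y "- y"] by (simp add: eq_neg_iff_add_eq_0 add.commute)

lemma brk_diff_left: "brk (x - y) z = brk x z - brk y z"
  using brk_add_left[of x "- y" z] by (simp add: brk_minus_left)

lemma brk_diff_right: "brk x (y - z) = brk x y - brk x z"
  using brk_add_right[of x y "- z"] by (simp add: brk_minus_right)

lemma brk_swap: "brk x y = - brk y x"
proof -
  have "brk (x + y) (x + y) = 0" by (rule brk_self)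
  then have "brk x y + brk y x = 0"
    unfolding brk_add_left brk_add_right by (simp add: brk_self add.commute)
  then show ?thesis by (simp add: eq_neg_iff_add_eq_0)
qed

lemma brk_eq_0_swap: "brk x y = 0 \<longleftrightarrow> brk y x = 0"
  by (subst brk_swap) simp

lemma brk_brk_right: "brk x (brk y z) = brk (brk x y) z + brk y (brk x z)"
proof -
  have a: "brk z (brk x y) = - brk (brk x y) z" by (rule brk_swap)
  have "brk y (brk z x) = brk y (- brk x z)" by (simp only: brk_swap[of z x])
  then have b: "brk y (brk z x) = - brk y (brk x z)" by (simp add: brk_minus_right)
  show ?thesis
    using jacobi[of x y z] unfolding a b by (simp add: algebra_simps)
qed

lemma brk_brk_left: "brk (brk x y) z = brk x (brk y z) - brk y (brk x z)"
  using brk_brk_right[of x y z] by (simp add: algebra_simps)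

lemmas brk_linear = brk_add_left brk_add_right brk_minus_left brk_minus_right
  brk_diff_left brk_diff_right

end

text \<open>Passes from a typed Lie algebra back to the record format, so that
  \<open>lie_eval\<close> and \<open>lie_lift\<close> apply to it.\<close>

definition typed_alg :: "('k \<Rightarrow> 'a \<Rightarrow> 'a) \<Rightarrow> ('k::comm_ring_1, 'a::lie_ring) lie_alg" where
  "typed_alg s = \<lparr>lcarrier = UNIV, lzero = 0, ladd = (+), lscale = s, lbrk = brk\<rparr>"

lemma typed_alg_simps [simp]:
  "lcarrier (typed_alg s) = UNIV" "lzero (typed_alg s) = 0" "ladd (typed_alg s) = (+)"
  "lscale (typed_alg s) = s" "lbrk (typed_alg s) = brk"
  by (simp_all add: typed_alg_def)

locale typed_lie_algebra =
  fixes scl :: "'k::comm_ring_1 \<Rightarrow> 'a::lie_ring \<Rightarrow> 'a"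
  assumes scl_add: "scl c (x + y) = scl c x + scl c y"
    and add_scl: "scl (c + d) x = scl c x + scl d x"
    and scl_scl: "scl (c * d) x = scl c (scl d x)"
    and scl_one [simp]: "scl 1 x = x"
    and brk_scl_left: "brk (scl c x) y = scl c (brk x y)"
begin

lemma brk_scl_right: "brk x (scl c y) = scl c (brk x y)"
proof -
  have "scl c 0 = 0" using scl_add[of c 0 0] by simp
  then have "scl c (- z) = - scl c z" for z
    using scl_add[of c z "- z"] by (simp add: eq_neg_iff_add_eq_0 add.commute)
  then show ?thesis by (metis brk_scl_left brk_swap)
qed

lemma scl_zero_right [simp]: "scl c 0 = 0"
  using scl_add[of c 0 0] by simp

lemma scl_zero_left [simp]: "scl 0 x = 0"
  using add_scl[of 0 0 x] by simp

lemma scl_minus_left: "scl (- c) x = - scl c x"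
  using add_scl[of c "- c" x] by (simp add: eq_neg_iff_add_eq_0 add.commute)

lemma scl_minus_right: "scl c (- x) = - scl c x"
  using scl_add[of c x "- x"] by (simp add: eq_neg_iff_add_eq_0 add.commute)

lemma scl_minus_one [simp]: "scl (- 1) x = - x"
  by (simp add: scl_minus_left)

lemma lie_algebra_typed: "lie_algebra (typed_alg scl)"
  by unfold_locales
    (simp_all add: scl_add add_scl scl_scl brk_scl_left brk_scl_right brk_add_left brk_add_right
      brk_self add.assoc add.commute jacobi[simplified add.assoc])

end

lemma lie_algebra_tt: "lie_algebra (tt n)"
  unfolding tt_def by (rule lie_algebra_lie_pres)

lemma lie_algebra_PP: "lie_algebra (PP n)"
  unfolding PP_def by (rule lie_algebra_lie_pres)

section \<open>The Lie algebras as types\<close>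

typedef (overloaded) ('k::comm_ring_1, 'g) fla = "lcarrier (lie_pres UNIV {} :: ('k::comm_ring_1, ('k, 'g) lie_elt) lie_alg)"
  using lie_algebra.zero_closed[OF lie_algebra_lie_pres] by blast

instantiation fla :: (comm_ring_1, type) lie_ring
begin

definition "0 = Abs_fla (lzero (lie_pres UNIV {}))"
definition "x + y = Abs_fla (ladd (lie_pres UNIV {}) (Rep_fla x) (Rep_fla y))"
definition "- x = Abs_fla (lscale (lie_pres UNIV {}) (- 1) (Rep_fla x))"
definition "x - y = x + - (y :: ('a, 'b) fla)"
definition "brk x y = Abs_fla (lbrk (lie_pres UNIV {}) (Rep_fla x) (Rep_fla y))"

instance
proof -
  interpret lie_algebra "lie_pres UNIV {}" by (rule lie_algebra_lie_pres)
  note [simp] = zero_fla_def plus_fla_def uminus_fla_def minus_fla_def brk_fla_def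
    Rep_fla Abs_fla_inverse zero_closed add_closed scale_closed brk_closed Rep_fla_inject[symmetric]
  show "OFCLASS(('a, 'b) fla, lie_ring_class)"
  proof
    fix a b c :: "('a, 'b) fla"
    show "a + b + c = a + (b + c)" by (simp add: add_assoc)
    show "a + b = b + a" by (simp add: add_comm)
    show "0 + a = a" by (simp add: add_zero)
    show "- a + a = 0" by (simp add: add_comm add_neg)
    show "a - b = a + - b" by simp
    show "brk (a + b) c = brk a c + brk b c" by (simp add: brk_add_left)
    show "brk a (b + c) = brk a b + brk a c" by (simp add: brk_add_right)
    show "brk a a = 0" by (simp add: brk_alt)
    show "brk a (brk b c) + brk b (brk c a) + brk c (brk a b) = 0"
      by (simp add: add_assoc jacobi)
  qed
qed

end

definition scl_fla :: "'k::comm_ring_1 \<Rightarrow> ('k, 'g) fla \<Rightarrow> ('k, 'g) fla" where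
  "scl_fla c x = Abs_fla (lscale (lie_pres UNIV {}) c (Rep_fla x))"

lemma Rep_fla_simps:
  "Rep_fla 0 = lzero (lie_pres UNIV {})"
  "Rep_fla (x + y) = ladd (lie_pres UNIV {}) (Rep_fla x) (Rep_fla y)"
  "Rep_fla (scl_fla c x) = lscale (lie_pres UNIV {}) c (Rep_fla x)"
  "Rep_fla (brk x y) = lbrk (lie_pres UNIV {}) (Rep_fla x) (Rep_fla y)"
proof -
  interpret lie_algebra "lie_pres UNIV {}" by (rule lie_algebra_lie_pres)
  show "Rep_fla 0 = lzero (lie_pres UNIV {})"
    "Rep_fla (x + y) = ladd (lie_pres UNIV {}) (Rep_fla x) (Rep_fla y)"
    "Rep_fla (scl_fla c x) = lscale (lie_pres UNIV {}) c (Rep_fla x)"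
    "Rep_fla (brk x y) = lbrk (lie_pres UNIV {}) (Rep_fla x) (Rep_fla y)"
    by (simp_all add: zero_fla_def plus_fla_def scl_fla_def brk_fla_def
        Abs_fla_inverse Rep_fla zero_closed add_closed scale_closed brk_closed)
qed

interpretation fla: typed_lie_algebra "scl_fla :: 'k::comm_ring_1 \<Rightarrow> ('k, 'g) fla \<Rightarrow> _"
proof -
  interpret lie_algebra "lie_pres UNIV {}" by (rule lie_algebra_lie_pres)
  show "typed_lie_algebra (scl_fla :: 'k \<Rightarrow> ('k, 'g) fla \<Rightarrow> _)"
    by unfold_locales
      (simp_all add: Rep_fla_inject[symmetric] Rep_fla_simps Rep_fla scale_add add_scale
        scale_scale scale_one brk_scale_left)
qed

lemma lie_hom_Rep_fla: "lie_hom (typed_alg scl_fla) (lie_pres UNIV {}) Rep_fla"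
  unfolding lie_hom_def by (simp add: Rep_fla_simps Rep_fla)

typedef (overloaded) ('k::comm_ring_1) tt4 = "lcarrier (tt 4 :: ('k::comm_ring_1, ('k, nat \<times> nat) lie_elt) lie_alg)"
  using lie_algebra.zero_closed[OF lie_algebra_tt] by blast

instantiation tt4 :: (comm_ring_1) lie_ring
begin

definition "0 = Abs_tt4 (lzero (tt 4))"
definition "x + y = Abs_tt4 (ladd (tt 4) (Rep_tt4 x) (Rep_tt4 y))"
definition "- x = Abs_tt4 (lscale (tt 4) (- 1) (Rep_tt4 x))"
definition "x - y = x + - (y :: 'a tt4)"
definition "brk x y = Abs_tt4 (lbrk (tt 4) (Rep_tt4 x) (Rep_tt4 y))"

instance
proof -
  interpret lie_algebra "tt 4" by (rule lie_algebra_tt)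
  note [simp] = zero_tt4_def plus_tt4_def uminus_tt4_def minus_tt4_def brk_tt4_def
    Rep_tt4 Abs_tt4_inverse zero_closed add_closed scale_closed brk_closed Rep_tt4_inject[symmetric]
  show "OFCLASS('a tt4, lie_ring_class)"
  proof
    fix a b c :: "'a tt4"
    show "a + b + c = a + (b + c)" by (simp add: add_assoc)
    show "a + b = b + a" by (simp add: add_comm)
    show "0 + a = a" by (simp add: add_zero)
    show "- a + a = 0" by (simp add: add_comm add_neg)
    show "a - b = a + - b" by simp
    show "brk (a + b) c = brk a c + brk b c" by (simp add: brk_add_left)
    show "brk a (b + c) = brk a b + brk a c" by (simp add: brk_add_right)
    show "brk a a = 0" by (simp add: brk_alt)
    show "brk a (brk b c) + brk b (brk c a) + brk c (brk a b) = 0"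
      by (simp add: add_assoc jacobi)
  qed
qed

end

definition scl_tt4 :: "'k::comm_ring_1 \<Rightarrow> 'k tt4 \<Rightarrow> 'k tt4" where
  "scl_tt4 c x = Abs_tt4 (lscale (tt 4) c (Rep_tt4 x))"

lemma Rep_tt4_simps:
  "Rep_tt4 0 = lzero (tt 4)"
  "Rep_tt4 (x + y) = ladd (tt 4) (Rep_tt4 x) (Rep_tt4 y)"
  "Rep_tt4 (scl_tt4 c x) = lscale (tt 4) c (Rep_tt4 x)"
  "Rep_tt4 (brk x y) = lbrk (tt 4) (Rep_tt4 x) (Rep_tt4 y)"
proof -
  interpret lie_algebra "tt 4" by (rule lie_algebra_tt)
  show "Rep_tt4 0 = lzero (tt 4)"
    "Rep_tt4 (x + y) = ladd (tt 4) (Rep_tt4 x) (Rep_tt4 y)"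
    "Rep_tt4 (scl_tt4 c x) = lscale (tt 4) c (Rep_tt4 x)"
    "Rep_tt4 (brk x y) = lbrk (tt 4) (Rep_tt4 x) (Rep_tt4 y)"
    by (simp_all add: zero_tt4_def plus_tt4_def scl_tt4_def brk_tt4_def
        Abs_tt4_inverse Rep_tt4 zero_closed add_closed scale_closed brk_closed)
qed

interpretation tt4: typed_lie_algebra "scl_tt4 :: 'k::comm_ring_1 \<Rightarrow> 'k tt4 \<Rightarrow> _"
proof -
  interpret lie_algebra "tt 4" by (rule lie_algebra_tt)
  show "typed_lie_algebra (scl_tt4 :: 'k \<Rightarrow> 'k tt4 \<Rightarrow> _)"
    by unfold_locales
      (simp_all add: Rep_tt4_inject[symmetric] Rep_tt4_simps Rep_tt4 scale_add add_scale
        scale_scale scale_one brk_scale_left)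
qed

lemma lie_hom_Rep_tt4: "lie_hom (typed_alg scl_tt4) (tt 4) Rep_tt4"
  unfolding lie_hom_def by (simp add: Rep_tt4_simps Rep_tt4)

text \<open>The number of strands is the cardinality of a type, so that one construction serves both
  \<open>PP 4\<close> and \<open>PP 5\<close> through numeral types.\<close>

typedef (overloaded) ('k::comm_ring_1, 'n::finite) pp = "lcarrier (PP CARD('n) :: ('k::comm_ring_1, ('k, nat \<times> nat) lie_elt) lie_alg)"
  using lie_algebra.zero_closed[OF lie_algebra_PP] by blast

instantiation pp :: (comm_ring_1, finite) lie_ring
begin

definition "0 = Abs_pp (lzero (PP CARD('b)))"
definition "x + y = Abs_pp (ladd (PP CARD('b)) (Rep_pp x) (Rep_pp y))"
definition "- x = Abs_pp (lscale (PP CARD('b)) (- 1) (Rep_pp x))"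
definition "x - y = x + - (y :: ('a, 'b) pp)"
definition "brk x y = Abs_pp (lbrk (PP CARD('b)) (Rep_pp x) (Rep_pp y))"

instance
proof -
  interpret lie_algebra "PP CARD('b)" by (rule lie_algebra_PP)
  note [simp] = zero_pp_def plus_pp_def uminus_pp_def minus_pp_def brk_pp_def
    Rep_pp Abs_pp_inverse zero_closed add_closed scale_closed brk_closed Rep_pp_inject[symmetric]
  show "OFCLASS(('a, 'b) pp, lie_ring_class)"
  proof
    fix a b c :: "('a, 'b) pp"
    show "a + b + c = a + (b + c)" by (simp add: add_assoc)
    show "a + b = b + a" by (simp add: add_comm)
    show "0 + a = a" by (simp add: add_zero)
    show "- a + a = 0" by (simp add: add_comm add_neg)
    show "a - b = a + - b" by simp
    show "brk (a + b) c = brk a c + brk b c" by (simp add: brk_add_left)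
    show "brk a (b + c) = brk a b + brk a c" by (simp add: brk_add_right)
    show "brk a a = 0" by (simp add: brk_alt)
    show "brk a (brk b c) + brk b (brk c a) + brk c (brk a b) = 0"
      by (simp add: add_assoc jacobi)
  qed
qed

end

definition scl_pp :: "'k::comm_ring_1 \<Rightarrow> ('k, 'n::finite) pp \<Rightarrow> ('k, 'n) pp" where
  "scl_pp c x = Abs_pp (lscale (PP CARD('n)) c (Rep_pp x))"

lemma Rep_pp_simps:
  fixes x y :: "('k::comm_ring_1, 'n::finite) pp"
  shows
  "Rep_pp (0 :: ('k, 'n) pp) = lzero (PP CARD('n))"
  "Rep_pp (x + y) = ladd (PP CARD('n)) (Rep_pp x) (Rep_pp y)"
  "Rep_pp (scl_pp c x) = lscale (PP CARD('n)) c (Rep_pp x)"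
  "Rep_pp (brk x y) = lbrk (PP CARD('n)) (Rep_pp x) (Rep_pp y)"
proof -
  interpret lie_algebra "PP CARD('n)" by (rule lie_algebra_PP)
  show "Rep_pp (0 :: ('k, 'n) pp) = lzero (PP CARD('n))"
    "Rep_pp (x + y) = ladd (PP CARD('n)) (Rep_pp x) (Rep_pp y)"
    "Rep_pp (scl_pp c x) = lscale (PP CARD('n)) c (Rep_pp x)"
    "Rep_pp (brk x y) = lbrk (PP CARD('n)) (Rep_pp x) (Rep_pp y)"
    by (simp_all add: zero_pp_def plus_pp_def scl_pp_def brk_pp_def
        Abs_pp_inverse Rep_pp zero_closed add_closed scale_closed brk_closed)
qed

interpretation pp: typed_lie_algebra "scl_pp :: 'k::comm_ring_1 \<Rightarrow> ('k, 'n::finite) pp \<Rightarrow> _"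
proof -
  interpret lie_algebra "PP CARD('n)" by (rule lie_algebra_PP)
  show "typed_lie_algebra (scl_pp :: 'k \<Rightarrow> ('k, 'n) pp \<Rightarrow> _)"
    by unfold_locales
      (simp_all add: Rep_pp_inject[symmetric] Rep_pp_simps Rep_pp scale_add add_scale
        scale_scale scale_one brk_scale_left)
qed

lemma lie_hom_Rep_pp: "lie_hom (typed_alg scl_pp) (PP CARD('n)) (Rep_pp :: ('k::comm_ring_1, 'n::finite) pp \<Rightarrow> _)"
  unfolding lie_hom_def by (simp add: Rep_pp_simps Rep_pp)

type_synonym 'k fl2 = "('k, egen) fla"
type_synonym 'k pp4 = "('k, 4) pp"
type_synonym 'k pp5 = "('k, 5) pp"

section \<open>Free Lie algebras\<close>

definition fcls :: "('k::comm_ring_1, 'g) lterm \<Rightarrow> ('k, 'g) fla" where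
  "fcls t = Abs_fla (lie_class UNIV {} t)"

abbreviation fgen :: "'g \<Rightarrow> ('k::comm_ring_1, 'g) fla" where
  "fgen g \<equiv> fcls (LGen g)"

lemma Rep_fcls: "Rep_fla (fcls t) = lie_class UNIV {} t"
  by (simp add: fcls_def Abs_fla_inverse lie_pres_simps)

lemma fcls_simps:
  "fcls LZero = 0" "fcls (LAdd s t) = fcls s + fcls t"
  "fcls (LScale c t) = scl_fla c (fcls t)" "fcls (LBrk s t) = brk (fcls s) (fcls t)"
  by (simp_all add: Rep_fla_inject[symmetric] Rep_fla_simps Rep_fcls lie_pres_simps)

lemma fcls_surj: "\<exists>t. x = fcls t"
proof -
  obtain t where "Rep_fla x = lie_class UNIV {} t"
    using Rep_fla[of x] by (auto simp: lie_pres_simps)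
  then have "x = fcls t" by (simp add: Rep_fla_inject[symmetric] Rep_fcls)
  then show ?thesis ..
qed

lemma fla_induct [case_names gen zero add scl brk]:
  assumes "\<And>g. P (fgen g)" "P 0" "\<And>x y. P x \<Longrightarrow> P y \<Longrightarrow> P (x + y)"
    "\<And>c x. P x \<Longrightarrow> P (scl_fla c x)" "\<And>x y. P x \<Longrightarrow> P y \<Longrightarrow> P (brk x y)"
  shows "P x"
proof -
  have "P (fcls t)" for t
    by (induction t) (simp_all add: fcls_simps assms)
  then show ?thesis using fcls_surj[of x] by auto
qed

definition flift :: "('k::comm_ring_1, 'a) lie_alg \<Rightarrow> ('g \<Rightarrow> 'a) \<Rightarrow> ('k, 'g) fla \<Rightarrow> 'a" where
  "flift L f x = lie_lift UNIV L f (Rep_fla x)"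

lemma flift_fcls:
  assumes "lie_algebra L" "\<And>g. f g \<in> lcarrier L"
  shows "flift L f (fcls t) = lie_eval L f t"
  using lie_lift_class[OF assms(1), of UNIV f "{}"] assms(2) by (simp add: flift_def Rep_fcls)

lemma lie_hom_flift:
  assumes "lie_algebra L" "lie_hom L M h" "\<And>g. f g \<in> lcarrier L"
  shows "h (flift L f x) = flift M (\<lambda>g. h (f g)) x"
  unfolding flift_def lie_lift_def using lie_hom_eval[OF assms] by simp

context typed_lie_algebra
begin

definition fl :: "('g \<Rightarrow> 'a) \<Rightarrow> ('k, 'g) fla \<Rightarrow> 'a" where
  "fl f x = flift (typed_alg scl) f x"

lemma fl_fcls: "fl f (fcls t) = lie_eval (typed_alg scl) f t"
  unfolding fl_def by (rule flift_fcls[OF lie_algebra_typed]) simp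

lemma fl_simps [simp]:
  "fl f (fgen g) = f g" "fl f 0 = 0" "fl f (x + y) = fl f x + fl f y"
  "fl f (scl_fla c x) = scl c (fl f x)" "fl f (brk x y) = brk (fl f x) (fl f y)"
proof -
  obtain s t where st: "x = fcls s" "y = fcls t" using fcls_surj by blast
  show "fl f (fgen g) = f g" "fl f (x + y) = fl f x + fl f y"
    "fl f (scl_fla c x) = scl c (fl f x)" "fl f (brk x y) = brk (fl f x) (fl f y)"
    unfolding st by (simp_all add: fcls_simps(2-)[symmetric] fl_fcls)
  show "fl f 0 = 0" by (simp add: fcls_simps(1)[symmetric] fl_fcls)
qed

lemma fl_minus [simp]: "fl f (- x) = - fl f x"
  using fl_simps(4)[of f "- 1" x] by simp

lemma fl_diff [simp]: "fl f (x - y) = fl f x - fl f y"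
  using fl_simps(3)[of f x "- y"] by simp

definition sub :: "'k fl2 \<Rightarrow> 'a \<Rightarrow> 'a \<Rightarrow> 'a" where
  "sub x a b = fl (case_egen a b) x"

lemma sub_simps [simp]:
  "sub (fgen E0) a b = a" "sub (fgen E1) a b = b" "sub 0 a b = 0"
  "sub (x + y) a b = sub x a b + sub y a b" "sub (x - y) a b = sub x a b - sub y a b"
  "sub (- x) a b = - sub x a b" "sub (scl_fla c x) a b = scl c (sub x a b)"
  "sub (brk x y) a b = brk (sub x a b) (sub y a b)"
  by (simp_all add: sub_def)

text \<open>By Jacobi the centraliser of \<open>z\<close> is a subalgebra, so commuting with the
  images of the generators is enough.\<close>

lemma fl_commute:
  assumes "\<And>g. brk z (f g) = 0"
  shows "brk z (fl f x) = 0"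
  by (induction x rule: fla_induct)
    (simp_all add: assms brk_add_right brk_scl_right brk_brk_right)

lemma sub_commute:
  assumes "brk z a = 0" "brk z b = 0"
  shows "brk z (sub x a b) = 0"
  unfolding sub_def by (rule fl_commute) (simp add: assms split: egen.split)

end

locale typed_lie_hom = A: typed_lie_algebra scl + B: typed_lie_algebra scl'
  for scl :: "'k::comm_ring_1 \<Rightarrow> 'a::lie_ring \<Rightarrow> 'a" and scl' :: "'k \<Rightarrow> 'b::lie_ring \<Rightarrow> 'b" +
  fixes h :: "'a \<Rightarrow> 'b"
  assumes hom_add: "h (x + y) = h x + h y" and hom_scl: "h (scl c x) = scl' c (h x)"
    and hom_brk: "h (brk x y) = brk (h x) (h y)"
begin

lemma hom_zero: "h 0 = 0"
  using hom_add[of 0 0] by simp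

lemma hom_minus: "h (- x) = - h x"
  using hom_scl[of "- 1" x] by simp

lemma hom_diff: "h (x - y) = h x - h y"
  using hom_add[of x "- y"] by (simp add: hom_minus)

lemma hom_fl: "h (A.fl f x) = B.fl (\<lambda>g. h (f g)) x"
  by (induction x rule: fla_induct) (simp_all add: hom_add hom_scl hom_brk hom_zero)

lemma hom_sub: "h (A.sub x a b) = B.sub x (h a) (h b)"
proof -
  have "(\<lambda>g. h (case g of E0 \<Rightarrow> a | E1 \<Rightarrow> b)) = case_egen (h a) (h b)"
    by (auto split: egen.split)
  then show ?thesis by (simp add: A.sub_def B.sub_def hom_fl)
qed

lemmas hom_simps = hom_add hom_scl hom_brk hom_zero hom_minus hom_diff hom_sub

end

lemma (in typed_lie_algebra) fl_hom: "typed_lie_hom scl_fla scl (fl f)"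
  by unfold_locales simp_all

lemma (in typed_lie_algebra) sub_hom: "typed_lie_hom scl_fla scl (\<lambda>x. sub x a b)"
  by unfold_locales simp_all

lemma (in typed_lie_algebra) sub_sub: "sub (fla.sub x y z) a b = sub x (sub y a b) (sub z a b)"
  by (rule typed_lie_hom.hom_sub[OF sub_hom])

lemma fl_fgen: "fla.fl fgen x = x"
  by (induction x rule: fla_induct) simp_all

lemma sub_fgen [simp]: "fla.sub x (fgen E0) (fgen E1) = x"
proof -
  have "case_egen (fgen E0) (fgen E1) = (fgen :: egen \<Rightarrow> 'a fl2)" by (auto split: egen.split)
  then show ?thesis by (simp add: fla.sub_def fl_fgen)
qed

section \<open>Action of a free Lie algebra on functions of words\<close>

text \<open>A function of words is a noncommutative formal power series, given by its coefficients.
  Linear operators on series form a Lie ring under the commutator that contains left multiplications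
  as well as derivations.\<close>

typedef (overloaded) ('k::comm_ring_1, 'g) opr =
  "{T :: ('g list \<Rightarrow> 'k) \<Rightarrow> 'g list \<Rightarrow> 'k.
     (\<forall>u v. T (\<lambda>w. u w + v w) = (\<lambda>w. T u w + T v w)) \<and>
     (\<forall>c u. T (\<lambda>w. c * u w) = (\<lambda>w. c * T u w))}"
  morphisms app Abs_opr
  by (rule exI[of _ "\<lambda>u. u"]) simp

setup_lifting type_definition_opr

lemma app_add: "app T (\<lambda>w. u w + v w) = (\<lambda>w. app T u w + app T v w)"
  by transfer simp

lemma app_scale: "app T (\<lambda>w. c * u w) = (\<lambda>w. c * app T u w)"
  by transfer simp

lemma app_minus: "app T (\<lambda>w. - u w) = (\<lambda>w. - app T u w)"
  using app_scale[of T "- 1" u] by simp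

lemma app_diff: "app T (\<lambda>w. u w - v w) = (\<lambda>w. app T u w - app T v w)"
  using app_add[of T u "\<lambda>w. - v w"] by (simp add: app_minus)

lemma app_zero: "app T (\<lambda>w. 0) = (\<lambda>w. 0)"
  using app_scale[of T 0 "\<lambda>w. 0"] by simp

instantiation opr :: (comm_ring_1, type) lie_ring
begin

lift_definition zero_opr :: "('a, 'b) opr" is "\<lambda>u w. 0" by simp
lift_definition plus_opr :: "('a, 'b) opr \<Rightarrow> ('a, 'b) opr \<Rightarrow> ('a, 'b) opr"
  is "\<lambda>T U u w. T u w + U u w" by (simp add: algebra_simps)
lift_definition uminus_opr :: "('a, 'b) opr \<Rightarrow> ('a, 'b) opr"
  is "\<lambda>T u w. - T u w" by (simp add: algebra_simps)
lift_definition minus_opr :: "('a, 'b) opr \<Rightarrow> ('a, 'b) opr \<Rightarrow> ('a, 'b) opr"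
  is "\<lambda>T U u w. T u w - U u w" by (simp add: algebra_simps)
lift_definition brk_opr :: "('a, 'b) opr \<Rightarrow> ('a, 'b) opr \<Rightarrow> ('a, 'b) opr"
  is "\<lambda>T U u w. T (U u) w - U (T u) w" by (simp add: algebra_simps)

lemma app_simps:
  "app 0 u w = 0" "app (T + U) u w = app T u w + app U u w" "app (- T) u w = - app T u w"
  "app (T - U) u w = app T u w - app U u w"
  "app (brk T U) u w = app T (app U u) w - app U (app T u) w"
  by (transfer; simp)+

lemma opr_eqI: "(\<And>u w. app T u w = app U u w) \<Longrightarrow> T = U"
  by (simp add: app_inject[symmetric] fun_eq_iff)

lemma app_op:
  "app (T + U) u = (\<lambda>w. app T u w + app U u w)" "app (T - U) u = (\<lambda>w. app T u w - app U u w)"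
  "app (brk T U) u = (\<lambda>w. app T (app U u) w - app U (app T u) w)"
  by (simp_all add: fun_eq_iff app_simps)

instance
  by standard
    (auto intro!: opr_eqI simp: app_simps app_op app_add app_diff algebra_simps)

end

lift_definition scl_opr :: "'k::comm_ring_1 \<Rightarrow> ('k, 'g) opr \<Rightarrow> ('k, 'g) opr"
  is "\<lambda>c T u w. c * T u w" by (simp add: algebra_simps)

lemma app_scl: "app (scl_opr c T) u w = c * app T u w"
  by transfer simp

lemma app_scl_op: "app (scl_opr c T) u = (\<lambda>w. c * app T u w)"
  by (simp add: fun_eq_iff app_scl)

interpretation opr: typed_lie_algebra "scl_opr :: 'k::comm_ring_1 \<Rightarrow> ('k, 'g) opr \<Rightarrow> _"
  by unfold_locales
    (auto intro!: opr_eqI simp: app_scl app_simps app_op app_scl_op app_scale algebra_simps)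

text \<open>Left multiplication of a series by the letter \<open>x\<close>; \<open>postp\<close> is
  right multiplication and \<open>one_word\<close> the series 1. Hence
  \<open>app (act p) one_word\<close> lists the coefficients of \<open>p\<close> as a noncommutative
  polynomial.\<close>

lift_definition prep :: "'g \<Rightarrow> ('k::comm_ring_1, 'g) opr"
  is "\<lambda>x u w. case w of [] \<Rightarrow> 0 | y # v \<Rightarrow> if y = x then u v else 0"
  by (auto simp: fun_eq_iff split: list.split)

lift_definition postp :: "'g \<Rightarrow> ('k::comm_ring_1, 'g) opr"
  is "\<lambda>x u w. if w \<noteq> [] \<and> last w = x then u (butlast w) else 0"
  by (auto simp: fun_eq_iff)

lemma app_prep [simp]:
  "app (prep x) u [] = 0" "app (prep x) u (y # v) = (if y = x then u v else 0)"
  by (transfer; simp)+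

lemma app_postp: "app (postp x) u w = (if w \<noteq> [] \<and> last w = x then u (butlast w) else 0)"
  by transfer simp

definition one_word :: "'g list \<Rightarrow> 'k::comm_ring_1" where
  "one_word w = (if w = [] then 1 else 0)"

definition act :: "('k::comm_ring_1, 'g) fla \<Rightarrow> ('k, 'g) opr" where
  "act = opr.fl prep"

lemma act_simps [simp]:
  "act (fgen g) = prep g" "act 0 = 0" "act (x + y) = act x + act y" "act (x - y) = act x - act y"
  "act (- x) = - act x" "act (scl_fla c x) = scl_opr c (act x)" "act (brk x y) = brk (act x) (act y)"
  by (simp_all add: act_def)

text \<open>Left and right multiplications commute; by \<open>fl_commute\<close> it is enough to see
  this for letters.\<close>

lemma act_postp: "brk (postp x) (act (p :: ('k::comm_ring_1, 'g) fla)) = 0"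
  unfolding act_def
proof (rule opr.fl_commute)
  fix g :: 'g
  show "brk (postp x) (prep g :: ('k, 'g) opr) = 0"
  proof (rule opr_eqI)
    fix u :: "'g list \<Rightarrow> 'k" and w
    show "app (brk (postp x) (prep g)) u w = app 0 u w"
      by (cases w; cases "tl w") (auto simp: app_simps app_postp one_word_def)
  qed
qed

subsection \<open>The Dynkin operator\<close>

text \<open>Right-nested brackets. The value at \<open>[x]\<close> is \<open>fgen x\<close> and not
  a bracket with the value at \<open>[]\<close>, which is why the formulas for \<open>dynkin\<close>
  start at length one.\<close>

fun nest :: "'g list \<Rightarrow> ('k::comm_ring_1, 'g) fla" where
  "nest [] = 0"
| "nest [x] = fgen x"
| "nest (x # w) = brk (fgen x) (nest w)"

lemma nest_replicate: "n \<ge> 2 \<Longrightarrow> nest (replicate n x) = 0"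
proof (induction n rule: nat_induct_at_least)
  case base
  show ?case by (simp add: numeral_2_eq_2 brk_self)
next
  case (Suc n)
  then show ?case by (cases n) auto
qed

definition dynkin :: "nat \<Rightarrow> ('g::finite list \<Rightarrow> 'k::comm_ring_1) \<Rightarrow> ('k, 'g) fla" where
  "dynkin n u = (\<Sum>w | length w = n. scl_fla (u w) (nest w))"

lemma finite_words: "finite {w :: 'g::finite list. length w = n}"
  using finite_lists_length_eq[of "UNIV :: 'g set" n] by simp

lemma dynkin_zero: "(\<And>w. length w = n \<Longrightarrow> u w = 0) \<Longrightarrow> dynkin n u = 0"
  unfolding dynkin_def by (rule sum.neutral) auto

lemma dynkin_add: "dynkin n (\<lambda>w. u w + v w) = dynkin n u + dynkin n v"
  unfolding dynkin_def by (simp add: fla.add_scl sum.distrib)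

lemma dynkin_diff: "dynkin n (\<lambda>w. u w - v w) = dynkin n u - dynkin n v"
  using dynkin_add[of n "\<lambda>w. u w - v w" v] by simp

lemma dynkin_scale: "dynkin n (\<lambda>w. c * u w) = scl_fla c (dynkin n u)"
proof -
  have "scl_fla c (\<Sum>w\<in>A. f w) = (\<Sum>w\<in>A. scl_fla c (f w))" for A and f :: "'b list \<Rightarrow> ('a, 'b) fla"
    by (induction A rule: infinite_finite_induct) (simp_all add: fla.scl_add)
  then show ?thesis unfolding dynkin_def by (simp add: fla.scl_scl)
qed

lemma brk_sum_right: "brk x (\<Sum>a\<in>A. f a) = (\<Sum>a\<in>A. brk x (f a))"
  by (induction A rule: infinite_finite_induct) (simp_all add: brk_add_right)

lemma dynkin_prep:
  fixes x :: "'g::finite"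
  assumes "n \<ge> 1"
  shows "dynkin (Suc n) (app (prep x) u) = brk (fgen x) (dynkin n u)"
proof -
  have *: "nest (x # w) = brk (fgen x) (nest w)" if "length w = n" for w :: "'g list"
    using assms that by (cases w) auto
  have "dynkin (Suc n) (app (prep x) u) =
      (\<Sum>w \<in> (#) x ` {w. length w = n}. scl_fla (app (prep x) u w) (nest w))"
    unfolding dynkin_def
    by (rule sum.mono_neutral_right[OF finite_words]) (auto simp: length_Suc_conv)
  also have "\<dots> = (\<Sum>w | length w = n. scl_fla (u w) (nest (x # w)))"
    by (subst sum.reindex) auto
  also have "\<dots> = (\<Sum>w | length w = n. brk (fgen x) (scl_fla (u w) (nest w)))"
    by (rule sum.cong) (auto simp: * fla.brk_scl_right)
  finally show ?thesis by (simp add: dynkin_def brk_sum_right)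
qed

lemma dynkin_1:
  fixes u :: "'g::finite list \<Rightarrow> 'k::comm_ring_1"
  shows "dynkin 1 u = (\<Sum>x\<in>UNIV. scl_fla (u [x]) (fgen x))"
proof -
  have "{w :: 'g list. length w = 1} = range (\<lambda>x. [x])"
    by (auto simp: length_Suc_conv)
  then show ?thesis
    unfolding dynkin_def by (simp add: sum.reindex inj_on_def)
qed

lemma homogeneous_0: "homogeneous d t \<Longrightarrow> d = 0 \<Longrightarrow> fcls t = 0"
  by (induction rule: homogeneous.induct) (simp_all add: fcls_simps)

text \<open>The Dynkin operator turns left multiplication by a Lie element into the adjoint action:
  for letters by the recursion of \<open>nest\<close>, for brackets because both sides are
  commutators, by Jacobi.\<close>

lemma dynkin_act:
  "homogeneous d t \<Longrightarrow> n \<ge> 1 \<Longrightarrow> dynkin (d + n) (app (act (fcls t)) u) = brk (fcls t) (dynkin n u)"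
proof (induction arbitrary: n u rule: homogeneous.induct)
  case (1 g)
  then show ?case by (simp add: dynkin_prep)
next
  case (5 d s d' t)
  have "dynkin (d + (d' + n)) (app (act (fcls s)) (app (act (fcls t)) u)) =
      brk (fcls s) (brk (fcls t) (dynkin n u))"
    using 5 by simp
  moreover have "dynkin (d' + (d + n)) (app (act (fcls t)) (app (act (fcls s)) u)) =
      brk (fcls t) (brk (fcls s) (dynkin n u))"
    using 5 by simp
  ultimately show ?case
    by (simp add: fcls_simps app_op dynkin_diff brk_brk_left ac_simps)
qed (simp_all add: fcls_simps app_simps app_op app_scl_op dynkin_add dynkin_scale dynkin_zero
    brk_add_left fla.brk_scl_left)

text \<open>The Dynkin-Specht-Wever identity. For a bracket, \<open>dynkin_act\<close> gives the
  bracket of \<open>s\<close> with \<open>d'\<close> times \<open>t\<close> minus that of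
  \<open>t\<close> with \<open>d\<close> times \<open>s\<close>, in total \<open>d + d'\<close>
  times the bracket of \<open>s\<close> and \<open>t\<close>.\<close>

lemma dynkin_homogeneous:
  "homogeneous d t \<Longrightarrow> d \<ge> 1 \<Longrightarrow> dynkin d (app (act (fcls t)) one_word) = scl_fla (of_nat d) (fcls t)"
proof (induction rule: homogeneous.induct)
  case (1 g)
  have "dynkin 1 (app (prep g) one_word) = (\<Sum>x\<in>UNIV. if x = g then fgen g else 0)"
    unfolding dynkin_1 by (rule sum.cong) (auto simp: one_word_def)
  then show ?case by simp
next
  case (5 d s d' t)
  \<comment> \<open>Degree 0 forces a factor to vanish; it is treated apart since
    \<open>dynkin_act\<close> requires \<open>n \<ge> 1\<close>.\<close>
  consider "d = 0" | "d' = 0" | "d \<ge> 1" "d' \<ge> 1" by linarith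
  then show ?case
  proof cases
    case 1
    then have "fcls s = 0" using 5 homogeneous_0 by blast
    then show ?thesis by (simp add: fcls_simps app_simps dynkin_zero)
  next
    case 2
    then have "fcls t = 0" using 5 homogeneous_0 by blast
    then show ?thesis by (simp add: fcls_simps app_simps dynkin_zero)
  next
    case 3
    have "dynkin (d' + d) (app (act (fcls t)) (app (act (fcls s)) one_word)) =
        brk (fcls t) (dynkin d (app (act (fcls s)) one_word))"
      using 5 3 by (intro dynkin_act)
    then have a: "dynkin (d + d') (app (act (fcls t)) (app (act (fcls s)) one_word)) =
        scl_fla (of_nat d) (brk (fcls t) (fcls s))"
      using 5 3 by (simp add: add.commute fla.brk_scl_right)
    have "dynkin (d + d') (app (act (fcls s)) (app (act (fcls t)) one_word)) =
        brk (fcls s) (dynkin d' (app (act (fcls t)) one_word))"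
      using 5 3 by (intro dynkin_act)
    then show ?thesis
      using 5 3 a brk_swap[of "fcls t" "fcls s"]
      by (simp add: fcls_simps app_op dynkin_diff fla.add_scl fla.brk_scl_right
          fla.scl_minus_right add.commute)
  qed
qed (simp_all add: fcls_simps app_simps app_op app_scl_op dynkin_add dynkin_scale dynkin_zero
    fla.scl_add fla.scl_scl[symmetric] mult.commute)

text \<open>Each letter lengthens words by one. This separates the degrees, so that
  \<open>dynkin e\<close> sees only the component of degree \<open>e\<close>.\<close>

lemma act_homogeneous_support:
  "homogeneous d t \<Longrightarrow> (\<And>w. u w \<noteq> 0 \<Longrightarrow> length w = n) \<Longrightarrow> app (act (fcls t)) u w \<noteq> 0 \<Longrightarrow>
    length w = d + n"
proof (induction arbitrary: n u w rule: homogeneous.induct)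
  case (1 g)
  then show ?case by (cases w) (auto split: if_splits)
next
  case (3 d s t)
  from "3.prems"(2) have "app (act (fcls s)) u w \<noteq> 0 \<or> app (act (fcls t)) u w \<noteq> 0"
    by (auto simp: fcls_simps app_simps)
  then show ?case using 3 by blast
next
  case (4 d t c)
  from "4.prems"(2) have "app (act (fcls t)) u w \<noteq> 0"
    by (auto simp: fcls_simps app_scl)
  then show ?case using 4 by blast
next
  case (5 d s d' t)
  have "app (act (fcls s)) (app (act (fcls t)) u) w \<noteq> 0 \<or>
      app (act (fcls t)) (app (act (fcls s)) u) w \<noteq> 0"
    using "5.prems"(2) by (auto simp: fcls_simps app_simps)
  then show ?case
  proof
    assume "app (act (fcls s)) (app (act (fcls t)) u) w \<noteq> 0"
    then have "length w = d + (d' + n)"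
      using "5.IH"(2)[OF "5.prems"(1)] by (intro "5.IH"(1)) auto
    then show ?thesis by simp
  next
    assume "app (act (fcls t)) (app (act (fcls s)) u) w \<noteq> 0"
    then have "length w = d' + (d + n)"
      using "5.IH"(1)[OF "5.prems"(1)] by (intro "5.IH"(2)) auto
    then show ?thesis by simp
  qed
qed (simp_all add: fcls_simps app_simps)

text \<open>On two generators \<open>graded 2\<close> is the typed counterpart of \<open>GG\<close>;
  the other bounds serve to track degrees under brackets.\<close>

inductive_set graded :: "nat \<Rightarrow> ('k::comm_ring_1, 'g) fla set" for m where
  homogeneous: "d \<ge> m \<Longrightarrow> homogeneous d t \<Longrightarrow> fcls t \<in> graded m"
| add: "x \<in> graded m \<Longrightarrow> y \<in> graded m \<Longrightarrow> x + y \<in> graded m"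

lemma graded_mono: "x \<in> graded m \<Longrightarrow> n \<le> m \<Longrightarrow> x \<in> graded n"
  by (induction rule: graded.induct) (meson graded.homogeneous order.trans, rule graded.add)

lemma graded_zero: "0 \<in> graded m"
  using graded.homogeneous[OF order.refl homogeneous.intros(2), of m] by (simp add: fcls_simps)

lemma graded_scl: "x \<in> graded m \<Longrightarrow> scl_fla c x \<in> graded m"
  by (induction rule: graded.induct)
    (auto simp: fla.scl_add fcls_simps(3)[symmetric] intro: graded.intros homogeneous.intros)

lemma graded_brk: "x \<in> graded m \<Longrightarrow> y \<in> graded n \<Longrightarrow> brk x y \<in> graded (m + n)"
proof (induction rule: graded.induct)
  case (homogeneous d s)
  from homogeneous(3) show ?case
  proof (induction rule: graded.induct)
    case (homogeneous d' t)
    then have "fcls (LBrk s t) \<in> graded (m + n)"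
      using \<open>d \<ge> m\<close> \<open>homogeneous d s\<close>
      by (intro graded.homogeneous[of "m + n" "d + d'"] homogeneous.intros) auto
    then show ?case by (simp add: fcls_simps)
  next
    case (add x y)
    then show ?case by (simp add: brk_add_right graded.add)
  qed
next
  case (add x y)
  then show ?case by (simp add: brk_add_left graded.add)
qed

lemma graded_1: "x \<in> graded 1"
proof (induction x rule: fla_induct)
  case (gen g)
  show ?case by (rule graded.homogeneous[OF order.refl homogeneous.intros(1)])
next
  case (brk x y)
  then show ?case using graded_brk[of x 1 y 1] graded_mono[of "brk x y" 2 1] by (simp add: numeral_2_eq_2)
qed (simp_all add: graded_zero graded.add graded_scl)

section \<open>Free Lie algebras over Q-algebras: coefficients determine elements, centralisers of
  generators\<close>

locale rational_scalars =
  fixes inv_nat :: "nat \<Rightarrow> 'k::comm_ring_1"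
  assumes inv_nat: "n > 0 \<Longrightarrow> of_nat n * inv_nat n = 1"
begin

lemma scl_inv_nat: "n > 0 \<Longrightarrow> scl_fla (inv_nat n) (scl_fla (of_nat n) x) = x"
  by (simp add: fla.scl_scl[symmetric] mult.commute inv_nat)

text \<open>The Dynkin-Specht-Wever identity divided by \<open>d\<close>, summed over the degrees.
  Validity for all large \<open>M\<close> lets two elements with different top degrees be
  added.\<close>

lemma dynkin_reconstruction:
  fixes x :: "('k, 'g::finite) fla"
  shows "\<exists>N. \<forall>M\<ge>N. x = (\<Sum>d=1..M. scl_fla (inv_nat d) (dynkin d (app (act x) one_word)))"
  using graded_1[of x]
proof (induction rule: graded.induct)
  case (homogeneous d t)
  have "fcls t = (\<Sum>e=1..M. scl_fla (inv_nat e) (dynkin e (app (act (fcls t)) one_word)))"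
    if "M \<ge> d" for M
  proof -
    have "scl_fla (inv_nat e) (dynkin e (app (act (fcls t)) one_word)) =
        (if e = d then fcls t else 0)" if "e \<in> {1..M}" for e
    proof (cases "e = d")
      case True
      then show ?thesis
        using homogeneous by (simp add: dynkin_homogeneous scl_inv_nat)
    next
      case False
      have "dynkin e (app (act (fcls t)) one_word) = 0"
        using act_homogeneous_support[OF homogeneous(2), of one_word 0] False
        by (intro dynkin_zero) (force simp: one_word_def split: if_splits)
      then show ?thesis using False by simp
    qed
    then show ?thesis using homogeneous(1) that by simp
  qed
  then show ?case by blast
next
  case (add x y)
  then obtain N N' where
    N: "\<And>M. M \<ge> N \<Longrightarrow> x = (\<Sum>d=1..M. scl_fla (inv_nat d) (dynkin d (app (act x) one_word)))" and
    N': "\<And>M. M \<ge> N' \<Longrightarrow> y = (\<Sum>d=1..M. scl_fla (inv_nat d) (dynkin d (app (act y) one_word)))"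
    by blast
  have "x + y = (\<Sum>d=1..M. scl_fla (inv_nat d) (dynkin d (app (act (x + y)) one_word)))"
    if "M \<ge> max N N'" for M
  proof -
    have "(\<Sum>d=1..M. scl_fla (inv_nat d) (dynkin d (app (act (x + y)) one_word))) =
      (\<Sum>d=1..M. scl_fla (inv_nat d) (dynkin d (app (act x) one_word))) +
      (\<Sum>d=1..M. scl_fla (inv_nat d) (dynkin d (app (act y) one_word)))"
      by (simp add: app_op dynkin_add fla.scl_add sum.distrib)
    then show ?thesis using N[of M] N'[of M] that by simp
  qed
  then show ?case by blast
qed

lemma act_eq_0:
  fixes x :: "('k, 'g::finite) fla"
  assumes "app (act x) one_word = (\<lambda>w. 0)"
  shows "x = 0"
  using dynkin_reconstruction[of x] by (auto simp: assms dynkin_zero)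

text \<open>Comparing coefficients in \<open>x u = u x\<close> moves letters around: a nonzero
  coefficient at \<open>y w x^m\<close> forces \<open>y = x\<close> and a nonzero coefficient at
  \<open>w x^(m+1)\<close>. The trailing power makes this rotation an induction on
  \<open>w\<close>.\<close>

lemma commute_fgen_words:
  assumes u: "app (prep x) u = app (postp x) u"
  shows "u (w @ replicate m x) \<noteq> 0 \<Longrightarrow> set w \<subseteq> {x}"
proof (induction w arbitrary: m)
  case (Cons y w)
  have "app (prep x) u (y # (w @ replicate m x @ [x])) = app (postp x) u ((y # w @ replicate m x) @ [x])"
    using u by simp
  also have "\<dots> = u (y # w @ replicate m x)"
    by (simp only: app_postp last_snoc butlast_snoc) simp
  finally have "y = x" "u (w @ replicate m x @ [x]) \<noteq> 0"
    using Cons.prems by (auto split: if_splits)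
  then show ?case
    using Cons.IH[of "Suc m"] by (simp add: replicate_append_same)
qed simp

text \<open>The series of \<open>h\<close> commutes with \<open>x\<close>, hence is supported on
  powers of \<open>x\<close>. Nested brackets of such words vanish from length two on, and the
  reconstruction leaves a multiple of \<open>x\<close>.\<close>

lemma commute_fgen:
  fixes h :: "('k, 'g::finite) fla"
  assumes "brk h (fgen x) = 0"
  shows "\<exists>c. h = scl_fla c (fgen x)"
proof -
  let ?u = "app (act h) one_word"
  have "app (brk (act h) (prep x)) one_word = (\<lambda>w. 0)"
    using arg_cong[OF assms, of act] by (simp add: fun_eq_iff app_simps)
  then have "app (act h) (app (prep x) one_word) = app (prep x) ?u"
    by (simp add: app_op fun_eq_iff)
  \<comment> \<open>On the series 1, left and right multiplication by \<open>x\<close> agree; as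
    \<open>postp x\<close> commutes with \<open>act h\<close>, the product \<open>h x\<close>
    becomes \<open>postp x\<close> applied to the series of \<open>h\<close>.\<close>
  moreover have "app (prep x) one_word = app (postp x) (one_word :: 'g list \<Rightarrow> 'k)"
  proof
    fix w :: "'g list"
    show "app (prep x) one_word w = app (postp x) (one_word :: 'g list \<Rightarrow> 'k) w"
      by (cases w; cases "tl w") (auto simp: app_postp one_word_def)
  qed
  moreover have "app (act h) (app (postp x) one_word) = app (postp x) ?u"
    using arg_cong[OF act_postp[of x h], of "\<lambda>T. app T one_word"]
    by (simp add: app_op app_simps fun_eq_iff)
  ultimately have u: "app (prep x) ?u = app (postp x) ?u" by simp
  have d: "scl_fla (inv_nat d) (dynkin d ?u) = 0" if "d \<ge> 2" for d
  proof -
    have "scl_fla (?u w) (nest w) = 0" if "length w = d" for w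
    proof (cases "?u w = 0")
      case False
      then have "w = replicate d x"
        using commute_fgen_words[OF u, of w 0] \<open>length w = d\<close> by (intro replicate_eqI) auto
      then show ?thesis using \<open>d \<ge> 2\<close> by (simp add: nest_replicate)
    qed simp
    then show ?thesis by (simp add: dynkin_def)
  qed
  have "?u [y] = 0" if "y \<noteq> x" for y
    using commute_fgen_words[OF u, of "[y]" 0] that by auto
  then have "dynkin 1 ?u = (\<Sum>y\<in>UNIV. if y = x then scl_fla (?u [x]) (fgen x) else 0)"
    unfolding dynkin_1 by (intro sum.cong) auto
  also have "\<dots> = scl_fla (?u [x]) (fgen x)" by simp
  finally have 1: "dynkin 1 ?u = scl_fla (?u [x]) (fgen x)" by simp
  obtain N where N: "\<And>M. M \<ge> N \<Longrightarrow> h = (\<Sum>d=1..M. scl_fla (inv_nat d) (dynkin d ?u))"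
    using dynkin_reconstruction[of h] by blast
  have "h = (\<Sum>d=1..Suc N. scl_fla (inv_nat d) (dynkin d ?u))"
    by (rule N) simp
  also have "\<dots> = scl_fla (inv_nat 1) (dynkin 1 ?u)"
    by (subst sum.atLeast_Suc_atMost, simp, subst sum.neutral) (auto intro: d)
  finally show ?thesis unfolding 1 by (metis fla.scl_scl)
qed

end

subsection \<open>Components of degree greater than one\<close>

lemma brk_graded_2: "brk x y \<in> graded 2"
  using graded_brk[OF graded_1[of x] graded_1[of y]] by (simp add: numeral_2_eq_2)

lemma graded_2_induct [consumes 1, case_names brk zero add scl]:
  assumes "x \<in> graded 2" and brk: "\<And>x y. P (brk x y)" and zero: "P 0"
    and add: "\<And>x y. P x \<Longrightarrow> P y \<Longrightarrow> P (x + y)" and scl: "\<And>c x. P x \<Longrightarrow> P (scl_fla c x)"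
  shows "P x"
  using assms(1)
proof (induction rule: graded.induct)
  case (homogeneous d t)
  from homogeneous(2,1) show ?case
    by (induction rule: homogeneous.induct) (auto simp: fcls_simps assms)
qed (rule add)

lemma graded_2_minus: "x \<in> graded 2 \<Longrightarrow> - x \<in> graded 2"
  using graded_scl[of x 2 "- 1"] by simp

lemma graded_2_diff: "x \<in> graded 2 \<Longrightarrow> y \<in> graded 2 \<Longrightarrow> x - y \<in> graded 2"
  using graded.add[of x 2 "- y"] graded_2_minus[of y] by simp

lemma linear_part:
  "\<exists>c d y. y \<in> graded 2 \<and> x = scl_fla c (fgen E0) + scl_fla d (fgen E1) + y"
proof (induction x rule: fla_induct)
  case (gen g)
  show ?case
  proof (cases g)
    case E0
    show ?thesis
      by (rule exI[of _ 1], rule exI[of _ 0], rule exI[of _ 0]) (simp add: graded_zero E0)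
  next
    case E1
    show ?thesis
      by (rule exI[of _ 0], rule exI[of _ 1], rule exI[of _ 0]) (simp add: graded_zero E1)
  qed
next
  case zero
  show ?case
    by (rule exI[of _ 0], rule exI[of _ 0], rule exI[of _ 0]) (simp add: graded_zero)
next
  case (add x y)
  then obtain c d u c' d' v where
    "u \<in> graded 2" "x = scl_fla c (fgen E0) + scl_fla d (fgen E1) + u"
    "v \<in> graded 2" "y = scl_fla c' (fgen E0) + scl_fla d' (fgen E1) + v" by blast
  then have "u + v \<in> graded 2 \<and>
      x + y = scl_fla (c + c') (fgen E0) + scl_fla (d + d') (fgen E1) + (u + v)"
    by (simp add: fla.add_scl graded.add algebra_simps)
  then show ?case by blast
next
  case (scl a x)
  then obtain c d u where
    "u \<in> graded 2" "x = scl_fla c (fgen E0) + scl_fla d (fgen E1) + u" by blast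
  then have "scl_fla a u \<in> graded 2 \<and>
      scl_fla a x = scl_fla (a * c) (fgen E0) + scl_fla (a * d) (fgen E1) + scl_fla a u"
    by (simp add: fla.scl_add fla.scl_scl graded_scl)
  then show ?case by blast
next
  case (brk x y)
  show ?case
    by (rule exI[of _ 0], rule exI[of _ 0], rule exI[of _ "brk x y"]) (simp add: brk_graded_2)
qed

lemma sub_graded_2: "x \<in> graded 2 \<Longrightarrow> fla.sub x a b \<in> graded 2"
  by (induction rule: graded_2_induct) (auto simp: brk_graded_2 graded_zero graded.add graded_scl)

context typed_lie_algebra
begin

lemma sub_commuting:
  assumes "x \<in> graded 2" "brk a b = 0"
  shows "sub x a b = 0"
  using assms(1)
proof (induction rule: graded_2_induct)
  case (brk u v)
  have "brk a (sub v a b) = 0" "brk b (sub v a b) = 0"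
    using assms(2) brk_eq_0_swap[of a b] by (auto intro: sub_commute simp: brk_self)
  then have "brk (sub v a b) (sub u a b) = 0"
    by (intro sub_commute) (simp_all add: brk_eq_0_swap)
  then show ?case by (simp add: brk_eq_0_swap)
qed simp_all

text \<open>In all five cases the arguments commute. These are the evaluations that appear when a
  strand is forgotten.\<close>

lemma sub_zero_zero:
  "x \<in> graded 2 \<Longrightarrow> sub x 0 b = 0" "x \<in> graded 2 \<Longrightarrow> sub x a 0 = 0"
  "x \<in> graded 2 \<Longrightarrow> sub x a a = 0" "x \<in> graded 2 \<Longrightarrow> sub x a (- a) = 0"
  "x \<in> graded 2 \<Longrightarrow> sub x (- a) a = 0"
  by (simp_all add: sub_commuting brk_self brk_minus_left brk_minus_right)

text \<open>Only the linear part of \<open>x\<close> sees \<open>z\<close> and \<open>z'\<close>,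
  because inside a bracket they commute with everything that occurs.\<close>

lemma sub_shift:
  assumes z: "brk z a = 0" "brk z b = 0" and z': "brk z' a = 0" "brk z' b = 0" and zz: "brk z z' = 0"
  shows "\<exists>c d. sub x (a + z) (b + z') = sub x a b + scl c z + scl d z'"
proof (induction x rule: fla_induct)
  case (gen g)
  show ?case
  proof (cases g)
    case E0
    show ?thesis by (rule exI[of _ 1], rule exI[of _ 0]) (simp add: E0)
  next
    case E1
    show ?thesis by (rule exI[of _ 0], rule exI[of _ 1]) (simp add: E1)
  qed
next
  case zero
  show ?case by (rule exI[of _ 0], rule exI[of _ 0]) simp
next
  case (add x y)
  then obtain c d c' d' where
    "sub x (a + z) (b + z') = sub x a b + scl c z + scl d z'"
    "sub y (a + z) (b + z') = sub y a b + scl c' z + scl d' z'" by blast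
  then have "sub (x + y) (a + z) (b + z') = sub (x + y) a b + scl (c + c') z + scl (d + d') z'"
    by (simp add: add_scl algebra_simps)
  then show ?case by blast
next
  case (scl e x)
  then obtain c d where "sub x (a + z) (b + z') = sub x a b + scl c z + scl d z'" by blast
  then have "sub (scl_fla e x) (a + z) (b + z') = sub (scl_fla e x) a b + scl (e * c) z + scl (e * d) z'"
    by (simp add: scl_add scl_scl)
  then show ?case by blast
next
  case (brk x y)
  then obtain c d c' d' where
    e: "sub x (a + z) (b + z') = sub x a b + scl c z + scl d z'"
    "sub y (a + z) (b + z') = sub y a b + scl c' z + scl d' z'" by blast
  have zz': "brk z' z = 0"
    using zz brk_eq_0_swap by blast
  have "brk z (sub w a b) = 0" "brk z' (sub w a b) = 0" for w
    using z z' by (auto intro: sub_commute)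
  then have "brk z (sub w a b) = 0" "brk z' (sub w a b) = 0"
    "brk (sub w a b) z = 0" "brk (sub w a b) z' = 0" for w
    by (simp_all add: brk_eq_0_swap[of "sub w a b"])
  then have "sub (brk x y) (a + z) (b + z') = sub (brk x y) a b"
    using zz zz' by (simp add: e brk_linear brk_scl_left brk_scl_right brk_self)
  then show ?case by (intro exI[of _ 0]) simp
qed

lemma sub_graded_2_shift:
  assumes x: "x \<in> graded 2"
    and "brk z a = 0" "brk z b = 0" and "brk z' a = 0" "brk z' b = 0" and zz: "brk z z' = 0"
  shows "sub x (a + z) (b + z') = sub x a b"
  using x
proof (induction rule: graded_2_induct)
  case (brk x y)
  obtain c d c' d' where
    e: "sub x (a + z) (b + z') = sub x a b + scl c z + scl d z'"
    "sub y (a + z) (b + z') = sub y a b + scl c' z + scl d' z'"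
    using sub_shift[OF assms(2-6)] by metis
  have zz': "brk z' z = 0"
    using zz brk_eq_0_swap by blast
  have "brk z (sub w a b) = 0" "brk z' (sub w a b) = 0" for w
    using assms by (auto intro: sub_commute)
  then have "brk z (sub w a b) = 0" "brk z' (sub w a b) = 0"
    "brk (sub w a b) z = 0" "brk (sub w a b) z' = 0" for w
    by (simp_all add: brk_eq_0_swap[of "sub w a b"])
  then show ?case
    using zz zz' by (simp add: e brk_linear brk_scl_left brk_scl_right brk_self)
qed simp_all

text \<open>The working form of the shift: arguments may change by elements commuting with both
  arguments and with each other. In this way the pentagon and the hexagon are moved between
  strands.\<close>

lemma sub_graded_2_cong:
  assumes "x \<in> graded 2"
    and "brk (a' - a) a = 0" "brk (a' - a) b = 0" "brk (b' - b) a = 0" "brk (b' - b) b = 0"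
    and "brk (a' - a) (b' - b) = 0"
  shows "sub x a' b' = sub x a b"
  using sub_graded_2_shift[OF assms] by simp

end

lemma Rep_fla_GG_iff: "Rep_fla x \<in> GG \<longleftrightarrow> x \<in> graded 2"
proof
  have "\<exists>x. y = Rep_fla x \<and> x \<in> graded 2" if "y \<in> GG" for y :: "('k::comm_ring_1, egen) lie_elt"
    using that
  proof (induction rule: GG.induct)
    case (1 d y)
    then obtain t where "y = lie_class UNIV {} t" "homogeneous d t"
      by (auto simp: flie_component_def)
    then show ?case using 1(1) by (intro exI[of _ "fcls t"]) (auto simp: Rep_fcls intro: graded.homogeneous[of 2 d])
  next
    case (2 y z)
    then show ?case by (metis graded.add Rep_fla_simps(2) flie_def)
  qed
  then show "Rep_fla x \<in> GG \<Longrightarrow> x \<in> graded 2" by (metis Rep_fla_inject)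
next
  show "x \<in> graded 2 \<Longrightarrow> Rep_fla x \<in> GG"
  proof (induction rule: graded.induct)
    case (homogeneous d t)
    then show ?case
      by (intro GG.intros(1)[of d]) (auto simp: Rep_fcls flie_component_def)
  next
    case (add x y)
    then show ?case using GG.intros(2) by (simp add: Rep_fla_simps flie_def)
  qed
qed

instance egen :: finite
proof
  have "UNIV = {E0, E1}" using egen.exhaust by auto
  then show "finite (UNIV :: egen set)" by (metis finite.emptyI finite_insert)
qed

lemma (in rational_scalars) commute_fgen_graded_2:
  fixes h :: "'k fl2"
  assumes "h \<in> graded 2" "brk h (fgen g) = 0"
  shows "h = 0"
proof -
  obtain c where c: "h = scl_fla c (fgen g)"
    using commute_fgen[OF assms(2)] by blast
  \<comment> \<open>Sending both generators to \<open>fgen g\<close> fixes the multiple of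
    \<open>fgen g\<close> but kills degree at least two.\<close>
  have "fla.sub h (fgen g) (fgen g) = 0"
    by (rule fla.sub_zero_zero) fact
  then show ?thesis
    unfolding c by (cases g) simp_all
qed

section \<open>The Lie algebra of infinitesimal braids on four strands\<close>

definition tcls :: "('k::comm_ring_1, nat \<times> nat) lterm \<Rightarrow> 'k tt4" where
  "tcls t = Abs_tt4 (lie_class (tt_gens 4) (tt_rels 4) t)"

definition T :: "nat \<Rightarrow> nat \<Rightarrow> 'k::comm_ring_1 tt4" where
  "T i j = tcls (LGen (i, j))"

lemma Rep_tcls: "Rep_tt4 (tcls t) = lie_class (tt_gens 4) (tt_rels 4) t"
  by (simp add: tcls_def Abs_tt4_inverse tt_def lie_pres_simps)

lemma Rep_T: "Rep_tt4 (T i j) = tgen 4 i j"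
  by (simp add: T_def Rep_tcls tgen_def)

lemma tcls_simps:
  "tcls (LGen (i, j)) = T i j"
  "tcls LZero = 0" "tcls (LAdd s t) = tcls s + tcls t"
  "tcls (LScale c t) = scl_tt4 c (tcls t)" "tcls (LBrk s t) = brk (tcls s) (tcls t)"
  by (simp_all add: T_def Rep_tt4_inject[symmetric] Rep_tt4_simps Rep_tcls tt_def lie_pres_simps)

lemma tcls_surj: "\<exists>t. x = tcls t"
proof -
  obtain t where "Rep_tt4 x = lie_class (tt_gens 4) (tt_rels 4) t"
    using Rep_tt4[of x] by (auto simp: tt_def lie_pres_simps)
  then have "x = tcls t" by (simp add: Rep_tt4_inject[symmetric] Rep_tcls)
  then show ?thesis ..
qed

lemma tcls_eqI: "lie_cong (tt_gens 4) (tt_rels 4) s t \<Longrightarrow> tcls s = tcls t"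
  by (simp add: Rep_tt4_inject[symmetric] Rep_tcls lie_class_eq_iff)

lemma T_outside: "(i, j) \<notin> tt_gens 4 \<Longrightarrow> T i j = 0"
  unfolding T_def tcls_simps(2)[symmetric] by (intro tcls_eqI lie_cong.outside)

lemma T_sym: "T i j = T j i"
proof (cases "(i, j) \<in> tt_gens 4")
  case True
  then show ?thesis
    unfolding T_def
    by (intro tcls_eqI lie_cong.relation) (auto simp: tt_rels_def tt_gens_def)
next
  case False
  then have "(j, i) \<notin> tt_gens 4" by (auto simp: tt_gens_def)
  then show ?thesis using False by (simp add: T_outside)
qed

lemma T_triple: "{i, j, k} \<subseteq> {1..4} \<Longrightarrow> distinct [i, j, k] \<Longrightarrow> brk (T i j + T i k) (T j k) = 0"
  using tcls_eqI[OF lie_cong.relation, of "LBrk (LAdd (LGen (i, j)) (LGen (i, k))) (LGen (j, k))" LZero]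
  by (simp add: tcls_simps tt_rels_def)

lemma T_disjoint: "{i, j, k, l} \<subseteq> {1..4} \<Longrightarrow> distinct [i, j, k, l] \<Longrightarrow> brk (T i j) (T k l) = 0"
  using tcls_eqI[OF lie_cong.relation, of "LBrk (LGen (i, j)) (LGen (k, l))" LZero]
  by (simp add: tcls_simps tt_rels_def)

lemma tt4_induct [case_names gen zero add scl brk]:
  assumes "\<And>i j. (i, j) \<in> tt_gens 4 \<Longrightarrow> P (T i j)" "P 0" "\<And>x y. P x \<Longrightarrow> P y \<Longrightarrow> P (x + y)"
    "\<And>c x. P x \<Longrightarrow> P (scl_tt4 c x)" "\<And>x y. P x \<Longrightarrow> P y \<Longrightarrow> P (brk x y)"
  shows "P x"
proof -
  have "P (T i j)" for i j
    using assms(1)[of i j] assms(2) by (cases "(i, j) \<in> tt_gens 4") (simp_all add: T_outside)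
  then have "P (tcls t)" for t
    by (induction t) (auto simp: tcls_simps assms)
  then show ?thesis using tcls_surj[of x] by auto
qed

definition (in typed_lie_algebra) tlift :: "(nat \<Rightarrow> nat \<Rightarrow> 'a) \<Rightarrow> 'k tt4 \<Rightarrow> 'a" where
  "tlift f x = lie_lift (tt_gens 4) (typed_alg scl) (\<lambda>(i, j). f i j) (Rep_tt4 x)"

locale braid_images = typed_lie_algebra scl
  for scl :: "'k::comm_ring_1 \<Rightarrow> 'a::lie_ring \<Rightarrow> 'a" +
  fixes f :: "nat \<Rightarrow> nat \<Rightarrow> 'a"
  assumes sym: "\<And>i j. {i, j} \<subseteq> {1..4} \<Longrightarrow> i \<noteq> j \<Longrightarrow> f i j = f j i"
    and triple: "\<And>i j k. {i, j, k} \<subseteq> {1..4} \<Longrightarrow> distinct [i, j, k] \<Longrightarrow> brk (f i j + f i k) (f j k) = 0"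
    and disjoint: "\<And>i j k l. {i, j, k, l} \<subseteq> {1..4} \<Longrightarrow> distinct [i, j, k, l] \<Longrightarrow> brk (f i j) (f k l) = 0"
begin

lemma tlift_tcls:
  "tlift f (tcls t) =
    lie_eval (typed_alg scl) (\<lambda>g. if g \<in> tt_gens 4 then case g of (i, j) \<Rightarrow> f i j else 0) t"
  unfolding tlift_def Rep_tcls
proof (subst lie_lift_class[OF lie_algebra_typed])
  show "lie_eval (typed_alg scl) (\<lambda>g. if g \<in> tt_gens 4 then (case g of (i, j) \<Rightarrow> f i j)
      else lzero (typed_alg scl)) s = lie_eval (typed_alg scl)
      (\<lambda>g. if g \<in> tt_gens 4 then (case g of (i, j) \<Rightarrow> f i j) else lzero (typed_alg scl)) t"
    if "(s, t) \<in> tt_rels 4" for s t :: "('k, nat \<times> nat) lterm"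
    using that unfolding tt_rels_def
    by (elim UnE; clarsimp simp: tt_gens_def) (use sym triple disjoint in force)+
qed (simp_all cong: if_cong)

lemma tlift_hom: "typed_lie_hom scl_tt4 scl (tlift f)"
proof
  fix x y :: "'k tt4" and c
  obtain s t where st: "x = tcls s" "y = tcls t" using tcls_surj by blast
  show "tlift f (x + y) = tlift f x + tlift f y" "tlift f (scl_tt4 c x) = scl c (tlift f x)"
    "tlift f (brk x y) = brk (tlift f x) (tlift f y)"
    unfolding st by (simp_all add: tcls_simps(2-)[symmetric] tlift_tcls)
qed

lemma tlift_T: "{i, j} \<subseteq> {1..4} \<Longrightarrow> i \<noteq> j \<Longrightarrow> tlift f (T i j) = f i j"
  by (simp add: tcls_simps(1)[symmetric] tlift_tcls tt_gens_def)

end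

subsection \<open>Linear parts\<close>

text \<open>The scalars as an abelian Lie algebra, the target of the morphism \<open>lin p q\<close>
  that reads off the coefficient of \<open>T p q\<close> in degree one.\<close>

definition abel :: "('k::comm_ring_1, 'k) lie_alg" where
  "abel = \<lparr>lcarrier = UNIV, lzero = 0, ladd = (+), lscale = (*), lbrk = (\<lambda>_ _. 0)\<rparr>"

lemma lie_algebra_abel: "lie_algebra abel"
  by unfold_locales (simp_all add: abel_def algebra_simps)

definition lin :: "nat \<Rightarrow> nat \<Rightarrow> 'k::comm_ring_1 tt4 \<Rightarrow> 'k" where
  "lin p q x = lie_lift (tt_gens 4) abel (\<lambda>g. if g = (p, q) \<or> g = (q, p) then 1 else 0) (Rep_tt4 x)"

lemma lin_tcls: "lin p q (tcls t) = lie_eval abel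
    (\<lambda>g. if g \<in> tt_gens 4 then if g = (p, q) \<or> g = (q, p) then 1 else 0 else lzero abel) t"
  unfolding lin_def Rep_tcls
  by (rule lie_lift_class[OF lie_algebra_abel]) (auto simp: abel_def tt_rels_def tt_gens_def)

lemma lin_simps [simp]:
  "lin p q (x + y) = lin p q x + lin p q y" "lin p q (scl_tt4 c x) = c * lin p q x"
  "lin p q (brk x y) = 0" "lin p q 0 = 0"
proof -
  obtain s t where st: "x = tcls s" "y = tcls t" using tcls_surj by blast
  show "lin p q (x + y) = lin p q x + lin p q y" "lin p q (scl_tt4 c x) = c * lin p q x"
    "lin p q (brk x y) = 0"
    unfolding st by (simp_all add: tcls_simps(3-)[symmetric] lin_tcls) (simp_all add: abel_def)
  show "lin p q 0 = 0" by (simp add: tcls_simps(2)[symmetric] lin_tcls) (simp add: abel_def)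
qed

lemma lin_minus [simp]: "lin p q (- x) = - lin p q x"
  using lin_simps(2)[of p q "- 1" x] by simp

lemma lin_diff [simp]: "lin p q (x - y) = lin p q x - lin p q y"
  using lin_simps(1)[of p q x "- y"] by simp

lemma lin_T: "(i, j) \<in> tt_gens 4 \<Longrightarrow>
    lin p q (T i j) = (if (i, j) = (p, q) \<or> (i, j) = (q, p) then 1 else 0)"
  by (simp add: tcls_simps(1)[symmetric] lin_tcls)

lemma lin_sub [simp]: "x \<in> graded 2 \<Longrightarrow> lin p q (tt4.sub x a b) = 0"
  by (induction rule: graded_2_induct) simp_all

definition linpart :: "'k::comm_ring_1 tt4 \<Rightarrow> 'k tt4" where
  "linpart x = scl_tt4 (lin 1 2 x) (T 1 2) + scl_tt4 (lin 1 3 x) (T 1 3) + scl_tt4 (lin 1 4 x) (T 1 4)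
    + scl_tt4 (lin 2 3 x) (T 2 3) + scl_tt4 (lin 2 4 x) (T 2 4) + scl_tt4 (lin 3 4 x) (T 3 4)"

lemma linpart_add [simp]: "linpart (x + y) = linpart x + linpart y"
  by (simp add: linpart_def tt4.add_scl ac_simps)

lemma linpart_scl [simp]: "linpart (scl_tt4 c x) = scl_tt4 c (linpart x)"
  by (simp add: linpart_def tt4.scl_add tt4.scl_scl)

lemma linpart_minus [simp]: "linpart (- x) = - linpart x"
  using linpart_scl[of "- 1" x] by simp

lemma linpart_diff [simp]: "linpart (x - y) = linpart x - linpart y"
  using linpart_add[of x "- y"] by simp

lemmas T_ordered = T_sym[of 2 1] T_sym[of 3 1] T_sym[of 4 1] T_sym[of 3 2] T_sym[of 4 2] T_sym[of 4 3]

lemma linpart_T: "(i, j) \<in> tt_gens 4 \<Longrightarrow> linpart (T i j) = T i j"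
proof -
  assume a: "(i, j) \<in> tt_gens 4"
  then have "i \<in> {1, 2, 3, 4}" "j \<in> {1, 2, 3, 4}" "i \<noteq> j" by (auto simp: tt_gens_def)
  then show ?thesis
    unfolding linpart_def
    by (auto simp: lin_T tt_gens_def T_ordered simp del: One_nat_def)
qed

lemma linpart_sub [simp]: "x \<in> graded 2 \<Longrightarrow> linpart (tt4.sub x a b) = 0"
  by (simp add: linpart_def)

subsection \<open>The centre\<close>

definition TT :: "'k::comm_ring_1 tt4" where
  "TT = T 1 2 + T 1 3 + T 1 4 + T 2 3 + T 2 4 + T 3 4"

lemma brk_T_pair:
  assumes "{p, q, k} \<subseteq> {1..4}" "distinct [p, q, k]"
  shows "brk (T p q) (T p k) = brk (T p k) (T q k)"
proof -
  have "brk (T q p + T q k) (T p k) = 0"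
    by (rule T_triple) (use assms in auto)
  then have "brk (T q p) (T p k) = - brk (T q k) (T p k)"
    by (simp add: brk_add_left eq_neg_iff_add_eq_0)
  then show ?thesis by (simp add: T_sym[of p q] brk_swap[of "T p k" "T q k"])
qed

text \<open>A labelling of the four strands: \<open>k\<close> is the strand of the fibre, and
  \<open>T i j\<close> the generator whose centraliser is sought.\<close>

locale labels =
  fixes i j k l :: nat
  assumes distinct: "distinct [i, j, k, l]" and set_eq: "{1..4} = {i, j, k, l}"
begin

lemma neq [simp]: "i \<noteq> j" "i \<noteq> k" "i \<noteq> l" "j \<noteq> k" "j \<noteq> l" "k \<noteq> l"
    "j \<noteq> i" "k \<noteq> i" "l \<noteq> i" "k \<noteq> j" "l \<noteq> j" "l \<noteq> k"
  using distinct by auto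

lemma mem_range: "i \<in> {1..4}" "j \<in> {1..4}" "k \<in> {1..4}" "l \<in> {1..4}"
  unfolding set_eq by auto

end

lemma labelsI: "distinct [i, j, k, l] \<Longrightarrow> {i, j, k, l} \<subseteq> {1..4} \<Longrightarrow> labels i j k l"
  by unfold_locales (simp, rule card_subset_eq[symmetric], simp_all)

lemma (in labels) sum_T_central:
  "brk (T i j + T i k + T i l + T j k + T j l + T k l) (T i j :: 'k::comm_ring_1 tt4) = 0"
proof -
  have "brk (T k i + T k j) (T i j :: 'k tt4) = 0" "brk (T l i + T l j) (T i j :: 'k tt4) = 0"
    by (rule T_triple; use mem_range in simp)+
  moreover have "brk (T k l) (T i j :: 'k tt4) = 0"
    by (rule T_disjoint) (use mem_range in simp_all)
  moreover have "T i j + T i k + T i l + T j k + T j l + T k l =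
      T i j + (T k i + T k j) + (T l i + T l j) + (T k l :: 'k tt4)"
    by (simp add: T_sym[of i k] T_sym[of i l] T_sym[of j k] T_sym[of j l] ac_simps)
  ultimately show ?thesis
    by (simp only: brk_add_left[of _ "T k l"] brk_add_left[of _ "T l i + T l j"]
        brk_add_left[of _ "T k i + T k j"]) (simp only: brk_self add_0)
qed

lemma TT_central: "brk TT (x :: 'k::comm_ring_1 tt4) = 0"
proof (induction x rule: tt4_induct)
  case (gen i j)
  have *: "brk TT (T p q :: 'k tt4) = 0" if "labels p q r s"
    "TT = T p q + T p r + T p s + T q r + T q s + (T r s :: 'k tt4)" for p q r s
    unfolding that(2) by (rule labels.sum_T_central[OF that(1)])
  have "brk TT (T 1 2 :: 'k tt4) = 0"
    by (rule *[of 1 2 3 4], rule labelsI) (simp_all add: TT_def T_ordered ac_simps del: One_nat_def)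
  moreover have "brk TT (T 1 3 :: 'k tt4) = 0"
    by (rule *[of 1 3 2 4], rule labelsI) (simp_all add: TT_def T_ordered ac_simps del: One_nat_def)
  moreover have "brk TT (T 1 4 :: 'k tt4) = 0"
    by (rule *[of 1 4 2 3], rule labelsI) (simp_all add: TT_def T_ordered ac_simps del: One_nat_def)
  moreover have "brk TT (T 2 3 :: 'k tt4) = 0"
    by (rule *[of 2 3 1 4], rule labelsI) (simp_all add: TT_def T_ordered ac_simps del: One_nat_def)
  moreover have "brk TT (T 2 4 :: 'k tt4) = 0"
    by (rule *[of 2 4 1 3], rule labelsI) (simp_all add: TT_def T_ordered ac_simps del: One_nat_def)
  moreover have "brk TT (T 3 4 :: 'k tt4) = 0"
    by (rule *[of 3 4 1 2], rule labelsI) (simp_all add: TT_def T_ordered ac_simps del: One_nat_def)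
  moreover have "i \<in> {1, 2, 3, 4}" "j \<in> {1, 2, 3, 4}" "i \<noteq> j" using gen by (auto simp: tt_gens_def)
  ultimately show ?case
    by (auto simp: T_ordered simp del: One_nat_def)
qed (simp_all add: brk_add_right tt4.brk_scl_right brk_brk_right)

lemma TT_central': "brk x TT = 0"
  using TT_central brk_eq_0_swap by blast

subsection \<open>Derivations as operators on words\<close>

lemma act_Nil: "app (act p) u [] = 0"
  by (induction p arbitrary: u rule: fla_induct) (simp_all add: app_simps app_scl)

text \<open>Coefficient at a word of the derivation extending \<open>d\<close>, applied to the
  series \<open>u\<close>: write \<open>u\<close> as the sum of \<open>x u_x\<close> over the
  letters \<open>x\<close> and apply the Leibniz rule. The empty word gets 0 because Lie elements
  have no constant term.\<close>

primrec derw :: "('g::finite \<Rightarrow> ('k::comm_ring_1, 'g) fla) \<Rightarrow> 'g list \<Rightarrow> ('g list \<Rightarrow> 'k) \<Rightarrow> 'k" where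
  "derw d [] u = 0"
| "derw d (y # w) u = (\<Sum>x\<in>UNIV. app (act (d x)) (\<lambda>v. u (x # v)) (y # w)) + derw d w (\<lambda>v. u (y # v))"

lemma derw_add: "derw d w (\<lambda>v. u v + u' v) = derw d w u + derw d w u'"
  by (induction w arbitrary: u u') (simp_all add: app_add sum.distrib algebra_simps)

lemma derw_scale: "derw d w (\<lambda>v. c * u v) = c * derw d w u"
  by (induction w arbitrary: u) (simp_all add: app_scale sum_distrib_left algebra_simps)

lemma derw_zero: "derw d w (\<lambda>v. 0) = 0"
  by (induction w) (simp_all add: app_zero)

lift_definition der :: "('g::finite \<Rightarrow> ('k::comm_ring_1, 'g) fla) \<Rightarrow> ('k, 'g) opr"
  is "\<lambda>d u w. derw d w u"
  by (simp add: derw_add derw_scale)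

lemma app_der: "app (der d) u w = derw d w u"
  by transfer simp

lemma brk_der_prep: "brk (der d) (prep x) = act (d x)"
proof (rule opr_eqI)
  fix u w
  show "app (brk (der d) (prep x)) u w = app (act (d x)) u w"
  proof (cases w)
    case Nil
    then show ?thesis by (simp add: app_simps app_der act_Nil)
  next
    case (Cons y v)
    have "(\<Sum>z\<in>UNIV. app (act (d z)) (\<lambda>v. app (prep x) u (z # v)) (y # v)) =
        (\<Sum>z\<in>UNIV. if z = x then app (act (d x)) u (y # v) else 0)"
      by (rule sum.cong) (auto simp: app_zero)
    then show ?thesis
      using Cons by (cases "y = x") (simp_all add: app_simps app_der derw_zero)
  qed
qed

lemma der_one_word: "app (der d) one_word = (\<lambda>w. 0)"
proof
  fix w
  show "app (der d) one_word w = 0"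
    by (cases w) (simp_all add: app_der one_word_def app_zero derw_zero)
qed

text \<open>Such an operator is determined by its value at 1. As series may be infinite, this is
  verified one coefficient at a time, peeling off the first letter.\<close>

lemma opr_eq_0:
  fixes Q :: "('k::comm_ring_1, 'g::finite) opr"
  assumes comm: "\<And>x. brk Q (prep x) = 0" and one: "app Q one_word = (\<lambda>w. 0)"
  shows "Q = 0"
proof (rule opr_eqI)
  fix u w
  have Q: "app Q (app (prep x) u) w = app (prep x) (app Q u) w" for x u w
    using arg_cong[OF comm[of x], of "\<lambda>P. app P u w"] by (simp add: app_simps)
  have decomp: "u = (\<lambda>w. u [] * one_word w + (\<Sum>x\<in>UNIV. app (prep x) (\<lambda>v. u (x # v)) w))"
    for u :: "'g list \<Rightarrow> 'k"
  proof
    fix w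
    show "u w = u [] * one_word w + (\<Sum>x\<in>UNIV. app (prep x) (\<lambda>v. u (x # v)) w)"
      by (cases w) (simp_all add: one_word_def)
  qed
  have app_sum: "app Q (\<lambda>w. \<Sum>x\<in>A. f x w) w = (\<Sum>x\<in>A. app Q (f x) w)"
    for f :: "'g \<Rightarrow> 'g list \<Rightarrow> 'k" and A w
    by (induction A rule: infinite_finite_induct) (simp_all add: app_zero app_add)
  have step: "app Q u w = (\<Sum>x\<in>UNIV. app (prep x) (app Q (\<lambda>v. u (x # v))) w)" for u w
    by (subst decomp, subst app_add) (simp add: app_scale one app_sum Q)
  show "app Q u w = app 0 u w"
  proof (induction w arbitrary: u)
    case (Cons y w)
    have "app Q u (y # w) = app Q (\<lambda>v. u (y # v)) w"
      by (subst step) simp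
    then show ?case using Cons by (simp add: app_simps)
  qed (subst step, simp add: app_simps)
qed

subsection \<open>The action of the base on the fibre\<close>

text \<open>The letters stand for \<open>t\<^sub>i\<^sub>k\<close>, \<open>t\<^sub>i\<^sub>k + t\<^sub>j\<^sub>k\<close> and \<open>t\<^sub>l\<^sub>k\<close>: the second one is annihilated by
  \<open>t\<^sub>i\<^sub>j\<close>, which makes the kernel of its action visible.\<close>

datatype fib = FA | FS | FC

lemma UNIV_fib: "UNIV = {FA, FS, FC}"
  using fib.exhaust by auto

instance fib :: finite
  by standard (simp add: UNIV_fib)

text \<open>Here \<open>a\<close>, \<open>b\<close>, \<open>c\<close> stand for
  \<open>T i k\<close>, \<open>T j k\<close>, \<open>T l k\<close> and \<open>p\<close>,
  \<open>q\<close>, \<open>r\<close> for \<open>T i j\<close>, \<open>T i l\<close>,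
  \<open>T j l\<close>. The assumptions are the brackets forced by the relations of
  \<open>tt 4\<close>; conversely they make the relations among \<open>p\<close>, \<open>q\<close>,
  \<open>r\<close> act trivially on the letters.\<close>

locale base_action =
  fixes a b c p q r :: "'a::lie_ring"
  assumes p: "brk p a = brk a b" "brk p b = brk b a" "brk p c = 0"
    and q: "brk q a = brk a c" "brk q b = 0" "brk q c = brk c a"
    and r: "brk r a = 0" "brk r b = brk b c" "brk r c = brk c b"
begin

lemma expand:
  "brk (brk p q) x = brk p (brk q x) - brk q (brk p x)"
  "brk (brk p r) x = brk p (brk r x) - brk r (brk p x)"
  "brk (brk q r) x = brk q (brk r x) - brk r (brk q x)"
  "brk (brk q p) x = brk q (brk p x) - brk p (brk q x)"
  "brk (brk r p) x = brk r (brk p x) - brk p (brk r x)"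
  "brk (brk r q) x = brk r (brk q x) - brk q (brk r x)"
  by (rule brk_brk_left)+

lemma derivation_rules:
  "brk p (brk x y) = brk (brk p x) y + brk x (brk p y)"
  "brk q (brk x y) = brk (brk q x) y + brk x (brk q y)"
  "brk r (brk x y) = brk (brk r x) y + brk x (brk r y)"
  by (rule brk_brk_right)+

lemma letters:
  "brk (brk a b) x = brk a (brk b x) - brk b (brk a x)"
  "brk (brk a c) x = brk a (brk c x) - brk c (brk a x)"
  "brk (brk b c) x = brk b (brk c x) - brk c (brk b x)"
  "brk b a = - brk a b" "brk c a = - brk a c" "brk c b = - brk b c"
  "brk c (brk a b) = brk b (brk a c) - brk a (brk b c)"
proof -
  show "brk b a = - brk a b" "brk c a = - brk a c" "brk c b = - brk b c"
    by (rule brk_swap)+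
  have "brk a (brk b c) + brk b (- brk a c) + brk c (brk a b) = 0"
    using jacobi[of a b c] brk_swap[of c a] by simp
  then show "brk c (brk a b) = brk b (brk a c) - brk a (brk b c)"
    by (simp add: brk_minus_right algebra_simps)
qed (rule brk_brk_left)+

lemma relations:
  "brk (brk (p + q) r) a = 0" "brk (brk (p + q) r) b = 0" "brk (brk (p + q) r) c = 0"
  "brk (brk (p + r) q) a = 0" "brk (brk (p + r) q) b = 0" "brk (brk (p + r) q) c = 0"
  "brk (brk (q + r) p) a = 0" "brk (brk (q + r) p) b = 0" "brk (brk (q + r) p) c = 0"
  by (simp_all add: brk_add_left expand derivation_rules p q r brk_self)
    (simp_all add: brk_linear letters brk_self)

end

abbreviation (input) gA :: "('k::comm_ring_1, fib) fla" where "gA \<equiv> fgen FA"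
abbreviation (input) gB :: "('k::comm_ring_1, fib) fla" where "gB \<equiv> fgen FS - fgen FA"
abbreviation (input) gC :: "('k::comm_ring_1, fib) fla" where "gC \<equiv> fgen FC"

definition dAB :: "('k::comm_ring_1, fib) opr" where
  "dAB = der (\<lambda>x. case x of FA \<Rightarrow> brk gA gB | FS \<Rightarrow> 0 | FC \<Rightarrow> 0)"

definition dAC :: "('k::comm_ring_1, fib) opr" where
  "dAC = der (\<lambda>x. case x of FA \<Rightarrow> brk gA gC | FS \<Rightarrow> brk gA gC | FC \<Rightarrow> brk gC gA)"

definition dBC :: "('k::comm_ring_1, fib) opr" where
  "dBC = der (\<lambda>x. case x of FA \<Rightarrow> 0 | FS \<Rightarrow> brk gB gC | FC \<Rightarrow> brk gC gB)"

lemma brk_d_prep: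
  "brk dAB (prep FA) = act (brk gA gB)" "brk dAB (prep FS) = 0" "brk dAB (prep FC) = 0"
  "brk dAC (prep FA) = act (brk gA gC)" "brk dAC (prep FS) = act (brk gA gC)"
  "brk dAC (prep FC) = act (brk gC gA)"
  "brk dBC (prep FA) = 0" "brk dBC (prep FS) = act (brk gB gC)" "brk dBC (prep FC) = act (brk gC gB)"
  by (simp_all add: dAB_def dAC_def dBC_def brk_der_prep)

lemma app_d_one_word:
  "app dAB one_word = (\<lambda>w. 0)" "app dAC one_word = (\<lambda>w. 0)" "app dBC one_word = (\<lambda>w. 0)"
  by (simp_all add: dAB_def dAC_def dBC_def der_one_word)

interpretation fibre: base_action "prep FA :: ('k::comm_ring_1, fib) opr" "prep FS - prep FA"
  "prep FC" dAB dAC dBC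
  by unfold_locales
    (simp_all add: brk_d_prep brk_linear brk_self brk_swap[of "prep FS" "prep FA"])

lemma opr_fib_eq_0:
  fixes Q :: "('k::comm_ring_1, fib) opr"
  assumes "brk Q (prep FA) = 0" "brk Q (prep FS - prep FA) = 0" "brk Q (prep FC) = 0"
    "app Q one_word = (\<lambda>w. 0)"
  shows "Q = 0"
proof (rule opr_eq_0)
  show "brk Q (prep x) = 0" for x using assms by (cases x) (auto simp: brk_diff_right)
qed (rule assms)

text \<open>Each bracket annihilates the series 1 and, by \<open>fibre.relations\<close>, commutes
  with multiplication by the letters.\<close>

lemma brk_d_d:
  "brk (dAB + dAC) (dBC :: ('k::comm_ring_1, fib) opr) = 0"
  "brk (dAB + dBC) (dAC :: ('k::comm_ring_1, fib) opr) = 0"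
  "brk (dAC + dBC) (dAB :: ('k::comm_ring_1, fib) opr) = 0"
  by (rule opr_fib_eq_0; simp add: fibre.relations app_op app_d_one_word app_zero)+

lemma brk_d_d':
  "brk (dAC + dAB) (dBC :: ('k::comm_ring_1, fib) opr) = 0"
  "brk (dBC + dAB) (dAC :: ('k::comm_ring_1, fib) opr) = 0"
  "brk (dBC + dAC) (dAB :: ('k::comm_ring_1, fib) opr) = 0"
  using brk_d_d by (simp_all add: add.commute)

context labels
begin

text \<open>The semidirect product realised on series: generators involving strand \<open>k\<close>
  are left multiplications, the others derivations.\<close>

definition rho :: "nat \<Rightarrow> nat \<Rightarrow> ('k::comm_ring_1, fib) opr" where
  "rho p q =
     (if (p, q) \<in> {(i, k), (k, i)} then prep FA
      else if (p, q) \<in> {(j, k), (k, j)} then prep FS - prep FA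
      else if (p, q) \<in> {(l, k), (k, l)} then prep FC
      else if (p, q) \<in> {(i, j), (j, i)} then dAB
      else if (p, q) \<in> {(i, l), (l, i)} then dAC
      else if (p, q) \<in> {(j, l), (l, j)} then dBC else 0)"

lemma rho_simps [simp]:
  "rho i k = prep FA" "rho k i = prep FA"
  "rho j k = prep FS - prep FA" "rho k j = prep FS - prep FA"
  "rho l k = prep FC" "rho k l = prep FC"
  "rho i j = dAB" "rho j i = dAB" "rho i l = dAC" "rho l i = dAC" "rho j l = dBC" "rho l j = dBC"
  by (simp_all add: rho_def)

lemma braid_images_rho: "braid_images scl_opr (rho :: nat \<Rightarrow> nat \<Rightarrow> ('k::comm_ring_1, fib) opr)"
proof
  fix p q :: nat assume "{p, q} \<subseteq> {1..4}" "p \<noteq> q"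
  then show "rho p q = (rho q p :: ('k, fib) opr)"
    unfolding set_eq by auto
next
  fix p q s :: nat assume "{p, q, s} \<subseteq> {1..4}" "distinct [p, q, s]"
  moreover have sw: "brk (prep FC) (prep FA :: ('k, fib) opr) = - brk (prep FA) (prep FC)"
    "brk (prep FS) (prep FA :: ('k, fib) opr) = - brk (prep FA) (prep FS)"
    "brk (prep FC) (prep FS :: ('k, fib) opr) = - brk (prep FS) (prep FC)"
    "brk (prep x) dAB = - brk dAB (prep x :: ('k, fib) opr)"
    "brk (prep x) dAC = - brk dAC (prep x :: ('k, fib) opr)"
    "brk (prep x) dBC = - brk dBC (prep x :: ('k, fib) opr)" for x
    by (rule brk_swap)+
  ultimately show "brk (rho p q + rho p s) (rho q s :: ('k, fib) opr) = 0"
    unfolding set_eq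
    using brk_d_d[where 'k='k] brk_d_d'[where 'k='k]
    by (auto simp: brk_linear brk_self sw brk_d_prep)
next
  fix p q s t :: nat assume "{p, q, s, t} \<subseteq> {1..4}" "distinct [p, q, s, t]"
  then show "brk (rho p q) (rho s t :: ('k, fib) opr) = 0"
    unfolding set_eq
    by (auto simp: brk_diff_right brk_diff_left brk_d_prep brk_eq_0_swap[of "prep _" dAB]
      brk_eq_0_swap[of "prep _" dAC] brk_eq_0_swap[of "prep _" dBC] 
      brk_swap[of "prep _" dAB] brk_swap[of "prep _" dAC] brk_swap[of "prep _" dBC])
qed

end

subsection \<open>Centralisers of generators\<close>

text \<open>The derivation of \<open>dAB\<close> in the letters of \<open>fib\<close>: since
  \<open>FS\<close> is killed, it only replaces an \<open>FA\<close> by the commutator of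
  \<open>FA\<close> and \<open>FS\<close>.\<close>

definition dAS :: "fib \<Rightarrow> ('k::comm_ring_1, fib) fla" where
  "dAS x = (case x of FA \<Rightarrow> brk (fgen FA) (fgen FS) | FS \<Rightarrow> 0 | FC \<Rightarrow> 0)"

lemma dAB_eq: "dAB = der dAS"
  unfolding dAB_def dAS_def[abs_def] by (simp add: brk_diff_right brk_self)

lemma derw_dAS:
  "derw dAS (y # w) u = (case w of [] \<Rightarrow> 0 | z # v \<Rightarrow>
     (if y = FA \<and> z = FS then u (FA # v) else 0) - (if y = FS \<and> z = FA then u (FA # v) else 0)) +
     derw dAS w (\<lambda>v. u (y # v))"
  by (simp add: UNIV_fib dAS_def app_simps split: list.split)

lemma derw_dAS_length:
  "(\<And>v. Suc (length v) = length w \<Longrightarrow> u v = 0) \<Longrightarrow> derw dAS w u = 0"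
proof (induction w arbitrary: u)
  case (Cons y w)
  then have "derw dAS w (\<lambda>v. u (y # v)) = 0" by (intro Cons.IH) simp
  then show ?case
    using Cons.prems by (auto simp: derw_dAS simp del: derw.simps split: list.split)
qed simp

text \<open>A pair of neighbours that contributes contains \<open>FA\<close>, so nothing happens
  inside a prefix without \<open>FA\<close> nor at its border with \<open>FS\<close>.\<close>

lemma derw_dAS_prefix:
  "FA \<notin> set p \<Longrightarrow> derw dAS (p @ FS # FA # q) u = derw dAS (FS # FA # q) (\<lambda>v. u (p @ v))"
proof (induction p arbitrary: u)
  case (Cons y p)
  then have "derw dAS ((y # p) @ FS # FA # q) u = derw dAS (p @ FS # FA # q) (\<lambda>v. u (y # v))"
    by (cases p) (auto simp: derw_dAS simp del: derw.simps)
  then show ?case using Cons by simp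
qed simp

text \<open>The coefficient of \<open>p S A q\<close> in the image expresses \<open>u (p A q)\<close> through values of \<open>u\<close> at words
  with a longer prefix free of \<open>A\<close> and a shorter remainder.\<close>

lemma kernel_dAS:
  assumes "\<And>w. derw dAS w u = 0"
  shows "FA \<notin> set p \<Longrightarrow> u (p @ FA # q) = 0"
proof (induction "length q" arbitrary: p q rule: less_induct)
  case less
  have IH: "u (p @ FS # FA # q') = 0" if "length q' < length q" for q'
    using less.hyps[OF that, of "p @ [FS]"] less.prems by simp
  have "derw dAS q (\<lambda>v. u (p @ FS # FA # v)) = 0"
    by (rule derw_dAS_length) (simp add: IH)
  then have "derw dAS (FA # q) (\<lambda>v. u (p @ FS # v)) = 0"
    by (auto simp: derw_dAS IH simp del: derw.simps split: list.split)
  moreover have "derw dAS (p @ FS # FA # q) u = 0" by (rule assms)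
  ultimately show ?case
    unfolding derw_dAS_prefix[OF less.prems] by (simp add: derw_dAS[of FS] del: derw.simps)
qed

lemma kernel_dAS':
  assumes "\<And>w. derw dAS w u = 0" "FA \<in> set w"
  shows "u w = 0"
proof -
  obtain p q where "w = p @ FA # q" "FA \<notin> set p"
    using split_list_first[OF assms(2)] by blast
  then show ?thesis using kernel_dAS[OF assms(1)] by simp
qed

definition kill_FA :: "('k::comm_ring_1, fib) fla \<Rightarrow> ('k, fib) fla" where
  "kill_FA = fla.fl (case_fib 0 (fgen FS) (fgen FC))"

lemma act_kill_FA:
  "app (act (kill_FA x)) (\<lambda>w. if FA \<in> set w then 0 else u w) =
    (\<lambda>w. if FA \<in> set w then 0 else app (act x) u w)"
proof (induction x arbitrary: u rule: fla_induct)
  case (gen g)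
  show ?case
  proof
    fix w
    show "app (act (kill_FA (fgen g))) (\<lambda>w. if FA \<in> set w then 0 else u w) w =
        (if FA \<in> set w then 0 else app (act (fgen g)) u w)"
      by (cases w; cases g) (auto simp: kill_FA_def app_simps)
  qed
next
  case (brk x y)
  have "kill_FA (brk x y) = brk (kill_FA x) (kill_FA y)" by (simp add: kill_FA_def)
  then show ?case by (auto simp: app_op brk fun_eq_iff)
qed (simp_all add: kill_FA_def fun_eq_iff app_simps app_op app_scl)

text \<open>As \<open>dAB\<close> annihilates 1, it also annihilates the series of \<open>f\<close>,
  which therefore has no word containing \<open>FA\<close>. Since coefficients determine Lie
  elements, \<open>f\<close> itself does not involve \<open>FA\<close>.\<close>

lemma (in rational_scalars) kernel_dAB:
  fixes f :: "('k, fib) fla"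
  assumes "brk dAB (act f) = 0"
  shows "kill_FA f = f"
proof -
  let ?u = "app (act f) one_word"
  have "app (brk dAB (act f)) one_word = (\<lambda>w. 0)"
    unfolding assms by (simp add: fun_eq_iff app_simps)
  then have "app dAB ?u = (\<lambda>w. 0)"
    by (simp add: app_op app_d_one_word app_zero)
  then have "derw dAS w ?u = 0" for w
    by (metis app_der dAB_eq)
  then have u: "?u w = 0" if "FA \<in> set w" for w
    using kernel_dAS' that by blast
  have "(\<lambda>w. if FA \<in> set w then 0 else one_word w) = (one_word :: fib list \<Rightarrow> 'k)"
    by (auto simp: one_word_def fun_eq_iff)
  then have "app (act (kill_FA f)) one_word = (\<lambda>w. if FA \<in> set w then 0 else ?u w)"
    using act_kill_FA[of f one_word] by simp
  also have "\<dots> = ?u" using u by (auto simp: fun_eq_iff)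
  finally have "app (act (kill_FA f - f)) one_word = (\<lambda>w. 0)"
    by (simp add: app_op)
  then have "kill_FA f - f = 0" by (rule act_eq_0)
  then show ?thesis by simp
qed

lemma (in typed_lie_algebra) fl_kill_FA:
  "fl v (kill_FA x) = sub (fla.fl (case_fib 0 (fgen E1) (fgen E0)) x) (v FC) (v FS)"
proof -
  interpret h: typed_lie_hom scl_fla scl "fl v" by (rule fl_hom)
  interpret s: typed_lie_hom scl_fla scl "\<lambda>x. sub x (v FC) (v FS)" by (rule sub_hom)
  have "(\<lambda>g. fl v (case_fib 0 (fgen FS) (fgen FC) g)) =
      (\<lambda>g. sub (case_fib 0 (fgen E1) (fgen E0) g) (v FC) (v FS))"
    by (auto split: fib.split)
  then show ?thesis unfolding kill_FA_def h.hom_fl s.hom_fl by simp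
qed

context labels
begin

text \<open>Strand \<open>k\<close> is forgotten and the remaining Lie algebra divided by its
  centre: the images of \<open>T i j\<close>, \<open>T j l\<close>, \<open>T i l\<close> add up to
  zero.\<close>

definition forget_strand :: "nat \<Rightarrow> nat \<Rightarrow> 'k::comm_ring_1 fl2" where
  "forget_strand p q =
     (if (p, q) \<in> {(i, j), (j, i)} then fgen E1
      else if (p, q) \<in> {(j, l), (l, j)} then fgen E0
      else if (p, q) \<in> {(i, l), (l, i)} then - fgen E0 - fgen E1 else 0)"

lemma forget_strand_simps [simp]:
  "forget_strand i j = fgen E1" "forget_strand j i = fgen E1" "forget_strand j l = fgen E0" "forget_strand l j = fgen E0"
  "forget_strand i l = - fgen E0 - fgen E1" "forget_strand l i = - fgen E0 - fgen E1"
  "forget_strand i k = 0" "forget_strand k i = 0" "forget_strand j k = 0" "forget_strand k j = 0" "forget_strand l k = 0" "forget_strand k l = 0"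
  by (simp_all add: forget_strand_def)

lemma braid_images_forget_strand: "braid_images scl_fla (forget_strand :: nat \<Rightarrow> nat \<Rightarrow> 'k::comm_ring_1 fl2)"
proof
  fix p q :: nat assume "{p, q} \<subseteq> {1..4}" "p \<noteq> q"
  then show "forget_strand p q = (forget_strand q p :: 'k fl2)"
    unfolding set_eq by auto
next
  fix p q s :: nat assume "{p, q, s} \<subseteq> {1..4}" "distinct [p, q, s]"
  then show "brk (forget_strand p q + forget_strand p s) (forget_strand q s :: 'k fl2) = 0"
    unfolding set_eq
    by (auto simp: brk_linear brk_self brk_swap[of "fgen E1" "fgen E0"])
next
  fix p q s t :: nat assume "{p, q, s, t} \<subseteq> {1..4}" "distinct [p, q, s, t]"
  then show "brk (forget_strand p q) (forget_strand s t :: 'k fl2) = 0"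
    unfolding set_eq by auto
qed

definition fibmap :: "fib \<Rightarrow> 'k::comm_ring_1 tt4" where
  "fibmap = case_fib (T i k) (T i k + T j k) (T l k)"

lemma fibmap_simps [simp]:
  "fibmap FA = T i k" "fibmap FS = T i k + T j k" "fibmap FC = T l k"
  by (simp_all add: fibmap_def)

abbreviation (input) fibre :: "'k::comm_ring_1 tt4 set" where
  "fibre \<equiv> range (tt4.fl fibmap)"

lemma fibre_add: "x \<in> fibre \<Longrightarrow> y \<in> fibre \<Longrightarrow> x + y \<in> fibre"
  by (auto simp: tt4.fl_simps(3)[symmetric] simp del: tt4.fl_simps)

lemma fibre_scl: "x \<in> fibre \<Longrightarrow> scl_tt4 c x \<in> fibre"
  by (auto simp: tt4.fl_simps(4)[symmetric] simp del: tt4.fl_simps)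

lemma fibre_brk: "x \<in> fibre \<Longrightarrow> y \<in> fibre \<Longrightarrow> brk x y \<in> fibre"
  by (auto simp: tt4.fl_simps(5)[symmetric] simp del: tt4.fl_simps)

lemma fibre_minus: "x \<in> fibre \<Longrightarrow> - x \<in> fibre"
  by (auto simp: tt4.fl_minus[symmetric] simp del: tt4.fl_minus)

lemma fibre_diff: "x \<in> fibre \<Longrightarrow> y \<in> fibre \<Longrightarrow> x - y \<in> fibre"
  using fibre_add[of x "- y"] fibre_minus[of y] by simp

lemma fibre_zero: "0 \<in> fibre"
  by (metis rangeI tt4.fl_simps(2))

lemma fibre_T: "T i k \<in> fibre" "T j k \<in> fibre" "T l k \<in> fibre"
proof -
  have "T i k = tt4.fl fibmap (fgen FA)" "T j k = tt4.fl fibmap (fgen FS - fgen FA)"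
    "T l k = tt4.fl fibmap (fgen FC)" by simp_all
  then show "T i k \<in> fibre" "T j k \<in> fibre" "T l k \<in> fibre" by (metis rangeI)+
qed

lemma brk_T_fibre:
  "brk (T i j) (T i k) = brk (T i k) (T j k)" "brk (T i j) (T j k) = brk (T j k) (T i k)"
  "brk (T i j) (T l k) = 0"
  "brk (T j l) (T j k) = brk (T j k) (T l k)" "brk (T j l) (T l k) = brk (T l k) (T j k)"
  "brk (T j l) (T i k) = 0"
proof -
  show "brk (T i j) (T i k) = brk (T i k) (T j k)" "brk (T j l) (T j k) = brk (T j k) (T l k)"
    by (intro brk_T_pair; use mem_range in simp)+
  show "brk (T i j) (T j k) = brk (T j k) (T i k)" "brk (T j l) (T l k) = brk (T l k) (T j k)"
    unfolding T_sym[of i j] T_sym[of j l] by (intro brk_T_pair; use mem_range in simp)+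
  show "brk (T i j) (T l k) = 0" "brk (T j l) (T i k) = 0"
    by (intro T_disjoint; use mem_range in simp)+
qed

text \<open>For the base, \<open>T i j\<close> and \<open>T j l\<close> suffice, because
  \<open>T i l\<close> is a combination of them modulo \<open>TT\<close> and the fibre.\<close>

lemma fibre_ideal_gen:
  assumes "x \<in> {T i j, T j l}" "y \<in> fibre"
  shows "brk x y \<in> fibre"
proof -
  have "brk x (tt4.fl fibmap f) \<in> fibre" for f
  proof (induction f rule: fla_induct)
    case (gen g)
    show ?case
      using assms(1)
      by (elim insertE emptyE; cases g)
        (simp_all add: brk_T_fibre brk_add_right fibre_zero fibre_add fibre_brk fibre_T)
  next
    case (brk f g)
    then show ?case
      by (simp add: brk_brk_right[of x] fibre_add fibre_brk)
  qed (simp_all add: fibre_zero brk_add_right fibre_add tt4.brk_scl_right fibre_scl)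
  then show ?thesis using assms(2) by blast
qed

lemma fibre_ideal: "y \<in> fibre \<Longrightarrow> brk (tt4.sub b (T j l) (T i j)) y \<in> fibre"
proof (induction b arbitrary: y rule: fla_induct)
  case (gen g)
  then show ?case using fibre_ideal_gen by (cases g) auto
next
  case (brk b c)
  then show ?case by (simp add: brk_brk_left fibre_diff)
qed (simp_all add: fibre_zero brk_add_left fibre_add tt4.brk_scl_left fibre_scl)

lemma fibre_ideal': "y \<in> fibre \<Longrightarrow> brk y (tt4.sub b (T j l) (T i j)) \<in> fibre"
  by (subst brk_swap) (intro fibre_minus fibre_ideal)

end

text \<open>\<open>TT\<close> is a fixed sum in increasing labels; its expression in
  \<open>i\<close>, \<open>j\<close>, \<open>k\<close>, \<open>l\<close> is assumed here and checked
  for each labelling that occurs.\<close>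

locale labels_TT = labels i j k l for i j k l and k_type :: "'k::comm_ring_1 itself" +
  assumes TT_eq: "TT = T i j + T i k + T i l + T j k + T j l + (T k l :: 'k tt4)"
begin

text \<open>Such sums contain the generators, \<open>T i l\<close> by means of the centre, and are
  closed under brackets because the fibre is an ideal.\<close>

lemma semidirect:
  fixes x :: "'k tt4"
  shows "\<exists>b c f. f \<in> fibre \<and> x = tt4.sub b (T j l) (T i j) + scl_tt4 c TT + f"
proof (induction x rule: tt4_induct)
  case (gen p q)
  have i_l: "T i l = tt4.sub (- fgen E0 - fgen E1) (T j l) (T i j) + scl_tt4 1 TT +
      - (T i k + T j k + (T l k :: 'k tt4))"
    unfolding TT_eq by (simp add: T_sym[of k l])
  have F: "- (T i k + T j k + T l k :: 'k tt4) \<in> fibre"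
    by (intro fibre_minus fibre_add fibre_T)
  have 1: "\<exists>b c f. f \<in> fibre \<and> T i j = tt4.sub b (T j l) (T i j) + scl_tt4 c TT + (f :: 'k tt4)"
    by (rule exI[of _ "fgen E1"], rule exI[of _ 0], rule exI[of _ 0]) (simp add: fibre_zero)
  have 2: "\<exists>b c f. f \<in> fibre \<and> T j l = tt4.sub b (T j l) (T i j) + scl_tt4 c TT + (f :: 'k tt4)"
    by (rule exI[of _ "fgen E0"], rule exI[of _ 0], rule exI[of _ 0]) (simp add: fibre_zero)
  have 3: "\<exists>b c f. f \<in> fibre \<and> T i l = tt4.sub b (T j l) (T i j) + scl_tt4 c TT + (f :: 'k tt4)"
    using i_l F by blast
  have 4: "\<exists>b c f. f \<in> fibre \<and> y = tt4.sub b (T j l) (T i j) + scl_tt4 c TT + f"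
    if "y \<in> fibre" for y :: "'k tt4"
    by (rule exI[of _ 0], rule exI[of _ 0], rule exI[of _ y]) (simp add: that)
  from gen have "p \<in> {i, j, k, l}" "q \<in> {i, j, k, l}" "p \<noteq> q"
    by (auto simp: tt_gens_def set_eq[symmetric])
  then show ?case
    using 1 2 3 4[OF fibre_T(1)] 4[OF fibre_T(2)] 4[OF fibre_T(3)]
    by (elim insertE emptyE) (simp_all only: T_sym[of j i] T_sym[of l j] T_sym[of l i]
      T_sym[of k i] T_sym[of k j] T_sym[of k l] simp_thms neq)
next
  case zero
  show ?case
    by (rule exI[of _ 0], rule exI[of _ 0], rule exI[of _ 0]) (simp add: fibre_zero)
next
  case (add x y)
  then obtain b c f b' c' f' where "f \<in> fibre" "f' \<in> fibre"
    "x = tt4.sub b (T j l) (T i j) + scl_tt4 c TT + f"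
    "y = tt4.sub b' (T j l) (T i j) + scl_tt4 c' TT + f'" by blast
  then have "f + f' \<in> fibre \<and> x + y = tt4.sub (b + b') (T j l) (T i j) + scl_tt4 (c + c') TT + (f + f')"
    by (simp add: fibre_add tt4.add_scl ac_simps)
  then show ?case by blast
next
  case (scl a x)
  then obtain b c f where "f \<in> fibre"
    "x = tt4.sub b (T j l) (T i j) + scl_tt4 c TT + f" by blast
  then have "scl_tt4 a f \<in> fibre \<and> scl_tt4 a x =
      tt4.sub (scl_fla a b) (T j l) (T i j) + scl_tt4 (a * c) TT + scl_tt4 a f"
    by (simp add: fibre_scl tt4.scl_add tt4.scl_scl)
  then show ?case by blast
next
  case (brk x y)
  then obtain b c f b' c' f' where f: "f \<in> fibre" "f' \<in> fibre" and
    "x = tt4.sub b (T j l) (T i j) + scl_tt4 c TT + f"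
    "y = tt4.sub b' (T j l) (T i j) + scl_tt4 c' TT + f'" by blast
  then have "brk x y = tt4.sub (brk b b') (T j l) (T i j) + scl_tt4 0 TT +
      (brk (tt4.sub b (T j l) (T i j)) f' + brk f (tt4.sub b' (T j l) (T i j)) + brk f f')"
    by (simp add: brk_linear tt4.brk_scl_left tt4.brk_scl_right TT_central TT_central' algebra_simps)
  moreover have "brk (tt4.sub b (T j l) (T i j)) f' + brk f (tt4.sub b' (T j l) (T i j)) + brk f f' \<in> fibre"
    using f by (intro fibre_add fibre_brk fibre_ideal fibre_ideal')
  ultimately show ?case by blast
qed

end

locale rational_labels = rational_scalars inv_nat + labels_TT i j k l "TYPE('k)"
  for inv_nat :: "nat \<Rightarrow> 'k::comm_ring_1" and i j k l
begin

theorem centraliser: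
  fixes x :: "'k tt4"
  assumes "brk x (T i j) = 0"
  shows "\<exists>c d w. x = scl_tt4 c (T i j) + scl_tt4 d TT + tt4.sub w (T k l) (T i k + T j k)"
proof -
  obtain b d f where f: "f \<in> fibre" and x: "x = tt4.sub b (T j l) (T i j) + scl_tt4 d TT + f"
    using semidirect by blast
  obtain g where g: "f = tt4.fl fibmap g" using f by blast
  interpret p: braid_images scl_fla "forget_strand :: nat \<Rightarrow> nat \<Rightarrow> 'k fl2" by (rule braid_images_forget_strand)
  interpret p: typed_lie_hom scl_tt4 scl_fla "fla.tlift (forget_strand :: nat \<Rightarrow> nat \<Rightarrow> 'k fl2)"
    by (rule p.tlift_hom)
  let ?p = "fla.tlift (forget_strand :: nat \<Rightarrow> nat \<Rightarrow> 'k fl2)"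
  have pT: "?p (T a b) = forget_strand a b" if "a \<in> {i, j, k, l}" "b \<in> {i, j, k, l}" "a \<noteq> b" for a b
    using that unfolding set_eq[symmetric] by (intro p.tlift_T) auto
  \<comment> \<open>Forgetting \<open>k\<close> kills the fibre and \<open>TT\<close>, hence sends
    \<open>x\<close> to \<open>b\<close>, to which the centraliser of a generator in the free Lie
    algebra applies.\<close>
  have "?p f = 0"
  proof -
    have "(\<lambda>a. ?p (fibmap a)) = (\<lambda>a. 0)"
    proof
      show "?p (fibmap a) = 0" for a
        by (cases a) (simp_all add: p.hom_simps pT)
    qed
    then have "?p f = fla.fl (\<lambda>a. 0) g" unfolding g p.hom_fl by simp
    also have "\<dots> = 0" by (induction g rule: fla_induct) simp_all
    finally show ?thesis .
  qed
  moreover have "?p TT = 0"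
    unfolding TT_eq by (simp add: p.hom_simps pT)
  ultimately have "?p x = b"
    unfolding x by (simp add: p.hom_simps pT)
  then have "brk b (fgen E1) = 0"
    using arg_cong[OF assms, of ?p] by (simp add: p.hom_simps pT)
  then obtain c where b: "b = scl_fla c (fgen E1)" using commute_fgen by blast
  have "brk (T i j) x = 0" using assms brk_eq_0_swap by blast
  then have comm: "brk (T i j) f = 0"
    unfolding x b by (simp add: brk_linear tt4.brk_scl_right TT_central' brk_self)
  interpret r: braid_images scl_opr "rho :: nat \<Rightarrow> nat \<Rightarrow> ('k, fib) opr" by (rule braid_images_rho)
  interpret r: typed_lie_hom scl_tt4 scl_opr "opr.tlift (rho :: nat \<Rightarrow> nat \<Rightarrow> ('k, fib) opr)"
    by (rule r.tlift_hom)
  let ?r = "opr.tlift (rho :: nat \<Rightarrow> nat \<Rightarrow> ('k, fib) opr)"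
  have rT: "?r (T a b) = rho a b" if "a \<in> {i, j, k, l}" "b \<in> {i, j, k, l}" "a \<noteq> b" for a b
    using that unfolding set_eq[symmetric] by (intro r.tlift_T) auto
  \<comment> \<open>On series \<open>f\<close> becomes left multiplication by \<open>g\<close> and
    \<open>T i j\<close> becomes \<open>dAB\<close>, so \<open>g\<close> involves only
    \<open>FS\<close> and \<open>FC\<close>.\<close>
  have "(\<lambda>a. ?r (fibmap a)) = prep"
  proof
    show "?r (fibmap a) = prep a" for a
      by (cases a) (simp_all add: r.hom_simps rT)
  qed
  then have "?r f = act g" unfolding g r.hom_fl act_def by simp
  then have "brk dAB (act g) = 0"
    using arg_cong[OF comm, of ?r] by (simp add: r.hom_simps rT)
  then have "kill_FA g = g" by (rule kernel_dAB)
  then have "f = tt4.sub (fla.fl (case_fib 0 (fgen E1) (fgen E0)) g) (T l k) (T i k + T j k)"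
    using tt4.fl_kill_FA[of fibmap g] g by simp
  then have "x = scl_tt4 c (T i j) + scl_tt4 d TT +
      tt4.sub (fla.fl (case_fib 0 (fgen E1) (fgen E0)) g) (T k l) (T i k + T j k)"
    unfolding x b by (simp add: T_sym[of k l])
  then show ?thesis by blast
qed

end

section \<open>Framed spherical infinitesimal braids\<close>

definition pcls :: "('k::comm_ring_1, nat \<times> nat) lterm \<Rightarrow> ('k, 'n::finite) pp" where
  "pcls t = Abs_pp (lie_class (PP_gens CARD('n)) (PP_rels CARD('n)) t)"

definition X :: "nat \<Rightarrow> nat \<Rightarrow> ('k::comm_ring_1, 'n::finite) pp" where
  "X i j = pcls (LGen (i, j))"

lemma Rep_pcls:
  "Rep_pp (pcls t :: ('k::comm_ring_1, 'n::finite) pp) = lie_class (PP_gens CARD('n)) (PP_rels CARD('n)) t"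
  by (simp add: pcls_def Abs_pp_inverse PP_def lie_pres_simps)

lemma Rep_X: "Rep_pp (X i j :: ('k::comm_ring_1, 'n::finite) pp) = Xgen CARD('n) i j"
  by (simp add: X_def Rep_pcls Xgen_def)

lemma pcls_simps:
  "pcls (LGen (i, j)) = X i j"
  "pcls LZero = 0" "pcls (LAdd s t) = pcls s + pcls t"
  "pcls (LScale c t) = scl_pp c (pcls t)" "pcls (LBrk s t) = brk (pcls s) (pcls t)"
  by (simp_all add: X_def Rep_pp_inject[symmetric] Rep_pp_simps Rep_pcls PP_def lie_pres_simps)

lemma pcls_surj: "\<exists>t. x = pcls t"
proof -
  obtain t where "Rep_pp x = lie_class (PP_gens CARD('b)) (PP_rels CARD('b)) t"
    using Rep_pp[of x] by (auto simp: PP_def lie_pres_simps)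
  then have "x = pcls t" by (simp add: Rep_pp_inject[symmetric] Rep_pcls)
  then show ?thesis ..
qed

lemma pcls_eq_iff: "(pcls s :: ('k::comm_ring_1, 'n::finite) pp) = pcls t \<longleftrightarrow>
    lie_cong (PP_gens CARD('n)) (PP_rels CARD('n)) s t"
  by (simp add: Rep_pp_inject[symmetric] Rep_pcls lie_class_eq_iff)

lemma PP_rels_cases:
  assumes "(s, t) \<in> PP_rels N"
  obtains (1) i j where "s = LGen (j, i)" "t = LGen (i, j)" "{i, j} \<subseteq> {1..N}"
  | (2) i j k l where "s = LBrk (LGen (i, j)) (LGen (k, l))" "t = LZero"
      "{i, j, k, l} \<subseteq> {1..N}" "distinct [i, j, k, l]"
  | (3) i where "s = foldr LAdd [LGen (i, j). j \<leftarrow> [1..<Suc N]] LZero" "t = LZero" "i \<in> {1..N}"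
  | (4) i u where "s = LBrk (LGen (i, i)) u" "t = LZero" "i \<in> {1..N}"
  using assms unfolding PP_rels_def
proof (elim UnE CollectE exE conjE Pair_inject)
  fix i j assume "s = LGen (j, i)" "t = LGen (i, j)" "{i, j} \<subseteq> {1..N}"
  then show thesis by (rule that(1))
next
  fix i j k l assume "s = LBrk (LGen (i, j)) (LGen (k, l))" "t = LZero"
      "{i, j, k, l} \<subseteq> {1..N}" "distinct [i, j, k, l]"
  then show thesis by (rule that(2))
next
  fix i assume "s = foldr LAdd [LGen (i, j). j \<leftarrow> [1..<Suc N]] LZero" "t = LZero" "i \<in> {1..N}"
  then show thesis by (rule that(3))
next
  fix i u assume "s = LBrk (LGen (i, i)) u" "t = LZero" "i \<in> {1..N}"
  then show thesis by (rule that(4))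
qed

lemma X_outside: "(i, j) \<notin> PP_gens CARD('n) \<Longrightarrow> (X i j :: ('k::comm_ring_1, 'n::finite) pp) = 0"
  unfolding X_def pcls_simps(2)[symmetric] pcls_eq_iff by (rule lie_cong.outside)

lemma X_sym: "X i j = (X j i :: ('k::comm_ring_1, 'n::finite) pp)"
proof (cases "(i, j) \<in> PP_gens CARD('n)")
  case True
  then show ?thesis
    unfolding X_def pcls_eq_iff
    by (intro lie_cong.relation) (auto simp: PP_rels_def PP_gens_def)
next
  case False
  then have "(j, i) \<notin> PP_gens CARD('n)" by (auto simp: PP_gens_def)
  then show ?thesis using False by (simp add: X_outside)
qed

lemma X_disjoint:
  assumes "{i, j, k, l} \<subseteq> {1..CARD('n)}" "distinct [i, j, k, l]"
  shows "brk (X i j) (X k l :: ('k::comm_ring_1, 'n::finite) pp) = 0"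
proof -
  have "pcls (LBrk (LGen (i, j)) (LGen (k, l))) = (pcls LZero :: ('k, 'n) pp)"
    unfolding pcls_eq_iff using assms by (intro lie_cong.relation) (simp add: PP_rels_def)
  then show ?thesis by (simp add: pcls_simps)
qed

lemma X_central: "brk (X i i) (x :: ('k::comm_ring_1, 'n::finite) pp) = 0"
proof (cases "(i, i) \<in> PP_gens CARD('n)")
  case True
  obtain t where t: "x = pcls t" using pcls_surj by blast
  have "pcls (LBrk (LGen (i, i)) t) = (pcls LZero :: ('k, 'n) pp)"
    unfolding pcls_eq_iff using True
    by (intro lie_cong.relation) (auto simp: PP_rels_def PP_gens_def)
  then show ?thesis by (simp add: pcls_simps t)
qed (simp add: X_outside)

lemma X_central': "brk (x :: ('k::comm_ring_1, 'n::finite) pp) (X i i) = 0"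
  using X_central brk_eq_0_swap by blast

lemma X_row:
  assumes "i \<in> {1..CARD('n)}"
  shows "(\<Sum>j=1..CARD('n). X i j :: ('k::comm_ring_1, 'n::finite) pp) = 0"
proof -
  have "pcls (foldr LAdd [LGen (i, j). j \<leftarrow> [1..<Suc CARD('n)]] LZero) = (pcls LZero :: ('k, 'n) pp)"
    unfolding pcls_eq_iff using assms
    by (intro lie_cong.relation) (auto simp: PP_rels_def)
  moreover have "pcls (foldr LAdd [LGen (i, j). j \<leftarrow> xs] LZero) = (\<Sum>j\<leftarrow>xs. X i j :: ('k, 'n) pp)" for xs
    by (induction xs) (simp_all add: pcls_simps)
  ultimately show ?thesis
    by (simp add: pcls_simps sum_list_distinct_conv_sum_set atLeastLessThanSuc_atLeastAtMost
        del: upt_Suc)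
qed

text \<open>The row relation replaces \<open>X i j + X i k\<close> by minus the rest of row
  \<open>i\<close>, and each term of it commutes with \<open>X j k\<close>, by disjointness or as
  the central \<open>X i i\<close>.\<close>

lemma X_triple:
  assumes "{i, j, k} \<subseteq> {1..CARD('n)}" "distinct [i, j, k]"
  shows "brk (X i j + X i k) (X j k :: ('k::comm_ring_1, 'n::finite) pp) = 0"
proof -
  let ?A = "{1..CARD('n)} - {j, k}"
  have sum_left: "brk (\<Sum>m\<in>A. f m) y = (\<Sum>m\<in>A. brk (f m) y)"
    for f :: "nat \<Rightarrow> ('k, 'n) pp" and A y
    by (induction A rule: infinite_finite_induct) (simp_all add: brk_add_left)
  have "(\<Sum>m=1..CARD('n). X i m) = X i j + (X i k + (\<Sum>m\<in>?A. X i m :: ('k, 'n) pp))"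
    using assms by (simp add: sum.remove[of _ j] sum.remove[of _ k] Diff_insert2[symmetric] insert_commute)
  then have "X i j + X i k = - (\<Sum>m\<in>?A. X i m :: ('k, 'n) pp)"
    using X_row[where 'k='k and 'n='n, of i] assms by (simp add: eq_neg_iff_add_eq_0 add.assoc)
  moreover have "brk (X i m) (X j k :: ('k, 'n) pp) = 0" if "m \<in> ?A" for m
    using that assms by (cases "m = i") (auto simp: X_central intro!: X_disjoint)
  ultimately show ?thesis
    by (simp add: brk_minus_left sum_left)
qed

lemma pp_induct [case_names gen zero add scl brk]:
  fixes x :: "('k::comm_ring_1, 'n::finite) pp"
  assumes "\<And>i j. i \<in> {1..CARD('n)} \<Longrightarrow> j \<in> {1..CARD('n)} \<Longrightarrow> P (X i j)" "P 0"
    "\<And>x y. P x \<Longrightarrow> P y \<Longrightarrow> P (x + y)"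
    "\<And>c x. P x \<Longrightarrow> P (scl_pp c x)" "\<And>x y. P x \<Longrightarrow> P y \<Longrightarrow> P (brk x y)"
  shows "P x"
proof -
  have "P (X i j)" for i j
    using assms(1)[of i j] assms(2)
    by (cases "(i, j) \<in> PP_gens CARD('n)") (simp_all add: X_outside, simp add: PP_gens_def)
  then have "P (pcls t)" for t
    by (induction t) (auto simp: pcls_simps assms)
  then show ?thesis using pcls_surj[of x] by auto
qed

definition (in typed_lie_algebra) plift :: "(nat \<Rightarrow> nat \<Rightarrow> 'a) \<Rightarrow> ('k, 'n::finite) pp \<Rightarrow> 'a" where
  "plift f x = lie_lift (PP_gens CARD('n)) (typed_alg scl) (\<lambda>(i, j). f i j) (Rep_pp x)"

locale sphere_images = typed_lie_algebra scl
  for scl :: "'k::comm_ring_1 \<Rightarrow> 'a::lie_ring \<Rightarrow> 'a" +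
  fixes f :: "nat \<Rightarrow> nat \<Rightarrow> 'a" and n_type :: "'n::finite itself"
  assumes sym: "\<And>i j. {i, j} \<subseteq> {1..CARD('n)} \<Longrightarrow> f i j = f j i"
    and disjoint: "\<And>i j k l. {i, j, k, l} \<subseteq> {1..CARD('n)} \<Longrightarrow> distinct [i, j, k, l] \<Longrightarrow>
      brk (f i j) (f k l) = 0"
    and row: "\<And>i. i \<in> {1..CARD('n)} \<Longrightarrow> (\<Sum>j=1..CARD('n). f i j) = 0"
    and central: "\<And>i j k. {i, j, k} \<subseteq> {1..CARD('n)} \<Longrightarrow> brk (f i i) (f j k) = 0"
begin

definition img :: "nat \<times> nat \<Rightarrow> 'a" where
  "img = (\<lambda>g. if g \<in> PP_gens CARD('n) then case g of (i, j) \<Rightarrow> f i j else 0)"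

lemma eval_row: "lie_eval (typed_alg scl) img (foldr LAdd [LGen (i, j). j \<leftarrow> [1..<Suc CARD('n)]] LZero) = 0"
  if "i \<in> {1..CARD('n)}"
proof -
  have "lie_eval (typed_alg scl) img (foldr LAdd [LGen (i, j). j \<leftarrow> xs] LZero) = (\<Sum>j\<leftarrow>xs. f i j)"
    if "set xs \<subseteq> {1..CARD('n)}" for xs
    using that \<open>i \<in> _\<close> by (induction xs) (simp_all add: img_def PP_gens_def)
  from this[of "[1..<Suc CARD('n)]"] show ?thesis
    using row[OF that]
    by (simp add: sum_list_distinct_conv_sum_set atLeastLessThanSuc_atLeastAtMost del: upt_Suc)
qed

text \<open>\<open>PP_rels\<close> lets \<open>X i i\<close> commute with every term, while
  \<open>central\<close> speaks of generators only; Jacobi bridges the gap.\<close>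

lemma eval_central:
  assumes "i \<in> {1..CARD('n)}"
  shows "brk (f i i) (lie_eval (typed_alg scl) img t) = 0"
  using assms
  by (induction t) (auto simp: brk_add_right brk_scl_right brk_brk_right img_def PP_gens_def central)

lemma plift_pcls: "plift f (pcls t :: ('k, 'n) pp) = lie_eval (typed_alg scl) img t"
  unfolding plift_def Rep_pcls img_def
proof (subst lie_lift_class[OF lie_algebra_typed])
  show "lie_eval (typed_alg scl) (\<lambda>g. if g \<in> PP_gens CARD('n) then (case g of (i, j) \<Rightarrow> f i j)
      else lzero (typed_alg scl)) s = lie_eval (typed_alg scl)
      (\<lambda>g. if g \<in> PP_gens CARD('n) then (case g of (i, j) \<Rightarrow> f i j) else lzero (typed_alg scl)) t"
    if "(s, t) \<in> PP_rels CARD('n)" for s t :: "('k, nat \<times> nat) lterm"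
  proof -
    from that show ?thesis
    proof (cases rule: PP_rels_cases)
      case (1 i j)
      then show ?thesis using sym[of i j] by (simp add: PP_gens_def)
    next
      case (2 i j k l)
      then show ?thesis using disjoint[of i j k l] by (simp add: PP_gens_def)
    next
      case (3 i)
      then show ?thesis using eval_row[of i] unfolding img_def by (simp del: upt_Suc cong: if_cong)
    next
      case (4 i u)
      then show ?thesis using eval_central[of i u] unfolding img_def by (simp add: PP_gens_def cong: if_cong)
    qed
  qed
qed (simp_all cong: if_cong)

lemma plift_hom: "typed_lie_hom scl_pp scl (plift f :: ('k, 'n) pp \<Rightarrow> 'a)"
proof
  fix x y :: "('k, 'n) pp" and c
  obtain s t where st: "x = pcls s" "y = pcls t" using pcls_surj by metis
  show "plift f (x + y) = plift f x + plift f y" "plift f (scl_pp c x) = scl c (plift f x)"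
    "plift f (brk x y) = brk (plift f x) (plift f y)"
    unfolding st by (simp_all add: pcls_simps(2-)[symmetric] plift_pcls)
qed

lemma plift_X: "{i, j} \<subseteq> {1..CARD('n)} \<Longrightarrow> plift f (X i j :: ('k, 'n) pp) = f i j"
  by (simp add: pcls_simps(1)[symmetric] plift_pcls img_def PP_gens_def)

end

subsection \<open>Derivations\<close>

locale derivation = typed_lie_algebra scl for scl :: "'k::comm_ring_1 \<Rightarrow> 'a::lie_ring \<Rightarrow> 'a" +
  fixes D :: "'a \<Rightarrow> 'a"
  assumes D_add: "D (x + y) = D x + D y" and D_scl: "D (scl c x) = scl c (D x)"
    and D_brk: "D (brk x y) = brk (D x) y + brk x (D y)"
begin

lemma D_zero: "D 0 = 0"
  using D_add[of 0 0] by simp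

lemma D_minus: "D (- x) = - D x"
  using D_scl[of "- 1" x] by simp

lemma D_diff: "D (x - y) = D x - D y"
  using D_add[of x "- y"] by (simp add: D_minus)

lemma derivation_add_ad: "derivation scl (\<lambda>x. D x + brk z x)"
  by unfold_locales
    (simp_all add: D_add D_scl D_brk brk_add_right brk_scl_right scl_add brk_add_left
      brk_brk_right[of z] ac_simps)

end

text \<open>The Leibniz rule on terms, with values already in the quotient; \<open>dev_cong\<close>
  shows that it descends to classes.\<close>

primrec dev :: "(nat \<Rightarrow> nat \<Rightarrow> ('k::comm_ring_1, 'n::finite) pp) \<Rightarrow> ('k, nat \<times> nat) lterm \<Rightarrow> ('k, 'n) pp"
  where
    "dev d (LGen g) = (if g \<in> PP_gens CARD('n) then d (fst g) (snd g) else 0)"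
  | "dev d LZero = 0"
  | "dev d (LAdd s t) = dev d s + dev d t"
  | "dev d (LScale c t) = scl_pp c (dev d t)"
  | "dev d (LBrk s t) = brk (dev d s) (pcls t) + brk (pcls s) (dev d t)"

lemma dev_cong:
  fixes d :: "nat \<Rightarrow> nat \<Rightarrow> ('k::comm_ring_1, 'n::finite) pp"
  assumes "lie_cong (PP_gens CARD('n)) (PP_rels CARD('n)) s t"
    and sym: "\<And>i j. {i, j} \<subseteq> {1..CARD('n)} \<Longrightarrow> d i j = d j i"
    and disjoint: "\<And>i j k l. {i, j, k, l} \<subseteq> {1..CARD('n)} \<Longrightarrow> distinct [i, j, k, l] \<Longrightarrow>
      brk (d i j) (X k l) + brk (X i j) (d k l) = 0"
    and row: "\<And>i. i \<in> {1..CARD('n)} \<Longrightarrow> (\<Sum>j=1..CARD('n). d i j) = 0"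
    and diag: "\<And>i. i \<in> {1..CARD('n)} \<Longrightarrow> d i i = 0"
  shows "dev d s = dev d t"
  using assms(1)
proof induction
  case (relation s t)
  then show ?case
  proof (cases rule: PP_rels_cases)
    case (1 i j)
    then show ?thesis using sym[of i j] by (simp add: PP_gens_def)
  next
    case (2 i j k l)
    then show ?thesis using disjoint[of i j k l] by (simp add: PP_gens_def pcls_simps)
  next
    case (3 i)
    have "dev d (foldr LAdd [LGen (i, j). j \<leftarrow> xs] LZero) = (\<Sum>j\<leftarrow>xs. d i j)"
      if "set xs \<subseteq> {1..CARD('n)}" for xs
      using that 3(3) by (induction xs) (simp_all add: PP_gens_def)
    from this[of "[1..<Suc CARD('n)]"] show ?thesis
      using row[OF 3(3)] 3
      by (simp add: sum_list_distinct_conv_sum_set atLeastLessThanSuc_atLeastAtMost del: upt_Suc)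
  next
    case (4 i u)
    then show ?thesis by (simp add: PP_gens_def pcls_simps diag X_central)
  qed
next
  case (cong_brk s s' t t')
  then have "pcls s = (pcls s' :: ('k, 'n) pp)" "pcls t = (pcls t' :: ('k, 'n) pp)"
    by (simp_all add: pcls_eq_iff)
  then show ?case using cong_brk by simp
next
  case (brk_alt t)
  show ?case using brk_swap[of "dev d t" "pcls t"] by simp
next
  case (jacobi s t u)
  let ?x = "pcls s :: ('k, 'n) pp" and ?y = "pcls t :: ('k, 'n) pp" and ?z = "pcls u :: ('k, 'n) pp"
  \<comment> \<open>The nine terms group into three Jacobi sums, one for each differentiated
    argument.\<close>
  have "dev d (LAdd (LBrk s (LBrk t u)) (LAdd (LBrk t (LBrk u s)) (LBrk u (LBrk s t)))) =
    (brk (dev d s) (brk ?y ?z) + brk ?y (brk ?z (dev d s)) + brk ?z (brk (dev d s) ?y)) +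
    (brk ?x (brk (dev d t) ?z) + brk (dev d t) (brk ?z ?x) + brk ?z (brk ?x (dev d t))) +
    (brk ?x (brk ?y (dev d u)) + brk ?y (brk (dev d u) ?x) + brk (dev d u) (brk ?x ?y))"
    by (simp add: pcls_simps brk_add_right ac_simps)
  then show ?case by (simp only: lie_ring_class.jacobi) simp
qed (simp_all add: pcls_simps pp.scl_add pp.add_scl pp.scl_scl brk_add_left brk_add_right
    pp.brk_scl_left pp.brk_scl_right ac_simps)

lemma pp_derivation_exists:
  fixes d :: "nat \<Rightarrow> nat \<Rightarrow> ('k::comm_ring_1, 'n::finite) pp"
  assumes "\<And>i j. {i, j} \<subseteq> {1..CARD('n)} \<Longrightarrow> d i j = d j i"
    and "\<And>i j k l. {i, j, k, l} \<subseteq> {1..CARD('n)} \<Longrightarrow> distinct [i, j, k, l] \<Longrightarrow>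
      brk (d i j) (X k l) + brk (X i j) (d k l) = 0"
    and "\<And>i. i \<in> {1..CARD('n)} \<Longrightarrow> (\<Sum>j=1..CARD('n). d i j) = 0"
    and "\<And>i. i \<in> {1..CARD('n)} \<Longrightarrow> d i i = 0"
  shows "\<exists>D. derivation scl_pp D \<and> (\<forall>i\<in>{1..CARD('n)}. \<forall>j\<in>{1..CARD('n)}. D (X i j) = d i j)"
proof -
  define D where "D x = dev d (SOME t. pcls t = x)" for x :: "('k, 'n) pp"
  have D: "D (pcls t) = dev d t" for t
  proof -
    have "(pcls (SOME s. pcls s = (pcls t :: ('k, 'n) pp)) :: ('k, 'n) pp) = pcls t"
      by (rule someI[of _ t]) simp
    then show ?thesis
      unfolding D_def by (intro dev_cong[OF _ assms]) (simp add: pcls_eq_iff)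
  qed
  have "derivation scl_pp D"
  proof
    fix x y :: "('k, 'n) pp" and c
    obtain s t where st: "x = pcls s" "y = pcls t" using pcls_surj by metis
    show "D (x + y) = D x + D y" "D (scl_pp c x) = scl_pp c (D x)"
      "D (brk x y) = brk (D x) y + brk x (D y)"
      unfolding st by (simp_all add: pcls_simps(2-)[symmetric] D)
  qed
  moreover have "D (X i j) = d i j" if "i \<in> {1..CARD('n)}" "j \<in> {1..CARD('n)}" for i j
    using that by (simp add: pcls_simps(1)[symmetric] D PP_gens_def)
  ultimately show ?thesis by blast
qed

lemma intertwine_derivations:
  fixes D :: "('k::comm_ring_1, 'n::finite) pp \<Rightarrow> ('k, 'n) pp" and E :: "'b::lie_ring \<Rightarrow> 'b"
  assumes "typed_lie_hom scl_pp scl h" "derivation scl_pp D" "derivation scl E"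
    and gen: "\<And>i j. i \<in> {1..CARD('n)} \<Longrightarrow> j \<in> {1..CARD('n)} \<Longrightarrow> E (h (X i j)) = h (D (X i j))"
  shows "E (h x) = h (D x)"
proof -
  interpret h: typed_lie_hom scl_pp scl h by fact
  interpret D: derivation scl_pp D by fact
  interpret E: derivation scl E by fact
  show ?thesis
    by (induction x rule: pp_induct)
      (simp_all add: gen h.hom_add h.hom_scl h.hom_brk h.hom_zero D.D_add D.D_scl D.D_brk D.D_zero
        E.D_add E.D_scl E.D_brk E.D_zero)
qed

section \<open>Comparison with the presented Lie algebras\<close>

lemma lie_derivation_Rep:
  fixes D :: "('k::comm_ring_1, 'n::finite) pp \<Rightarrow> ('k, 'n) pp"
  assumes "derivation scl_pp D"
  shows "lie_derivation (PP CARD('n)) (\<lambda>y. Rep_pp (D (Abs_pp y)))"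
proof -
  interpret D: derivation scl_pp D by fact
  show ?thesis
    unfolding lie_derivation_def
  proof (intro conjI ballI allI funcsetI)
    fix y z :: "('k, nat \<times> nat) lie_elt" and c
    assume "y \<in> lcarrier (PP CARD('n))" "z \<in> lcarrier (PP CARD('n))"
    then obtain u v where uv: "y = Rep_pp (u :: ('k, 'n) pp)" "z = Rep_pp (v :: ('k, 'n) pp)"
      by (metis Abs_pp_inverse)
    show "Rep_pp (D (Abs_pp (ladd (PP CARD('n)) y z))) =
        ladd (PP CARD('n)) (Rep_pp (D (Abs_pp y))) (Rep_pp (D (Abs_pp z)))"
      "Rep_pp (D (Abs_pp (lbrk (PP CARD('n)) y z))) =
        ladd (PP CARD('n)) (lbrk (PP CARD('n)) (Rep_pp (D (Abs_pp y))) z)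
          (lbrk (PP CARD('n)) y (Rep_pp (D (Abs_pp z))))"
      unfolding uv Rep_pp_simps[symmetric] by (simp_all add: Rep_pp_inverse D.D_add D.D_brk)
  next
    fix y :: "('k, nat \<times> nat) lie_elt" and c
    assume "y \<in> lcarrier (PP CARD('n))"
    then obtain u where u: "y = Rep_pp (u :: ('k, 'n) pp)"
      by (metis Abs_pp_inverse)
    show "Rep_pp (D (Abs_pp (lscale (PP CARD('n)) c y))) =
        lscale (PP CARD('n)) c (Rep_pp (D (Abs_pp y)))"
      unfolding u Rep_pp_simps[symmetric] by (simp add: Rep_pp_inverse D.D_scl)
    show "Rep_pp (D (Abs_pp y)) \<in> lcarrier (PP CARD('n))" by (rule Rep_pp)
  qed
qed

lemma derivation_Abs:
  fixes E :: "('k::comm_ring_1, nat \<times> nat) lie_elt \<Rightarrow> ('k, nat \<times> nat) lie_elt"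
  assumes "lie_derivation (PP CARD('n::finite)) E"
  shows "derivation scl_pp (\<lambda>x. Abs_pp (E (Rep_pp x)) :: ('k, 'n) pp)"
    and "Rep_pp (Abs_pp (E (Rep_pp (x :: ('k, 'n) pp))) :: ('k, 'n) pp) = E (Rep_pp x)"
proof -
  have E: "E (Rep_pp x) \<in> lcarrier (PP CARD('n))" for x :: "('k, 'n) pp"
    using assms Rep_pp[of x] by (auto simp: lie_derivation_def)
  then show R: "Rep_pp (Abs_pp (E (Rep_pp (x :: ('k, 'n) pp))) :: ('k, 'n) pp) = E (Rep_pp x)" for x
    by (rule Abs_pp_inverse)
  show "derivation scl_pp (\<lambda>x. Abs_pp (E (Rep_pp x)) :: ('k, 'n) pp)"
  proof
    fix x y :: "('k, 'n) pp" and c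
    show "(Abs_pp (E (Rep_pp (x + y))) :: ('k, 'n) pp) = Abs_pp (E (Rep_pp x)) + Abs_pp (E (Rep_pp y))"
      "(Abs_pp (E (Rep_pp (scl_pp c x))) :: ('k, 'n) pp) = scl_pp c (Abs_pp (E (Rep_pp x)))"
      "(Abs_pp (E (Rep_pp (brk x y))) :: ('k, 'n) pp) =
        brk (Abs_pp (E (Rep_pp x))) y + brk x (Abs_pp (E (Rep_pp y)))"
      using assms Rep_pp[of x] Rep_pp[of y]
      by (simp_all add: Rep_pp_inject[symmetric] R) (simp_all add: Rep_pp_simps R lie_derivation_def)
  qed
qed

lemma lsubst_Rep_pp: "lsubst (PP CARD('n)) (Rep_fla c) (Rep_pp a) (Rep_pp (b :: ('k::comm_ring_1, 'n::finite) pp)) =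
    Rep_pp (pp.sub c a b)"
proof -
  have "(\<lambda>g. Rep_pp (case g of E0 \<Rightarrow> a | E1 \<Rightarrow> b)) = case_egen (Rep_pp a) (Rep_pp b)"
    by (rule ext) (simp split: egen.split)
  then show ?thesis
    unfolding pp.sub_def pp.fl_def
    by (subst lie_hom_flift[OF pp.lie_algebra_typed lie_hom_Rep_pp]) (simp_all add: lsubst_def flift_def)
qed

lemma lsubst_Rep_tt4: "lsubst (tt 4) (Rep_fla c) (Rep_tt4 a) (Rep_tt4 b) = Rep_tt4 (tt4.sub c a b)"
proof -
  have "(\<lambda>g. Rep_tt4 (case g of E0 \<Rightarrow> a | E1 \<Rightarrow> b)) = case_egen (Rep_tt4 a) (Rep_tt4 b)"
    by (rule ext) (simp split: egen.split)
  then show ?thesis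
    unfolding tt4.sub_def tt4.fl_def
    by (subst lie_hom_flift[OF tt4.lie_algebra_typed lie_hom_Rep_tt4]) (simp_all add: lsubst_def flift_def)
qed

lemma lsubst_Rep_fla: "lsubst flie (Rep_fla c) (Rep_fla a) (Rep_fla b) = Rep_fla (fla.sub c a b)"
proof -
  have "(\<lambda>g. Rep_fla (case g of E0 \<Rightarrow> a | E1 \<Rightarrow> b)) = case_egen (Rep_fla a) (Rep_fla b)"
    by (rule ext) (simp split: egen.split)
  then show ?thesis
    unfolding fla.sub_def fla.fl_def
    by (subst lie_hom_flift[OF fla.lie_algebra_typed lie_hom_Rep_fla])
      (simp_all add: lsubst_def flift_def flie_def)
qed

lemma PP_pull_Rep:
  fixes x :: "('k::comm_ring_1, 'n::finite) pp"
  assumes "length F = CARD('n)"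
  shows "PP_pull CARD('m) F (Rep_pp x) =
    Rep_pp (pp.plift (\<lambda>i j. \<Sum>(i', j')\<leftarrow>List.product (F ! (i - 1)) (F ! (j - 1)). X i' j') x :: ('k, 'm::finite) pp)"
proof -
  have lsum: "lsum (PP CARD('m)) (map (\<lambda>g. Xgen CARD('m) (fst g) (snd g)) gs) =
      Rep_pp (\<Sum>(i', j')\<leftarrow>gs. X i' j' :: ('k, 'm) pp)" for gs
    by (induction gs) (simp_all add: lsum_def Rep_pp_simps Rep_X split: prod.split)
  have "lsum (PP CARD('m)) [Xgen CARD('m) i' j'. i' \<leftarrow> xs, j' \<leftarrow> ys] =
      Rep_pp (\<Sum>(i', j')\<leftarrow>List.product xs ys. X i' j' :: ('k, 'm) pp)" for xs ys
    unfolding lsum[symmetric] by (rule arg_cong[of _ _ "lsum _"]) (simp add: product_concat_map map_concat comp_def)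
  then have "(\<lambda>g. if g \<in> PP_gens CARD('n) then (case g of (i, j) \<Rightarrow>
        lsum (PP CARD('m)) [Xgen CARD('m) i' j'. i' \<leftarrow> F ! (i - 1), j' \<leftarrow> F ! (j - 1)])
        else lzero (PP CARD('m))) =
      (\<lambda>g. Rep_pp (if g \<in> PP_gens CARD('n) then (case g of (i, j) \<Rightarrow>
        \<Sum>(i', j')\<leftarrow>List.product (F ! (i - 1)) (F ! (j - 1)). X i' j') else 0 :: ('k, 'm) pp))"
    by (intro ext) (simp add: Rep_pp_simps split: prod.split)
  then show ?thesis
    unfolding PP_pull_def pp.plift_def lie_lift_def assms typed_alg_simps
    by (subst lie_hom_eval[OF pp.lie_algebra_typed lie_hom_Rep_pp]) simp_all
qed

text \<open>Inside a triple all brackets are \<open>brk (T a b) (T b c)\<close> up to sign. Together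
  with the disjoint pairs this is a normal form in degree two, by which the later commutation
  conditions are decided.\<close>

lemma T_brk_triple:
  assumes "{a, b, c} \<subseteq> {1..4}" "distinct [a, b, c]"
  shows "brk (T b c) (T a b) = - brk (T a b) (T b c)" "brk (T b c) (T a c) = brk (T a b) (T b c)"
    "brk (T a c) (T b c) = - brk (T a b) (T b c)" "brk (T a c) (T a b) = brk (T a b) (T b c)"
    "brk (T a b) (T a c) = - brk (T a b) (T b c)"
proof -
  show "brk (T b c) (T a b) = - brk (T a b) (T b c)" by (rule brk_swap)
  have "brk (T b a) (T b c) = brk (T b c) (T a c)" "brk (T c b) (T c a) = brk (T c a) (T b a)"
    by (rule brk_T_pair; use assms in auto)+
  then have h: "brk (T a b) (T b c) = brk (T b c) (T a c)" "brk (T b c) (T a c) = brk (T a c) (T a b)"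
    by (simp_all add: T_sym[of b a] T_sym[of c a] T_sym[of c b])
  show 1: "brk (T b c) (T a c) = brk (T a b) (T b c)" by (rule h(1)[symmetric])
  show 2: "brk (T a c) (T a b) = brk (T a b) (T b c)" unfolding h ..
  show "brk (T a c) (T b c) = - brk (T a b) (T b c)"
    using 1 by (subst brk_swap) simp
  show "brk (T a b) (T a c) = - brk (T a b) (T b c)"
    using 2 by (subst brk_swap) simp
qed

lemma T_brk_disjoint:
  "brk (T 1 2) (T 3 4) = 0" "brk (T 3 4) (T 1 2) = 0" "brk (T 1 3) (T 2 4) = 0"
  "brk (T 2 4) (T 1 3) = 0" "brk (T 1 4) (T 2 3) = 0" "brk (T 2 3) (T 1 4) = 0"
  by (rule T_disjoint; simp)+

lemmas T_brk_normal = T_brk_disjoint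
  T_brk_triple[of 1 2 3] T_brk_triple[of 1 2 4] T_brk_triple[of 1 3 4] T_brk_triple[of 2 3 4]

text \<open>The assumptions on \<open>f\<close> are the relations of \<open>tt 3\<close> for the
  images of its generators; there are no four distinct strands, hence no disjoint pairs to
  check.\<close>

lemma tt_pull_lsubst:
  fixes c :: "'k::comm_ring_1 fl2" and f :: "nat \<Rightarrow> nat \<Rightarrow> 'k tt4"
  assumes F: "length F = 3"
    and f: "\<And>i j. f i j = (\<Sum>(i', j')\<leftarrow>List.product (F ! (i - 1)) (F ! (j - 1)). T i' j')"
    and sym: "f 1 2 = f 2 1" "f 1 3 = f 3 1" "f 2 3 = f 3 2"
    and triple: "brk (f 1 2 + f 1 3) (f 2 3) = 0" "brk (f 1 2 + f 2 3) (f 1 3) = 0"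
      "brk (f 1 3 + f 2 3) (f 1 2) = 0"
  shows "tt_pull 4 F (lsubst (tt 3) (Rep_fla c) (tgen 3 2 3) (tgen 3 1 2)) =
    Rep_tt4 (tt4.sub c (f 2 3) (f 1 2))"
proof -
  let ?v = "\<lambda>(i, j). lsum (tt 4) [tgen 4 i' j'. i' \<leftarrow> F ! (i - 1), j' \<leftarrow> F ! (j - 1)]"
  let ?u = "\<lambda>g. if g \<in> tt_gens 3 then case g of (i, j) \<Rightarrow> f i j else 0"
  have lsum: "lsum (tt 4) (map (\<lambda>g. tgen 4 (fst g) (snd g)) gs) =
      Rep_tt4 (\<Sum>(i', j')\<leftarrow>gs. T i' j' :: 'k tt4)" for gs
    by (induction gs) (simp_all add: lsum_def Rep_tt4_simps Rep_T split: prod.split)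
  have "lsum (tt 4) [tgen 4 i' j'. i' \<leftarrow> xs, j' \<leftarrow> ys] =
      Rep_tt4 (\<Sum>(i', j')\<leftarrow>List.product xs ys. T i' j' :: 'k tt4)" for xs ys
    unfolding lsum[symmetric]
    by (rule arg_cong[of _ _ "lsum _"]) (simp add: product_concat_map map_concat comp_def)
  then have v: "?v (i, j) = Rep_tt4 (f i j)" for i j by (simp add: f)
  have u: "(\<lambda>g. if g \<in> tt_gens 3 then ?v g else lzero (tt 4)) = (\<lambda>g. Rep_tt4 (?u g))"
    using v by (intro ext) (auto simp: Rep_tt4_simps)
  have eval: "lie_eval (tt 4) (\<lambda>g. Rep_tt4 (?u g)) t = Rep_tt4 (lie_eval (typed_alg scl_tt4) ?u t)" for t
    by (rule lie_hom_eval[OF tt4.lie_algebra_typed lie_hom_Rep_tt4, symmetric]) simp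
  have sym': "f i j = f j i" if "{i, j} \<subseteq> {1..3}" "i \<noteq> j" for i j
  proof -
    have "i \<in> {1, 2, 3}" "j \<in> {1, 2, 3}" using that by auto
    then show ?thesis using sym by auto
  qed
  have triple': "brk (f i j + f i k) (f j k) = 0" if "{i, j, k} \<subseteq> {1..3}" "distinct [i, j, k]" for i j k
  proof -
    have "i \<in> {1, 2, 3}" "j \<in> {1, 2, 3}" "k \<in> {1, 2, 3}" using that by auto
    then show ?thesis
      using triple that(2) by (elim insertE emptyE) (auto simp: sym[symmetric] add.commute simp del: One_nat_def)
  qed
  have no_disjoint: False if "{i, j, k, l} \<subseteq> {1..3}" "distinct [i, j, k, l]" for i j k l :: nat
    using card_mono[OF _ that(1)] that(2) by simp
  have rel: "lie_eval (typed_alg scl_tt4) ?u s = lie_eval (typed_alg scl_tt4) ?u t"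
    if "(s, t) \<in> tt_rels 3" for s t
  proof -
    have u: "?u (i, j) = f i j" if "{i, j} \<subseteq> {1..3}" "i \<noteq> j" for i j
      using that by (simp add: tt_gens_def)
    from that show ?thesis
      unfolding tt_rels_def
    proof (elim UnE CollectE exE conjE Pair_inject, goal_cases)
      case (1 i j)
      then show ?thesis using u[of i j] u[of j i] sym'[of i j] by simp
    next
      case (2 i j k)
      then show ?thesis using u[of i j] u[of i k] u[of j k] triple'[of i j k] by simp
    next
      case (3 i j k l)
      then show ?thesis using no_disjoint by blast
    qed
  qed
  have alg: "lie_algebra (tt 3)" "lie_algebra (tt 4)" by (rule lie_algebra_tt)+
  have lift: "(tt_pull 4 F :: ('k, nat \<times> nat) lie_elt \<Rightarrow> _) = lie_lift (tt_gens 3) (tt 4) ?v"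
    by (simp add: tt_pull_def F)
  have hom: "lie_hom (tt 3) (tt 4) (tt_pull 4 F :: ('k, nat \<times> nat) lie_elt \<Rightarrow> _)"
    unfolding lift tt_def[of 3]
  proof (rule lie_hom_lie_lift[OF alg(2)], goal_cases)
    case (1 g)
    obtain i j where "g = (i, j)" by (cases g)
    show ?case unfolding \<open>g = (i, j)\<close> v by (rule Rep_tt4)
  next
    case (2 s t)
    then show ?case unfolding u eval by (simp add: rel)
  qed
  have gen: "tt_pull 4 F (tgen 3 i j) = Rep_tt4 (f i j)" if "(i, j) \<in> tt_gens 3" for i j
    unfolding lift tgen_def[of 3]
  proof (subst lie_lift_class[OF alg(2)], goal_cases)
    case (1 g)
    obtain i j where "g = (i, j)" by (cases g)
    show ?case unfolding \<open>g = (i, j)\<close> v by (rule Rep_tt4)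
  next
    case (2 s t)
    then show ?case unfolding u eval by (simp add: rel)
  next
    case 3
    show ?case unfolding u eval using that by simp
  qed
  have "tt_pull 4 F (lsubst (tt 3) (Rep_fla c) (tgen 3 2 3) (tgen 3 1 2)) =
      flift (tt 4) (\<lambda>g. tt_pull 4 F (case_egen (tgen 3 2 3) (tgen 3 1 2) g)) c"
    unfolding lsubst_def flift_def[symmetric]
    by (rule lie_hom_flift[OF alg(1) hom]) (simp add: tgen_def tt_def lie_pres_simps split: egen.split)
  also have "(\<lambda>g. tt_pull 4 F (case_egen (tgen 3 2 3) (tgen 3 1 2) g)) =
      case_egen (Rep_tt4 (f 2 3)) (Rep_tt4 (f 1 2))"
    by (rule ext) (simp add: gen tt_gens_def split: egen.split)
  also have "flift (tt 4) (case_egen (Rep_tt4 (f 2 3)) (Rep_tt4 (f 1 2))) c = Rep_tt4 (tt4.sub c (f 2 3) (f 1 2))"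
    unfolding lsubst_Rep_tt4[symmetric] by (simp add: lsubst_def flift_def)
  finally show ?thesis .
qed

section \<open>The conditions defining \<open>grt1\<close> and \<open>GG_inert\<close>, for typed
  elements\<close>

definition pentagon :: "'k::comm_ring_1 fl2 \<Rightarrow> 'k tt4" where
  "pentagon c = tt4.sub c (T 3 4) (T 2 3) + tt4.sub c (T 2 4 + T 3 4) (T 1 2 + T 1 3)
    + tt4.sub c (T 2 3) (T 1 2) - tt4.sub c (T 3 4) (T 1 3 + T 2 3) - tt4.sub c (T 2 3 + T 2 4) (T 1 2)"

lemma lminus_Rep_tt4: "lminus (tt 4) (Rep_tt4 x) (Rep_tt4 y) = Rep_tt4 (x - y)"
  unfolding lminus_def Rep_tt4_simps[symmetric] by simp

lemma pent_eq: "pent (lsubst (tt 3) (Rep_fla c) (tgen 3 2 3) (tgen 3 1 2)) = Rep_tt4 (pentagon c)"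
proof -
  have nth: "Suc (Suc 0) = 2" by simp
  have "tt_pull 4 [[2], [3], [4]] (lsubst (tt 3) (Rep_fla c) (tgen 3 2 3) (tgen 3 1 2)) =
      Rep_tt4 (tt4.sub c (T 3 4) (T 2 3))"
    by (subst tt_pull_lsubst[OF _ HOL.refl]) (simp_all add: T_ordered T_brk_normal brk_linear brk_self nth del: One_nat_def)
  moreover have "tt_pull 4 [[1], [2, 3], [4]] (lsubst (tt 3) (Rep_fla c) (tgen 3 2 3) (tgen 3 1 2)) =
      Rep_tt4 (tt4.sub c (T 2 4 + T 3 4) (T 1 2 + T 1 3))"
    by (subst tt_pull_lsubst[OF _ HOL.refl]) (simp_all add: T_ordered T_brk_normal brk_linear brk_self nth del: One_nat_def)
  moreover have "tt_pull 4 [[1], [2], [3]] (lsubst (tt 3) (Rep_fla c) (tgen 3 2 3) (tgen 3 1 2)) =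
      Rep_tt4 (tt4.sub c (T 2 3) (T 1 2))"
    by (subst tt_pull_lsubst[OF _ HOL.refl]) (simp_all add: T_ordered T_brk_normal brk_linear brk_self nth del: One_nat_def)
  moreover have "tt_pull 4 [[1, 2], [3], [4]] (lsubst (tt 3) (Rep_fla c) (tgen 3 2 3) (tgen 3 1 2)) =
      Rep_tt4 (tt4.sub c (T 3 4) (T 1 3 + T 2 3))"
    by (subst tt_pull_lsubst[OF _ HOL.refl]) (simp_all add: T_ordered T_brk_normal brk_linear brk_self nth del: One_nat_def)
  moreover have "tt_pull 4 [[1], [2], [3, 4]] (lsubst (tt 3) (Rep_fla c) (tgen 3 2 3) (tgen 3 1 2)) =
      Rep_tt4 (tt4.sub c (T 2 3 + T 2 4) (T 1 2))"
    by (subst tt_pull_lsubst[OF _ HOL.refl]) (simp_all add: T_ordered T_brk_normal brk_linear brk_self nth del: One_nat_def)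
  ultimately show ?thesis
    unfolding pent_def pentagon_def by (simp add: Rep_tt4_simps[symmetric] lminus_Rep_tt4)
qed

abbreviation (input) xinf :: "'k::comm_ring_1 fl2" where
  "xinf \<equiv> - fgen E0 - fgen E1"

lemma Rep_e: "Rep_fla (fgen E0) = e0" "Rep_fla (fgen E1) = e1"
  by (simp_all add: Rep_fcls e0_def e1_def)

lemma Rep_xinf: "Rep_fla (xinf :: 'k::comm_ring_1 fl2) = einf"
proof -
  have "(xinf :: 'k fl2) = scl_fla (- 1) (fgen E0) + scl_fla (- 1) (fgen E1)" by simp
  then show ?thesis
    unfolding einf_def lminus_def Rep_e[symmetric] flie_def Rep_fla_simps[symmetric] by simp
qed

definition grt :: "'k::comm_ring_1 fl2 \<Rightarrow> bool" where
  "grt c \<longleftrightarrow> c + fla.sub c (fgen E1) (fgen E0) = 0 \<and>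
     c + fla.sub c (fgen E1) xinf + fla.sub c xinf (fgen E0) = 0 \<and>
     brk (fgen E1) c + brk xinf (fla.sub c (fgen E0) xinf) = 0 \<and> pentagon c = 0"

lemma grt1_iff: "Rep_fla c \<in> grt1 \<longleftrightarrow> grt c"
proof -
  have "Rep_fla c \<in> lcarrier flie" using Rep_fla[of c] by (simp add: flie_def)
  moreover have "Rep_fla x = lzero flie \<longleftrightarrow> x = 0" for x :: "'a fl2"
    by (metis Rep_fla_inject Rep_fla_simps(1) flie_def)
  moreover have "Rep_tt4 x = lzero (tt 4) \<longleftrightarrow> x = 0" for x :: "'a tt4"
    by (metis Rep_tt4_inject Rep_tt4_simps(1))
  moreover have "ladd flie (Rep_fla x) (Rep_fla y) = Rep_fla (x + y)"
    "lbrk flie (Rep_fla x) (Rep_fla y) = Rep_fla (brk x y)" for x y :: "'a fl2"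
    by (simp_all add: Rep_fla_simps flie_def)
  ultimately show ?thesis
    by (simp only: grt1_def grt_def mem_Collect_eq pent_eq Rep_e[symmetric] Rep_xinf[symmetric] lsubst_Rep_fla simp_thms)
qed

definition inert :: "'k::comm_ring_1 fl2 \<Rightarrow> 'k fl2 \<Rightarrow> bool" where
  "inert c h \<longleftrightarrow> h \<in> graded 2 \<and> brk c (fgen E0) + brk h xinf = 0"

lemma inert_witness_iff: "inert_witness (Rep_fla c) (Rep_fla h) \<longleftrightarrow> inert c h"
proof -
  have "ladd flie (Rep_fla x) (Rep_fla y) = Rep_fla (x + y)"
    "lbrk flie (Rep_fla x) (Rep_fla y) = Rep_fla (brk x y)" for x y :: "'a fl2"
    by (simp_all add: Rep_fla_simps flie_def)
  moreover have "Rep_fla x = lzero flie \<longleftrightarrow> x = 0" for x :: "'a fl2"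
    by (metis Rep_fla_inject Rep_fla_simps(1) flie_def)
  ultimately show ?thesis
    by (simp only: inert_witness_def inert_def Rep_fla_GG_iff Rep_e[symmetric] Rep_xinf[symmetric])
qed

lemma GG_subset: "GG \<subseteq> range Rep_fla"
proof
  fix x :: "('k::comm_ring_1, egen) lie_elt" assume "x \<in> GG"
  then show "x \<in> range Rep_fla"
  proof (induction rule: GG.induct)
    case (1 d x)
    then obtain t where "x = lie_class UNIV {} t" by (auto simp: flie_component_def)
    then show ?case by (metis Rep_fcls rangeI)
  next
    case (2 x y)
    then obtain u v where "x = Rep_fla u" "y = Rep_fla v" by blast
    then have "ladd flie x y = Rep_fla (u + v)" by (simp add: Rep_fla_simps flie_def)
    then show ?case by blast
  qed
qed

lemma GG_inert_iff: "Rep_fla c \<in> GG_inert \<longleftrightarrow> c \<in> graded 2 \<and> (\<exists>h. inert c h)"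
proof -
  have "(\<exists>h. inert_witness (Rep_fla c) h) \<longleftrightarrow> (\<exists>h. inert c h)"
    using GG_subset inert_witness_iff by (metis inert_witness_def rangeE subsetD)
  then show ?thesis by (simp add: GG_inert_def Rep_fla_GG_iff)
qed

text \<open>The substitution exchanges \<open>e0\<close> and \<open>einf\<close> and fixes
  \<open>e1\<close>. It carries statements about \<open>e0\<close> to \<open>einf\<close> and
  relates \<open>h\<close> to \<open>c\<close>.\<close>

lemma fla_sub_involution: "fla.sub (fla.sub x xinf (fgen E1)) xinf (fgen E1) = x"
  by (simp add: fla.sub_sub)

context rational_scalars
begin

lemma commute_xinf:
  fixes h :: "'k fl2"
  assumes "h \<in> graded 2" "brk h xinf = 0"
  shows "h = 0"
proof -
  have "fla.sub (brk h xinf) xinf (fgen E1) = 0" unfolding assms(2) by simp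
  then have "brk (fla.sub h xinf (fgen E1)) (fgen E0) = 0" by simp
  then have "fla.sub h xinf (fgen E1) = 0"
    by (rule commute_fgen_graded_2[OF sub_graded_2[OF assms(1)]])
  then show ?thesis using fla_sub_involution[of h] by simp
qed

lemma inert_unique:
  fixes c h h' :: "'k fl2"
  assumes "inert c h" "inert c h'"
  shows "h = h'"
proof -
  have "brk h xinf = brk h' xinf"
    using assms by (metis add_left_cancel inert_def)
  then have "brk (h - h') xinf = 0" by (simp add: brk_diff_left)
  moreover have "h - h' \<in> graded 2" using assms by (auto simp: inert_def intro: graded_2_diff)
  ultimately show ?thesis using commute_xinf by fastforce
qed

lemma hC_eq:
  fixes c h :: "'k fl2"
  assumes "inert c h"
  shows "hC (Rep_fla c) = Rep_fla h"
  unfolding hC_def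
proof (rule the_equality)
  show "inert_witness (Rep_fla c) (Rep_fla h)" using assms by (simp add: inert_witness_iff)
  fix y assume y: "inert_witness (Rep_fla c) y"
  then obtain h' where "y = Rep_fla h'" using GG_subset by (auto simp: inert_witness_def)
  then show "y = Rep_fla h" using y assms inert_unique by (auto simp: inert_witness_iff)
qed

end

section \<open>Four strands\<close>

lemma range_4: "i \<in> {1..4} \<Longrightarrow> i \<in> {1, 2, 3, 4}" for i :: nat
  by auto

lemma X4_row:
  assumes "distinct [a, b, c, d]" "{a, b, c, d} \<subseteq> {1..4}"
  shows "X a a + X a b + X a c + X a d = (0 :: 'k::comm_ring_1 pp4)"
proof -
  have "{1..4} = {a, b, c, d}"
    by (rule card_subset_eq[symmetric]) (use assms in simp_all)
  then have "(\<Sum>j=1..4. X a j) = X a a + X a b + X a c + (X a d :: 'k pp4)"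
    using assms(1) by (simp add: add.assoc)
  then show ?thesis using X_row[where 'k='k and 'n=4, of a] assms by simp
qed

lemma X4_triple: "{i, j, k} \<subseteq> {1..4} \<Longrightarrow> distinct [i, j, k] \<Longrightarrow>
    brk (X i j + X i k) (X j k :: 'k::comm_ring_1 pp4) = 0"
  using X_triple[where 'k='k and 'n=4, of i j k] by simp

lemmas X_ordered = X_sym[of 2 1] X_sym[of 3 1] X_sym[of 4 1] X_sym[of 3 2] X_sym[of 4 2] X_sym[of 4 3]
  X_sym[of 5 1] X_sym[of 5 2] X_sym[of 5 3] X_sym[of 5 4]

definition ZZ :: "'k::comm_ring_1 pp4" where
  "ZZ = X 1 2 + X 1 3 + X 2 3"

text \<open>Modulo central elements complementary pairs of strands coincide, so \<open>PP 4\<close>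
  is generated by \<open>X 1 2\<close>, \<open>X 2 3\<close> and central elements.\<close>

lemma X4_eq:
  "X 1 4 = X 2 3 - ZZ - (X 1 1 :: 'k::comm_ring_1 pp4)"
  "X 2 4 = X 1 3 - ZZ - (X 2 2 :: 'k::comm_ring_1 pp4)"
  "X 3 4 = X 1 2 - ZZ - (X 3 3 :: 'k::comm_ring_1 pp4)"
proof -
  have "X 1 1 + X 1 2 + X 1 3 + X 1 4 = (0 :: 'k pp4)"
    "X 2 2 + X 2 1 + X 2 3 + X 2 4 = (0 :: 'k pp4)"
    "X 3 3 + X 3 1 + X 3 2 + X 3 4 = (0 :: 'k pp4)"
    by (rule X4_row; simp)+
  then show "X 1 4 = X 2 3 - ZZ - (X 1 1 :: 'k::comm_ring_1 pp4)"
    "X 2 4 = X 1 3 - ZZ - (X 2 2 :: 'k::comm_ring_1 pp4)"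
    "X 3 4 = X 1 2 - ZZ - (X 3 3 :: 'k::comm_ring_1 pp4)"
    unfolding ZZ_def X_ordered by (simp_all add: algebra_simps eq_neg_iff_add_eq_0 del: One_nat_def)
qed

lemma ZZ_central: "brk ZZ (x :: 'k::comm_ring_1 pp4) = 0"
proof -
  have t: "brk (X 3 1 + X 3 2) (X 1 2 :: 'k pp4) = 0" "brk (X 2 1 + X 2 3) (X 1 3 :: 'k pp4) = 0"
    "brk (X 1 2 + X 1 3) (X 2 3 :: 'k pp4) = 0"
    by (rule X4_triple; simp)+
  have z: "ZZ = X 1 2 + (X 3 1 + X 3 2 :: 'k pp4)" "ZZ = X 1 3 + (X 2 1 + X 2 3 :: 'k pp4)"
    "ZZ = X 2 3 + (X 1 2 + X 1 3 :: 'k pp4)"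
    unfolding ZZ_def X_ordered by (simp_all add: ac_simps)
  have base: "brk ZZ (X 1 2 :: 'k pp4) = 0" "brk ZZ (X 1 3 :: 'k pp4) = 0"
    "brk ZZ (X 2 3 :: 'k pp4) = 0"
    by (simp only: z(1) brk_add_left[of "X 1 2"] t(1) brk_self add_0_right,
        simp only: z(2) brk_add_left[of "X 1 3"] t(2) brk_self add_0_right,
        simp only: z(3) brk_add_left[of "X 2 3"] t(3) brk_self add_0_right)
  have "brk ZZ (X 1 4 :: 'k pp4) = 0" "brk ZZ (X 2 4 :: 'k pp4) = 0" "brk ZZ (X 3 4 :: 'k pp4) = 0"
    unfolding X4_eq by (simp_all add: brk_diff_right base brk_self X_central' del: One_nat_def)
  note all = base this
  show ?thesis
  proof (induction x rule: pp_induct)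
    case (gen i j)
    then have "i \<in> {1, 2, 3, 4}" "j \<in> {1, 2, 3, 4}" by auto
    then show ?case
      using all by (elim insertE emptyE) (simp_all only: X_central' X_ordered)
  qed (simp_all add: brk_add_right pp.brk_scl_right brk_brk_right)
qed

lemma ZZ_central': "brk (x :: 'k::comm_ring_1 pp4) ZZ = 0"
  using ZZ_central brk_eq_0_swap by blast

text \<open>Up to the central \<open>ZZ\<close>, \<open>X 1 3\<close> is the image of
  \<open>einf\<close>. The identity makes the rows of the derivation on four strands sum to
  zero.\<close>

lemma inert_X4:
  assumes "inert c h"
  shows "brk (pp.sub c (X 2 3) (X 1 2)) (X 2 3) + brk (pp.sub h (X 2 3) (X 1 2)) (X 1 3) =
    (0 :: 'k::comm_ring_1 pp4)"
proof -
  let ?s = "\<lambda>x. pp.sub x (X 2 3) (X 1 2) :: 'k pp4"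
  have "?s (brk c (fgen E0) + brk h xinf) = 0"
    using assms by (simp add: inert_def)
  then have "brk (?s c) (X 2 3) + brk (?s h) (- X 2 3 - X 1 2) = 0" by simp
  moreover have "X 1 3 = - X 2 3 - X 1 2 + (ZZ :: 'k pp4)" by (simp add: ZZ_def)
  ultimately show ?thesis by (simp only: brk_add_right[of _ _ ZZ] ZZ_central') simp
qed

locale four_derivation = derivation scl_pp D for D :: "'k::comm_ring_1 pp4 \<Rightarrow> 'k pp4" +
  fixes c h :: "'k fl2"
  assumes diag: "i \<in> {1..4} \<Longrightarrow> D (X i i) = 0"
    and D12: "D (X 1 2) = 0" and D34: "D (X 3 4) = 0"
    and D23: "D (X 2 3) = brk (pp.sub c (X 2 3) (X 1 2)) (X 2 3)"
    and D14: "D (X 1 4) = brk (pp.sub c (X 2 3) (X 1 2)) (X 2 3)"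
    and D13: "D (X 1 3) = brk (pp.sub h (X 2 3) (X 1 2)) (X 1 3)"
    and D24: "D (X 2 4) = brk (pp.sub h (X 2 3) (X 1 2)) (X 1 3)"

text \<open>Complementary generators differ by central elements and get equal values, so the
  disjointness relations reduce to antisymmetry of the bracket, and the rows to
  \<open>u + v = 0\<close>.\<close>

lemma four_derivation_exists:
  fixes c h :: "'k::comm_ring_1 fl2"
  assumes "inert c h"
  shows "\<exists>D. four_derivation D c h"
proof -
  define u v :: "'k pp4" where "u = brk (pp.sub c (X 2 3) (X 1 2)) (X 2 3)"
    and "v = brk (pp.sub h (X 2 3) (X 1 2)) (X 1 3)"
  define d where "d i j = (if (i, j) \<in> {(2, 3), (3, 2), (1, 4), (4, 1)} then u
    else if (i, j) \<in> {(1, 3), (3, 1), (2, 4), (4, 2)} then v else 0)" for i j :: nat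
  have uv: "u + v = 0" using inert_X4[OF assms] by (simp add: u_def v_def)
  have d: "d 1 1 = 0" "d 1 2 = 0" "d 1 3 = v" "d 1 4 = u" "d 2 1 = 0" "d 2 2 = 0" "d 2 3 = u" "d 2 4 = v"
    "d 3 1 = v" "d 3 2 = u" "d 3 3 = 0" "d 3 4 = 0" "d 4 1 = u" "d 4 2 = v" "d 4 3 = 0" "d 4 4 = 0"
    by (simp_all add: d_def)
  have X: "brk y (X 1 4) = brk y (X 2 3)" "brk y (X 2 4) = brk y (X 1 3)"
    "brk (X 1 4) y = brk (X 2 3) y" "brk (X 2 4) y = brk (X 1 3) y" for y :: "'k pp4"
    unfolding X4_eq by (simp_all add: brk_diff_left brk_diff_right ZZ_central ZZ_central' X_central X_central')
  have sw: "brk (X 2 3) u = - brk u (X 2 3)" "brk (X 1 3) v = - brk v (X 1 3)"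
    by (rule brk_swap)+
  have "\<exists>D. derivation scl_pp D \<and> (\<forall>i\<in>{1..CARD(4)}. \<forall>j\<in>{1..CARD(4)}. D (X i j) = d i j)"
  proof (rule pp_derivation_exists)
    fix i j assume "{i, j} \<subseteq> {1..CARD(4)}"
    then have "i \<in> {1, 2, 3, 4}" "j \<in> {1, 2, 3, 4}" by auto
    then show "d i j = d j i" by (elim insertE emptyE) (simp_all add: d del: One_nat_def)
  next
    fix i j k l assume "{i, j, k, l} \<subseteq> {1..CARD(4)}" and dist: "distinct [i, j, k, l]"
    then have "i \<in> {1, 2, 3, 4}" "j \<in> {1, 2, 3, 4}" "k \<in> {1, 2, 3, 4}" "l \<in> {1, 2, 3, 4}"
      by (intro range_4; simp)+
    then show "brk (d i j) (X k l) + brk (X i j) (d k l) = 0"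
      using dist
      by (elim insertE emptyE) (simp_all add: d X X_ordered sw del: One_nat_def)
  next
    fix i assume "i \<in> {1..CARD(4)}"
    then have i: "i \<in> {1, 2, 3, 4}" by auto
    have "{1..4} = {1, 2, 3, 4 :: nat}" by auto
    then have "(\<Sum>j=1..4. d i j) = d i 1 + d i 2 + d i 3 + d i 4" by (simp add: add.assoc)
    also have "\<dots> = 0" using i uv by (elim insertE emptyE) (simp_all add: d add.commute del: One_nat_def)
    finally show "(\<Sum>j=1..CARD(4). d i j) = 0" by simp
    show "d i i = 0" using i by (elim insertE emptyE) (simp_all add: d del: One_nat_def)
  qed
  then obtain D where D: "derivation scl_pp D" "\<And>i j. i \<in> {1..4} \<Longrightarrow> j \<in> {1..4} \<Longrightarrow> D (X i j) = d i j"
    by auto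
  have "d i i = 0" if "i \<in> {1..4}" for i
    using range_4[OF that] by (elim insertE emptyE) (simp_all add: d del: One_nat_def)
  then have "four_derivation D c h"
    unfolding four_derivation_def four_derivation_axioms_def using D
    by (simp add: d u_def v_def del: One_nat_def)
  then show ?thesis by blast
qed

lemma (in rational_scalars) vecD_spec:
  fixes c h :: "'k fl2"
  assumes "inert c h"
  obtains D where "four_derivation D c h" "\<And>x. vecD (Rep_fla c) (Rep_pp x) = Rep_pp (D x)"
proof -
  define P where "P = (\<lambda>D :: ('k, nat \<times> nat) lie_elt \<Rightarrow> _.
     let X = Xgen 4;
         u = lbrk (PP 4) (lsubst (PP 4) (Rep_fla c) (X 2 3) (X 1 2)) (X 2 3);
         v = lbrk (PP 4) (lsubst (PP 4) (hC (Rep_fla c)) (X 2 3) (X 1 2)) (X 1 3)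
     in lie_derivation (PP 4) D \<and>
        (\<forall>i\<in>{1..4}. D (X i i) = lzero (PP 4)) \<and>
        D (X 1 2) = lzero (PP 4) \<and> D (X 3 4) = lzero (PP 4) \<and>
        D (X 2 3) = u \<and> D (X 1 4) = u \<and>
        D (X 1 3) = v \<and> D (X 2 4) = v)"
  have card: "CARD(4) = 4" by simp
  have R: "Xgen 4 i j = Rep_pp (X i j :: 'k pp4)" for i j using Rep_X[where 'k='k and 'n=4, of i j] by (simp add: card)
  have S: "lsubst (PP 4) (Rep_fla x) (Rep_pp a) (Rep_pp b) = Rep_pp (pp.sub x a b)"
    for x and a b :: "'k pp4"
    using lsubst_Rep_pp[where 'n=4, of x a b] by (simp add: card)
  have B: "lbrk (PP 4) (Rep_pp a) (Rep_pp b) = Rep_pp (brk a b)" for a b :: "'k pp4"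
    using Rep_pp_simps(4)[of a b] by (simp add: card)
  have Z: "lzero (PP 4) = Rep_pp (0 :: 'k pp4)"
    using Rep_pp_simps(1)[where 'k='k and 'n=4] by (simp add: card)
  have P: "P E \<longleftrightarrow> lie_derivation (PP 4) E \<and>
      (\<forall>i\<in>{1..4}. E (Rep_pp (X i i :: 'k pp4)) = Rep_pp (0 :: 'k pp4)) \<and>
      E (Rep_pp (X 1 2 :: 'k pp4)) = Rep_pp (0 :: 'k pp4) \<and>
      E (Rep_pp (X 3 4 :: 'k pp4)) = Rep_pp (0 :: 'k pp4) \<and>
      E (Rep_pp (X 2 3 :: 'k pp4)) = Rep_pp (brk (pp.sub c (X 2 3) (X 1 2)) (X 2 3) :: 'k pp4) \<and>
      E (Rep_pp (X 1 4 :: 'k pp4)) = Rep_pp (brk (pp.sub c (X 2 3) (X 1 2)) (X 2 3) :: 'k pp4) \<and>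
      E (Rep_pp (X 1 3 :: 'k pp4)) = Rep_pp (brk (pp.sub h (X 2 3) (X 1 2)) (X 1 3) :: 'k pp4) \<and>
      E (Rep_pp (X 2 4 :: 'k pp4)) = Rep_pp (brk (pp.sub h (X 2 3) (X 1 2)) (X 1 3) :: 'k pp4)" for E
    unfolding P_def Let_def hC_eq[OF assms] R S B Z ..
  obtain D0 where "four_derivation D0 c h" using four_derivation_exists[OF assms] ..
  then interpret D0: four_derivation D0 c h .
  have "P (\<lambda>y. Rep_pp (D0 (Abs_pp y)))"
    using lie_derivation_Rep[OF D0.derivation_axioms] unfolding P card
    by (simp add: Rep_pp_inverse D0.diag D0.D12 D0.D34 D0.D23 D0.D14 D0.D13 D0.D24 del: One_nat_def)
  then have V: "P (vecD (Rep_fla c))"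
    unfolding vecD_def P_def[symmetric] by (rule someI[of P])
  define D where "D x = (Abs_pp (vecD (Rep_fla c) (Rep_pp x)) :: 'k pp4)" for x :: "'k pp4"
  have der: "lie_derivation (PP CARD(4)) (vecD (Rep_fla c))" using V unfolding P card by simp
  have "derivation scl_pp D" unfolding D_def by (rule derivation_Abs[OF der])
  moreover have RD: "vecD (Rep_fla c) (Rep_pp x) = Rep_pp (D x)" for x
    unfolding D_def by (rule derivation_Abs(2)[OF der, symmetric])
  ultimately have "four_derivation D c h"
    using V unfolding P four_derivation_def four_derivation_axioms_def by (simp add: RD Rep_pp_inject del: One_nat_def)
  then show thesis using RD that by blast
qed

section \<open>Five strands\<close>

lemma X5_row:
  assumes "distinct [a, b, c, d, e]" "{a, b, c, d, e} \<subseteq> {1..5}"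
  shows "X a a + X a b + X a c + X a d + X a e = (0 :: 'k::comm_ring_1 pp5)"
proof -
  have "{1..5} = {a, b, c, d, e}"
    by (rule card_subset_eq[symmetric]) (use assms in simp_all)
  then have "(\<Sum>j=1..5. X a j) = X a a + X a b + X a c + X a d + (X a e :: 'k pp5)"
    using assms(1) by (simp add: add.assoc)
  then show ?thesis using X_row[where 'k='k and 'n=5, of a] assms by simp
qed

lemma X5_triple: "{i, j, k} \<subseteq> {1..5} \<Longrightarrow> distinct [i, j, k] \<Longrightarrow>
    brk (X i j + X i k) (X j k :: 'k::comm_ring_1 pp5) = 0"
  using X_triple[where 'k='k and 'n=5, of i j k] by simp

lemma X5_disjoint: "{i, j, k, l} \<subseteq> {1..5} \<Longrightarrow> distinct [i, j, k, l] \<Longrightarrow>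
    brk (X i j) (X k l :: 'k::comm_ring_1 pp5) = 0"
  using X_disjoint[where 'k='k and 'n=5, of i j k l] by simp

text \<open>The fourth strand is doubled into \<open>d\<close>, \<open>e\<close>; the maps of (a')
  and (b') are the labellings 1, 2, 3, 4, 5 and 1, 2, 4, 3, 5.\<close>

locale five_labels =
  fixes a b c d e :: nat
  assumes distinct: "distinct [a, b, c, d, e]" and subset: "{a, b, c, d, e} \<subseteq> {1..5}"
begin

definition merge :: "nat \<Rightarrow> nat \<Rightarrow> 'k::comm_ring_1 pp5" where
  "merge i j = (\<Sum>(i', j')\<leftarrow>List.product ([[a], [b], [c], [d, e]] ! (i - 1)) ([[a], [b], [c], [d, e]] ! (j - 1)).
     X i' j')"

lemma merge_simps:
  "merge 1 1 = X a a" "merge 2 2 = X b b" "merge 3 3 = X c c"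
  "merge 1 2 = X a b" "merge 1 3 = X a c" "merge 2 3 = X b c"
  "merge 1 4 = X a d + X a e" "merge 2 4 = X b d + X b e" "merge 3 4 = X c d + X c e"
  "merge 4 4 = X d d + X d e + X d e + X e e"
  "merge 2 1 = X a b" "merge 3 1 = X a c" "merge 3 2 = X b c"
  "merge 4 1 = X a d + X a e" "merge 4 2 = X b d + X b e" "merge 4 3 = X c d + X c e"
  by (simp_all add: merge_def X_sym[of b a] X_sym[of c a] X_sym[of c b] X_sym[of d a] X_sym[of d b]
      X_sym[of d c] X_sym[of e a] X_sym[of e b] X_sym[of e c] X_sym[of e d] add.assoc)

lemma sphere_images_merge: "sphere_images TYPE(4) scl_pp (merge :: nat \<Rightarrow> nat \<Rightarrow> 'k::comm_ring_1 pp5)"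
proof
  {
    fix i j assume "{i, j} \<subseteq> {1..CARD(4)}"
    then have "i \<in> {1, 2, 3, 4}" "j \<in> {1, 2, 3, 4}" by auto
    then show "merge i j = (merge j i :: 'k pp5)"
      by (elim insertE emptyE) (simp_all add: merge_simps del: One_nat_def)
  next
    fix i j k l assume "{i, j, k, l} \<subseteq> {1..CARD(4)}" and dist: "distinct [i, j, k, l]"
    then have "i \<in> {1, 2, 3, 4}" "j \<in> {1, 2, 3, 4}" "k \<in> {1, 2, 3, 4}" "l \<in> {1, 2, 3, 4}"
      by (intro range_4; simp)+
    moreover have "brk (X a b) (X c d :: 'k pp5) = 0" "brk (X a b) (X c e :: 'k pp5) = 0"
      "brk (X a c) (X b d :: 'k pp5) = 0" "brk (X a c) (X b e :: 'k pp5) = 0"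
      "brk (X b c) (X a d :: 'k pp5) = 0" "brk (X b c) (X a e :: 'k pp5) = 0"
      "brk (X c d) (X a b :: 'k pp5) = 0" "brk (X c e) (X a b :: 'k pp5) = 0"
      "brk (X b d) (X a c :: 'k pp5) = 0" "brk (X b e) (X a c :: 'k pp5) = 0"
      "brk (X a d) (X b c :: 'k pp5) = 0" "brk (X a e) (X b c :: 'k pp5) = 0"
      by (rule X5_disjoint; use distinct subset in auto)+
    ultimately show "brk (merge i j) (merge k l) = (0 :: 'k pp5)"
      using dist by (elim insertE emptyE) (simp_all add: merge_simps brk_linear del: One_nat_def)
  next
    fix i assume "i \<in> {1..CARD(4)}"
    then have i: "i \<in> {1, 2, 3, 4}" by auto
    have r: "X a a + X a b + X a c + X a d + X a e = (0 :: 'k pp5)"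
      "X b b + X b a + X b c + X b d + X b e = (0 :: 'k pp5)"
      "X c c + X c a + X c b + X c d + X c e = (0 :: 'k pp5)"
      "X d d + X d a + X d b + X d c + X d e = (0 :: 'k pp5)"
      "X e e + X e a + X e b + X e c + X e d = (0 :: 'k pp5)"
      by (rule X5_row; use distinct subset in auto)+
    have "{1..4} = {1, 2, 3, 4 :: nat}" by auto
    then have "(\<Sum>j=1..4. merge i j :: 'k pp5) = merge i 1 + merge i 2 + merge i 3 + merge i 4"
      by (simp add: add.assoc)
    also have "\<dots> = 0"
      using i
    proof (elim insertE emptyE)
      assume "i = 1"
      then show ?thesis using r(1) by (simp add: merge_simps add.assoc del: One_nat_def)
    next
      assume "i = 2"
      then show ?thesis using r(2) by (simp add: merge_simps X_sym[of b a] ac_simps del: One_nat_def)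
    next
      assume "i = 3"
      then show ?thesis using r(3) by (simp add: merge_simps X_sym[of c a] X_sym[of c b] ac_simps del: One_nat_def)
    next
      assume "i = 4"
      moreover have "X a d + X a e + (X b d + X b e) + (X c d + X c e) + (X d d + X d e + X d e + X e e) =
          (X d d + X d a + X d b + X d c + X d e) + (X e e + X e a + X e b + X e c + X e d :: 'k pp5)"
        by (simp add: X_sym[of d a] X_sym[of d b] X_sym[of d c] X_sym[of e a] X_sym[of e b]
            X_sym[of e c] X_sym[of e d] ac_simps)
      ultimately show ?thesis using r(4,5) by (simp add: merge_simps del: One_nat_def)
    qed
    finally show "(\<Sum>j=1..CARD(4). merge i j) = (0 :: 'k pp5)" by simp
  next
    fix i j k assume "{i, j, k} \<subseteq> {1..CARD(4)}"
    then have i: "i \<in> {1, 2, 3, 4}" "j \<in> {1, 2, 3, 4}" "k \<in> {1, 2, 3, 4}"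
      by (intro range_4; simp)+
    \<comment> \<open>The doubled strand has the frame \<open>X d d + 2 X d e + X e e\<close>; its
      middle term is not central, but commutes with the image of the map.\<close>
    have "brk (X d e) (X a b :: 'k pp5) = 0" "brk (X d e) (X a c :: 'k pp5) = 0"
      "brk (X d e) (X b c :: 'k pp5) = 0"
      by (rule X5_disjoint; use distinct subset in auto)+
    moreover have "brk (X a d + X a e) (X d e :: 'k pp5) = 0"
      "brk (X b d + X b e) (X d e :: 'k pp5) = 0" "brk (X c d + X c e) (X d e :: 'k pp5) = 0"
      by (rule X5_triple; use distinct subset in auto)+
    then have "brk (X d e) (X a d + X a e :: 'k pp5) = 0"
      "brk (X d e) (X b d + X b e :: 'k pp5) = 0" "brk (X d e) (X c d + X c e :: 'k pp5) = 0"
      using brk_eq_0_swap by blast+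
    ultimately have "brk (X d e) (merge j k :: 'k pp5) = 0"
      using i(2,3)
      by (elim insertE emptyE)
        (simp_all add: merge_simps brk_add_right[of _ "X d d + X d e + X d e"]
          brk_add_right[of _ "X d d + X d e"] brk_add_right[of _ "X d d"] X_central' brk_self del: One_nat_def)
    then show "brk (merge i i) (merge j k :: 'k pp5) = 0"
      using i(1) by (elim insertE emptyE)
        (simp_all add: merge_simps brk_add_left X_central del: One_nat_def)
  }
qed

lemma PP_pull_merge:
  "PP_pull 5 [[a], [b], [c], [d, e]] (Rep_pp (x :: 'k::comm_ring_1 pp4)) =
    Rep_pp (pp.plift merge x :: 'k pp5)"
  using PP_pull_Rep[where 'k='k and 'n=4 and 'm=5, of "[[a], [b], [c], [d, e]]" x]
  by (simp add: merge_def[abs_def])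

lemma plift_merge_hom: "typed_lie_hom scl_pp scl_pp (pp.plift merge :: 'k::comm_ring_1 pp4 \<Rightarrow> 'k pp5)"
  by (rule sphere_images.plift_hom[OF sphere_images_merge])

lemma plift_merge_X:
  "i \<in> {1..4} \<Longrightarrow> j \<in> {1..4} \<Longrightarrow> pp.plift merge (X i j :: 'k::comm_ring_1 pp4) = (merge i j :: 'k pp5)"
  using sphere_images.plift_X[OF sphere_images_merge, of i j] by simp

lemma intertwines_merge:
  fixes c' :: "'k::comm_ring_1 fl2" and D4 :: "'k pp4 \<Rightarrow> 'k pp4"
  assumes "\<And>x. vecD (Rep_fla c') (Rep_pp x) = Rep_pp (D4 x :: 'k pp4)"
  shows "intertwines (PP 4) (PP_pull 5 [[a], [b], [c], [d, e]]) (vecD (Rep_fla c')) E \<longleftrightarrow>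
    (\<forall>x. E (Rep_pp (pp.plift merge x :: 'k pp5)) = Rep_pp (pp.plift merge (D4 x) :: 'k pp5))"
proof -
  have "lcarrier (PP 4) = range (Rep_pp :: 'k pp4 \<Rightarrow> _)"
    using type_definition.Rep_range[OF type_definition_pp[where 'k='k and 'n=4]] by simp
  then show ?thesis
    by (simp add: intertwines_def assms PP_pull_merge)
qed

end

section \<open>Elements of the Grothendieck--Teichmueller Lie algebra\<close>

text \<open>At a linear element \<open>r e0 + s e1\<close> the pentagon equals
  \<open>r T 3 4 + s T 1 2\<close>. This is why elements of \<open>grt1\<close> lie in
  \<open>GG\<close>.\<close>

lemma grt_graded_2:
  fixes c :: "'k::comm_ring_1 fl2"
  assumes "pentagon c = 0"
  shows "c \<in> graded 2"
proof -
  obtain r s g where g: "g \<in> graded 2" and c: "c = scl_fla r (fgen E0) + scl_fla s (fgen E1) + g"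
    using linear_part by blast
  have lin: "lin p q (tt4.sub c a b) = r * lin p q a + s * lin p q b" for p q a b
    using g by (simp add: c)
  have T: "(1, 2) \<in> tt_gens 4" "(1, 3) \<in> tt_gens 4" "(2, 3) \<in> tt_gens 4" "(2, 4) \<in> tt_gens 4"
    "(3, 4) \<in> tt_gens 4"
    by (simp_all add: tt_gens_def)
  have "lin 3 4 (pentagon c) = r" "lin 1 2 (pentagon c) = s"
    by (simp_all add: pentagon_def lin lin_T T del: One_nat_def)
  then have "r = 0" "s = 0" by (simp_all add: assms)
  then show ?thesis using g by (simp add: c)
qed

context typed_lie_algebra
begin

lemma grt_antisym: "grt c \<Longrightarrow> sub c b a = - sub c a b"
proof -
  assume "grt c"
  then have "sub (c + fla.sub c (fgen E1) (fgen E0)) a b = 0" by (simp add: grt_def)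
  then show ?thesis by (simp add: sub_sub eq_neg_iff_add_eq_0 add.commute)
qed

text \<open>The third defining equation at \<open>(y, x)\<close>, where \<open>- y - x\<close> may
  be replaced by \<open>x'\<close> since they differ by an element commuting with \<open>x\<close>
  and \<open>y\<close>; antisymmetry brings it to the form of inertness.\<close>

lemma grt_third:
  assumes "grt c" and z: "brk (x + y + x') x = 0" "brk (x + y + x') y = 0"
  shows "brk (sub c x y) x + brk (sub c x' y) x' = 0"
proof -
  let ?z = "x + y + x'"
  have c: "c \<in> graded 2" using assms(1) by (simp add: grt_def grt_graded_2)
  have "sub (brk (fgen E1) c + brk xinf (fla.sub c (fgen E0) xinf)) y x = 0"
    using assms(1) by (simp add: grt_def)
  then have *: "brk x (sub c y x) + brk (- y - x) (sub c y (- y - x)) = 0"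
    by (simp add: sub_sub)
  have "sub c x' y = sub c (- y - x) y"
    by (rule sub_graded_2_cong[OF c]) (use z in \<open>simp_all add: brk_linear algebra_simps\<close>)
  then have x': "sub c x' y = - sub c y (- y - x)"
    using grt_antisym[OF assms(1)] by metis
  have "brk ?z (- y - x) = 0"
    by (simp only: brk_diff_right brk_minus_right z) simp
  then have "brk ?z (sub c x' y) = 0"
    unfolding x' brk_minus_right by (simp only: sub_commute[OF z(2)] neg_equal_0_iff_equal)
  then have "brk (sub c x' y) ?z = 0" using brk_eq_0_swap by blast
  moreover have "x' = ?z + (- y - x)" by simp
  ultimately have "brk (sub c x' y) x' = brk (sub c x' y) (- y - x)"
    by (metis brk_add_right add_0)
  also have "\<dots> = brk (- y - x) (sub c y (- y - x))"
    unfolding x' by (subst brk_swap) (simp add: brk_minus_right)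
  moreover have "brk (sub c x y) x = brk x (sub c y x)"
    unfolding grt_antisym[OF assms(1), of y x] by (subst brk_swap) (simp add: brk_minus_right)
  ultimately show ?thesis using * by simp
qed

lemma grt_hexagon:
  assumes "grt c" and z: "brk (x + y + x') x = 0" "brk (x + y + x') y = 0"
  shows "sub c x y + sub c y x' + sub c x' x = 0"
proof -
  have c: "c \<in> graded 2" using assms(1) by (simp add: grt_def grt_graded_2)
  have "sub (c + fla.sub c (fgen E1) xinf + fla.sub c xinf (fgen E0)) x y = 0"
    using assms(1) by (simp add: grt_def)
  then have "sub c x y + sub c y (- x - y) + sub c (- x - y) x = 0" by (simp add: sub_sub)
  moreover have "sub c x' x = sub c (- x - y) x" "sub c y x' = sub c y (- x - y)"
    by (rule sub_graded_2_cong[OF c]; use z in \<open>simp add: brk_linear algebra_simps\<close>)+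
  ultimately show ?thesis by simp
qed

end

lemma grt_inert: "grt c \<Longrightarrow> inert c (fla.sub c xinf (fgen E1))"
  unfolding inert_def
  using fla.grt_third[of c "fgen E0" "fgen E1" xinf] grt_graded_2[of c]
  by (simp add: sub_graded_2 grt_def)

subsection \<open>Identities on five strands\<close>

text \<open>The condition for a derivation with values \<open>brk u p\<close> on \<open>p\<close>
  and \<open>brk v q\<close> on \<open>q\<close> to preserve \<open>brk p q = 0\<close>. Subtracting
  \<open>a\<close> from \<open>u\<close> and adding \<open>b\<close> to \<open>v\<close> changes
  neither value, and makes both restrictions of one inner derivation.\<close>

lemma (in lie_ring) brk_brk_disjoint:
  assumes "brk p q = 0" "u - v = a + b" "brk a p = 0" "brk b q = 0"
  shows "brk (brk u p) q + brk p (brk v q) = 0"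
proof -
  have u: "u = v + (a + b)" using assms(2) by (simp add: algebra_simps)
  have "brk p (brk v q) = brk (brk p v) q"
    using brk_brk_right[of p v q] assms(1) by simp
  also have "brk p v = - brk v p" by (rule brk_swap)
  finally have "brk (brk u p) q + brk p (brk v q) = brk (brk b p) q"
    unfolding u by (simp add: brk_add_left brk_minus_left assms(3))
  also have "\<dots> = 0"
    using assms(1,4) by (simp add: brk_brk_left)
  finally show ?thesis .
qed

text \<open>Adding the rows of \<open>b\<close>, \<open>c\<close>, \<open>d\<close> and subtracting
  those of \<open>a\<close>, \<open>e\<close> cancels the mixed pairs and counts the others twice.
  Hence twice the element is a combination of the central \<open>X i i\<close>, and 2 is
  invertible.\<close>

lemma (in rational_scalars) complement_central:
  assumes "distinct [a, b, c, d, e]" "{a, b, c, d, e} \<subseteq> {1..5}"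
  shows "brk (X b c + X b d + X c d - X a e) (y :: 'k pp5) = 0"
proof -
  let ?z = "X b c + X b d + X c d - X a e :: 'k pp5"
  have r: "X a a + X a b + X a c + X a d + X a e = (0 :: 'k pp5)"
    "X b b + X b a + X b c + X b d + X b e = (0 :: 'k pp5)"
    "X c c + X c a + X c b + X c d + X c e = (0 :: 'k pp5)"
    "X d d + X d a + X d b + X d c + X d e = (0 :: 'k pp5)"
    "X e e + X e a + X e b + X e c + X e d = (0 :: 'k pp5)"
    by (rule X5_row; use assms in auto)+
  have "?z + ?z = (X b b + X b a + X b c + X b d + X b e) + (X c c + X c a + X c b + X c d + X c e) +
      (X d d + X d a + X d b + X d c + X d e) - (X a a + X a b + X a c + X a d + X a e) -
      (X e e + X e a + X e b + X e c + X e d) - X b b - X c c - X d d + X a a + X e e"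
    by (simp add: X_sym[of b a] X_sym[of c a] X_sym[of d a] X_sym[of e a] X_sym[of c b] X_sym[of d b]
      X_sym[of e b] X_sym[of d c] X_sym[of e c] X_sym[of e d] algebra_simps)
  then have "?z + ?z = X a a + X e e - X b b - X c c - X d d"
    unfolding r by simp
  then have "brk (?z + ?z) y = 0"
    by (simp only: brk_add_left[of "X a a"] brk_diff_left X_central) simp
  then have "brk ?z y + brk ?z y = 0" by (simp only: brk_add_left)
  then have "scl_pp (of_nat 2) (brk ?z y) = 0"
    using pp.add_scl[of 1 1 "brk ?z y"] by (simp only: of_nat_numeral one_add_one pp.scl_one)
  then have "scl_pp (inv_nat 2 * of_nat 2) (brk ?z y) = 0"
    by (simp only: pp.scl_scl pp.scl_zero_right)
  then show ?thesis using inv_nat[of 2] by (simp only: mult.commute[of "inv_nat 2"]) simp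
qed

text \<open>The pentagon equation is transported to strands \<open>a\<close>, \<open>b\<close>,
  \<open>c\<close>, \<open>d\<close>; \<open>complement_central\<close> then trades sums over
  strands for complementary pairs, until the five terms run around the cycle.\<close>

lemma (in rational_scalars) pentagon_five:
  fixes x :: "'k fl2"
  assumes dist: "distinct [a, b, c, d, e]" "{a, b, c, d, e} \<subseteq> {1..5}" and x: "grt x"
  shows "pp.sub x (X a b) (X b c) + pp.sub x (X b c) (X c d) + pp.sub x (X c d) (X d e) +
    pp.sub x (X d e) (X e a) + pp.sub x (X e a) (X a b) = (0 :: 'k pp5)"
proof -
  define s where "s p = [a, b, c, d] ! (p - 1)" for p
  have s: "s 1 = a" "s 2 = b" "s 3 = c" "s 4 = d" by (simp_all add: s_def)
  have in_range: "1 \<le> s p" "s p \<le> 5" if "p \<in> {1..4}" for p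
    using range_4[OF that] dist(2) by (auto simp: s simp del: One_nat_def)
  have inj: "s p \<noteq> s q" if "p \<in> {1..4}" "q \<in> {1..4}" "p \<noteq> q" for p q
  proof -
    from dist(1) have "a \<noteq> b" "a \<noteq> c" "a \<noteq> d" "b \<noteq> c" "b \<noteq> d" "c \<noteq> d" by auto
    then show ?thesis
      using range_4[OF that(1)] range_4[OF that(2)] that(3) by (auto simp: s simp del: One_nat_def)
  qed
  interpret b: braid_images scl_pp "\<lambda>p q. X (s p) (s q) :: 'k pp5"
  proof
    fix p q show "X (s p) (s q) = (X (s q) (s p) :: 'k pp5)" by (rule X_sym)
  next
    fix p q r :: nat assume "{p, q, r} \<subseteq> {1..4}" "distinct [p, q, r]"
    then have "s p \<noteq> s q" "s p \<noteq> s r" "s q \<noteq> s r" "{s p, s q, s r} \<subseteq> {1..5}"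
      by (simp_all add: inj in_range[unfolded One_nat_def])
    then show "brk (X (s p) (s q) + X (s p) (s r)) (X (s q) (s r) :: 'k pp5) = 0"
      by (intro X5_triple) simp_all
  next
    fix p q r t :: nat assume "{p, q, r, t} \<subseteq> {1..4}" "distinct [p, q, r, t]"
    then have "s p \<noteq> s q" "s p \<noteq> s r" "s q \<noteq> s r" "s p \<noteq> s t" "s q \<noteq> s t" "s r \<noteq> s t"
      "{s p, s q, s r, s t} \<subseteq> {1..5}"
      by (simp_all add: inj in_range[unfolded One_nat_def])
    then show "brk (X (s p) (s q)) (X (s r) (s t) :: 'k pp5) = 0"
      by (intro X5_disjoint) simp_all
  qed
  interpret h: typed_lie_hom scl_tt4 scl_pp "pp.tlift (\<lambda>p q. X (s p) (s q) :: 'k pp5)"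
    by (rule b.tlift_hom)
  have x2: "x \<in> graded 2" using x by (simp add: grt_def grt_graded_2)
  have "pp.tlift (\<lambda>p q. X (s p) (s q) :: 'k pp5) (pentagon x) = 0"
    using x by (simp add: grt_def h.hom_zero)
  then have P: "pp.sub x (X c d) (X b c) + pp.sub x (X b d + X c d) (X a b + X a c)
    + pp.sub x (X b c) (X a b) - pp.sub x (X c d) (X a c + X b c) - pp.sub x (X b c + X b d) (X a b) =
    (0 :: 'k pp5)"
    by (simp add: pentagon_def h.hom_simps b.tlift_T s del: One_nat_def)
  define z z' :: "'k pp5" where "z = X b c + X b d + X c d - X a e" and "z' = X a b + X a c + X b c - X e d"
  have z: "brk z y = 0" "brk y z = 0" and z': "brk z' y = 0" "brk y z' = 0" for y
  proof -
    show 1: "brk z y = 0" unfolding z_def by (rule complement_central) (rule dist)+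
    show 2: "brk z' y = 0" unfolding z'_def by (rule complement_central) (use dist in auto)
    show "brk y z = 0" "brk y z' = 0" using 1 2 brk_eq_0_swap by blast+
  qed
  have disj: "brk (X b c) (X a e :: 'k pp5) = 0" "brk (X b c) (X d e :: 'k pp5) = 0"
    "brk (X a b) (X c d :: 'k pp5) = 0" "brk (X a b) (X d e :: 'k pp5) = 0"
    "brk (X c d) (X a e :: 'k pp5) = 0" "brk (X c d) (X a b :: 'k pp5) = 0"
    by (rule X5_disjoint; use dist in auto)+
  \<comment> \<open>Each change of argument is a central element minus a generator that commutes
    with the new arguments, as \<open>sub_graded_2_cong\<close> demands.\<close>
  have e: "X b d + X c d - X a e = z - X b c" "X a b + X a c - X d e = z' - X b c"
    "X a c + X b c - X d e = z' - X a b" "X b c + X b d - X a e = z - X c d"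
    unfolding z_def z'_def X_sym[of e d] by (simp_all add: algebra_simps)
  have "pp.sub x (X b d + X c d) (X a b + X a c) = (pp.sub x (X a e) (X d e) :: 'k pp5)"
    by (rule pp.sub_graded_2_cong[OF x2]; (unfold e)?)
      (simp_all add: brk_diff_left brk_diff_right z z' disj brk_self)
  moreover have "pp.sub x (X c d) (X a c + X b c) = (pp.sub x (X c d) (X d e) :: 'k pp5)"
    by (rule pp.sub_graded_2_cong[OF x2]; (unfold e)?)
      (simp_all add: brk_diff_left brk_diff_right z z' disj brk_self)
  moreover have "pp.sub x (X b c + X b d) (X a b) = (pp.sub x (X a e) (X a b) :: 'k pp5)"
    by (rule pp.sub_graded_2_cong[OF x2]; (unfold e)?)
      (simp_all add: brk_diff_left brk_diff_right z z' disj brk_self)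
  moreover have "pp.sub x (X c d) (X b c) = - pp.sub x (X b c) (X c d :: 'k pp5)"
    "pp.sub x (X b c) (X a b) = - pp.sub x (X a b) (X b c :: 'k pp5)"
    "pp.sub x (X a e) (X d e) = - pp.sub x (X d e) (X a e :: 'k pp5)"
    by (rule pp.grt_antisym[OF x])+
  ultimately have "- (pp.sub x (X a b) (X b c) + pp.sub x (X b c) (X c d) + pp.sub x (X c d) (X d e) +
    pp.sub x (X d e) (X a e) + pp.sub x (X a e) (X a b)) = (0 :: 'k pp5)"
    using P by (simp add: algebra_simps)
  then show ?thesis unfolding X_sym[of e a] by (simp only: neg_equal_0_iff_equal)
qed

section \<open>Relations preserved by the derivation attached to the tree
  \<open>(i i') m (j j')\<close>\<close>

locale grt_five = rational_scalars inv_nat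
  for inv_nat :: "nat \<Rightarrow> 'k::comm_ring_1" +
  fixes c :: "'k fl2" and i i' m j j' :: nat
  assumes grt: "grt c"
    and dist: "distinct [i, i', m, j, j']" and range: "{i, i', m, j, j'} \<subseteq> {1..5}"
begin

abbreviation (input) C :: "'k pp5 \<Rightarrow> 'k pp5 \<Rightarrow> 'k pp5" where
  "C \<equiv> pp.sub c"

abbreviation (input) Y :: "nat \<Rightarrow> nat \<Rightarrow> 'k pp5" where
  "Y \<equiv> X"

lemma antisym: "C y x = - C x y"
  by (rule pp.grt_antisym[OF grt])

lemma triple_central:
  assumes "{p, q, r} \<subseteq> {1..5}" "distinct [p, q, r]"
  shows "brk (Y p q + Y p r + Y q r) (Y p q) = 0" "brk (Y p q + Y p r + Y q r) (Y p r) = 0"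
    "brk (Y p q + Y p r + Y q r) (Y q r) = 0"
proof -
  have t: "brk (Y r p + Y r q) (Y p q) = 0" "brk (Y q p + Y q r) (Y p r) = 0" "brk (Y p q + Y p r) (Y q r) = 0"
    by (rule X5_triple; use assms in auto)+
  have e: "Y p q + Y p r + Y q r = Y p q + (Y r p + Y r q)" "Y p q + Y p r + Y q r = Y p r + (Y q p + Y q r)"
    "Y p q + Y p r + Y q r = Y q r + (Y p q + Y p r)"
    unfolding X_sym[of r p] X_sym[of r q] X_sym[of q p] by (simp_all add: ac_simps)
  show "brk (Y p q + Y p r + Y q r) (Y p q) = 0"
    unfolding e(1) brk_add_left[of "Y p q"] t(1) brk_self by simp
  show "brk (Y p q + Y p r + Y q r) (Y p r) = 0"
    unfolding e(2) brk_add_left[of "Y p r"] t(2) brk_self by simp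
  show "brk (Y p q + Y p r + Y q r) (Y q r) = 0"
    unfolding e(3) brk_add_left[of "Y q r"] t(3) brk_self by simp
qed

lemma third:
  assumes "{p, q, r} \<subseteq> {1..5}" "distinct [p, q, r]"
  shows "brk (C (Y p q) (Y q r)) (Y p q) + brk (C (Y p r) (Y q r)) (Y p r) = 0"
proof (rule pp.grt_third[OF grt])
  have "Y p q + Y q r + Y p r = Y p q + Y p r + Y q r" by (simp add: ac_simps)
  then show "brk (Y p q + Y q r + Y p r) (Y p q) = 0" "brk (Y p q + Y q r + Y p r) (Y q r) = 0"
    unfolding \<open>Y p q + Y q r + Y p r = _\<close> using triple_central[OF assms] by blast+
qed

text \<open>The value of the derivation on \<open>X i j\<close> for the tree \<open>(i i') m (j j')\<close>, with its two expressions
  exchanged by the symmetry of the tree.\<close>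

definition cross :: "'k pp5" where
  "cross = brk (C (Y i j) (Y i i') + C (Y m j') (Y j j')) (Y i j)"

text \<open>By the pentagon \<open>i', i, j, j', m\<close> the two expressions differ by a Lie
  polynomial in \<open>Y m j'\<close> and \<open>Y m i'\<close>, which commutes with
  \<open>Y i j\<close>.\<close>

lemma cross_flip: "cross = brk (C (Y i j) (Y j j') + C (Y m i') (Y i i')) (Y i j)"
proof -
  have "C (Y i' i) (Y i j) + C (Y i j) (Y j j') + C (Y j j') (Y j' m) + C (Y j' m) (Y m i') + C (Y m i') (Y i' i) = 0"
    by (rule pentagon_five[OF _ _ grt]) (use dist range in auto)
  then have "C (Y i j) (Y i i') + C (Y m j') (Y j j') =
      C (Y i j) (Y j j') + C (Y m i') (Y i i') + C (Y m j') (Y m i')"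
    unfolding X_sym[of i' i] X_sym[of j' m] antisym[of "Y i j" "Y i i'"] antisym[of "Y j j'" "Y m j'"]
    by (simp add: algebra_simps)
  moreover have "brk (C (Y m j') (Y m i')) (Y i j) = 0"
    unfolding brk_eq_0_swap[of _ "Y i j"]
    by (rule pp.sub_commute; rule X5_disjoint; use dist range in auto)
  ultimately show ?thesis
    unfolding cross_def by (simp add: brk_add_left)
qed

end

context rational_scalars
begin

lemma grt_fiveI:
  "grt c \<Longrightarrow> distinct [i, i', m, j, j'] \<Longrightarrow> {i, i', m, j, j'} \<subseteq> {1..5} \<Longrightarrow> grt_five inv_nat c i i' m j j'"
  by unfold_locales

end

context grt_five
begin

definition cross' :: "'k pp5" where
  "cross' = brk (C (Y i j') (Y i i') + C (Y m j) (Y j j')) (Y i j')"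

text \<open>In the flipped form the sum contains \<open>third\<close> for \<open>i, j, j'\<close>.
  The row relation replaces \<open>Y i j + Y i j'\<close> by \<open>Y m i'\<close> in what remains,
  which is then \<open>third\<close> for \<open>m, i, i'\<close>.\<close>

lemma row_outer:
  "brk (C (Y i m) (Y i i')) (Y i m) + cross + cross' = 0"
proof -
  interpret o: grt_five inv_nat c i i' m j' j
    by (rule grt_fiveI[OF grt]) (use dist range in auto)
  have c': "cross' = o.cross"
    unfolding cross'_def o.cross_def X_sym[of j' j] ..
  have "brk (C (Y m i') (Y i i')) (Y i j + Y i j') = brk (C (Y m i') (Y i i')) (Y m i')"
  proof -
    have "Y i i + Y i i' + Y i m + Y i j + Y i j' = 0"
      by (rule X5_row) (use dist range in auto)
    then have "Y i j + Y i j' = Y m i' - (Y i m + Y i i' + Y m i') - Y i i"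
      by (simp add: algebra_simps eq_neg_iff_add_eq_0)
    moreover have "brk (Y i m + Y i i' + Y m i') (C (Y m i') (Y i i')) = 0"
      by (rule pp.sub_commute; rule triple_central; use dist range in auto)
    then have "brk (C (Y m i') (Y i i')) (Y i m + Y i i' + Y m i') = 0"
      using brk_eq_0_swap by blast
    ultimately show ?thesis by (simp only: brk_diff_right X_central') simp
  qed
  moreover have "brk (C (Y m i) (Y i i')) (Y m i) + brk (C (Y m i') (Y i i')) (Y m i') = 0"
    by (rule third) (use dist range in auto)
  moreover have "brk (C (Y i j) (Y j j')) (Y i j) + brk (C (Y i j') (Y j j')) (Y i j') = 0"
    by (rule third) (use dist range in auto)
  ultimately show ?thesis
    unfolding c' cross_flip o.cross_flip X_sym[of j' j] X_sym[of i m]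
    by (simp add: brk_add_left brk_add_right algebra_simps)
qed

lemma disjoint_adjacent:
  "brk (brk (C (Y m j) (Y j j')) (Y m j)) (Y i j') + brk (Y m j) cross' = 0"
  unfolding cross'_def
proof (rule brk_brk_disjoint)
  show "C (Y m j) (Y j j') - (C (Y i j') (Y i i') + C (Y m j) (Y j j')) = - C (Y i j') (Y i i') + 0"
    by simp
  show "brk (- C (Y i j') (Y i i')) (Y m j) = 0"
    unfolding brk_minus_left neg_equal_0_iff_equal brk_eq_0_swap[of _ "Y m j"]
    by (rule pp.sub_commute; rule X5_disjoint; use dist range in auto)
  show "brk (Y m j) (Y i j') = 0"
    by (rule X5_disjoint) (use dist range in auto)
qed simp

text \<open>The pentagon \<open>j, i, i', j', m\<close> and the hexagon on \<open>m, j, j'\<close>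
  split the difference of the two inner elements into a part commuting with \<open>Y i j\<close> and
  one commuting with \<open>Y i' j'\<close>.\<close>

lemma disjoint_crossing:
  "brk cross (Y i' j') +
    brk (Y i j) (brk (C (Y i' j') (Y i i') + C (Y m j) (Y j j')) (Y i' j')) = 0"
  unfolding cross_def
proof (rule brk_brk_disjoint)
  have "C (Y j i) (Y i i') + C (Y i i') (Y i' j') + C (Y i' j') (Y j' m) + C (Y j' m) (Y m j) + C (Y m j) (Y j i) = 0"
    by (rule pentagon_five[OF _ _ grt]) (use dist range in auto)
  then have p: "C (Y i j) (Y i i') - C (Y i' j') (Y i i') + C (Y i' j') (Y m j') + C (Y m j') (Y m j)
      + C (Y m j) (Y i j) = 0"
    unfolding X_sym[of j i] X_sym[of j' m] antisym[of "Y i' j'" "Y i i'"] by simp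
  have "C (Y m j) (Y m j') + C (Y m j') (Y j j') + C (Y j j') (Y m j) = 0"
    by (rule pp.grt_hexagon[OF grt]; rule triple_central; use dist range in auto)
  then have h: "C (Y m j') (Y m j) = C (Y m j') (Y j j') - C (Y m j) (Y j j')"
    unfolding antisym[of "Y m j'" "Y m j"] antisym[of "Y m j" "Y j j'"]
    by (simp add: algebra_simps neg_eq_iff_add_eq_0)
  show "C (Y i j) (Y i i') + C (Y m j') (Y j j') - (C (Y i' j') (Y i i') + C (Y m j) (Y j j')) =
      - C (Y i' j') (Y m j') + - C (Y m j) (Y i j)"
    using p unfolding h by (simp add: algebra_simps eq_neg_iff_add_eq_0)
  show "brk (- C (Y i' j') (Y m j')) (Y i j) = 0"
    unfolding brk_minus_left neg_equal_0_iff_equal brk_eq_0_swap[of _ "Y i j"]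
    by (rule pp.sub_commute; rule X5_disjoint; use dist range in auto)
  show "brk (- C (Y m j) (Y i j)) (Y i' j') = 0"
    unfolding brk_minus_left neg_equal_0_iff_equal brk_eq_0_swap[of _ "Y i' j'"]
    by (rule pp.sub_commute; rule X5_disjoint; use dist range in auto)
  show "brk (Y i j) (Y i' j') = 0"
    by (rule X5_disjoint) (use dist range in auto)
qed

lemma disjoint_pair: "brk (Y i i') (brk (C (Y m j) (Y j j')) (Y m j)) = 0"
proof -
  have "brk (Y i i') (C (Y m j) (Y j j')) = 0"
    by (rule pp.sub_commute; rule X5_disjoint; use dist range in auto)
  moreover have "brk (Y i i') (Y m j) = 0"
    by (rule X5_disjoint) (use dist range in auto)
  ultimately show ?thesis by (simp add: brk_brk_right[of "Y i i'"])
qed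

end

lemma range_5: "i \<in> {1..5} \<Longrightarrow> i \<in> {1, 2, 3, 4, 5}" for i :: nat
  by auto

text \<open>The eight interpretations of \<open>grt_five\<close> are the symmetries of the tree
  \<open>(12)3(45)\<close>; they produce all relations of \<open>PP 5\<close> from the few lemmas
  above.\<close>

lemma grt_derivation:
  fixes c :: "'k::comm_ring_1 fl2"
  assumes Q: "rational_scalars (inv_nat :: nat \<Rightarrow> 'k)" and grt: "grt c"
  shows "\<exists>D. derivation scl_pp D \<and> (\<forall>i\<in>{1..5}. D (X i i) = 0) \<and> D (X 1 2) = (0 :: 'k pp5) \<and>
    D (X 1 3) = brk (pp.sub c (X 1 3) (X 1 2)) (X 1 3) \<and>
    D (X 2 3) = brk (pp.sub c (X 2 3) (X 1 2)) (X 2 3) \<and>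
    D (X 1 4) = brk (pp.sub c (X 1 4) (X 1 2) + pp.sub c (X 3 5) (X 4 5)) (X 1 4) \<and>
    D (X 2 4) = brk (pp.sub c (X 2 4) (X 1 2) + pp.sub c (X 3 5) (X 4 5)) (X 2 4)"
proof -
  interpret rational_scalars inv_nat by (rule Q)
  let ?C = "\<lambda>x y :: 'k pp5. pp.sub c x y"
  define d13 d23 d34 d35 d14 d15 d24 d25 :: "'k pp5"
    where d13: "d13 = brk (?C (X 1 3) (X 1 2)) (X 1 3)"
      and d23: "d23 = brk (?C (X 2 3) (X 1 2)) (X 2 3)"
      and d34: "d34 = brk (?C (X 3 4) (X 4 5)) (X 3 4)"
      and d35: "d35 = brk (?C (X 3 5) (X 4 5)) (X 3 5)"
      and d14: "d14 = brk (?C (X 1 4) (X 1 2) + ?C (X 3 5) (X 4 5)) (X 1 4)"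
      and d15: "d15 = brk (?C (X 1 5) (X 1 2) + ?C (X 3 4) (X 4 5)) (X 1 5)"
      and d24: "d24 = brk (?C (X 2 4) (X 1 2) + ?C (X 3 5) (X 4 5)) (X 2 4)"
      and d25: "d25 = brk (?C (X 2 5) (X 1 2) + ?C (X 3 4) (X 4 5)) (X 2 5)"
  define d where "d i j =
    (if (i, j) \<in> {(1, 3), (3, 1)} then d13 else if (i, j) \<in> {(2, 3), (3, 2)} then d23
     else if (i, j) \<in> {(3, 4), (4, 3)} then d34 else if (i, j) \<in> {(3, 5), (5, 3)} then d35
     else if (i, j) \<in> {(1, 4), (4, 1)} then d14 else if (i, j) \<in> {(1, 5), (5, 1)} then d15
     else if (i, j) \<in> {(2, 4), (4, 2)} then d24 else if (i, j) \<in> {(2, 5), (5, 2)} then d25 else 0)"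
    for i j :: nat
  have dv: "d 1 1 = 0" "d 2 2 = 0" "d 3 3 = 0" "d 4 4 = 0" "d 5 5 = 0"
    "d 1 2 = 0" "d 2 1 = 0" "d 4 5 = 0" "d 5 4 = 0"
    "d 1 3 = d13" "d 3 1 = d13" "d 2 3 = d23" "d 3 2 = d23" "d 3 4 = d34" "d 4 3 = d34"
    "d 3 5 = d35" "d 5 3 = d35" "d 1 4 = d14" "d 4 1 = d14" "d 1 5 = d15" "d 5 1 = d15"
    "d 2 4 = d24" "d 4 2 = d24" "d 2 5 = d25" "d 5 2 = d25"
    by (simp_all add: d_def)
  interpret a: grt_five inv_nat c 1 2 3 4 5 by (rule grt_fiveI[OF grt]) simp_all
  interpret b: grt_five inv_nat c 2 1 3 4 5 by (rule grt_fiveI[OF grt]) simp_all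
  interpret e: grt_five inv_nat c 1 2 3 5 4 by (rule grt_fiveI[OF grt]) simp_all
  interpret f: grt_five inv_nat c 2 1 3 5 4 by (rule grt_fiveI[OF grt]) simp_all
  interpret a': grt_five inv_nat c 4 5 3 1 2 by (rule grt_fiveI[OF grt]) simp_all
  interpret b': grt_five inv_nat c 5 4 3 1 2 by (rule grt_fiveI[OF grt]) simp_all
  interpret e': grt_five inv_nat c 4 5 3 2 1 by (rule grt_fiveI[OF grt]) simp_all
  interpret f': grt_five inv_nat c 5 4 3 2 1 by (rule grt_fiveI[OF grt]) simp_all
  have cross: "a.cross = d14" "b.cross = d24" "e.cross = d15" "f.cross = d25"
    "a.cross' = d15" "b.cross' = d25" "e.cross' = d14" "f.cross' = d24"
    by (simp_all only: a.cross_def b.cross_def e.cross_def f.cross_def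
      a.cross'_def b.cross'_def e.cross'_def f.cross'_def d14 d15 d24 d25 X_ordered)
  \<comment> \<open>Reading the tree from its other end exchanges \<open>cross\<close> with its
    flipped expression.\<close>
  have cross2: "a'.cross = d14" "b'.cross = d15" "e'.cross = d24" "f'.cross = d25"
    unfolding cross[symmetric] a.cross_flip b.cross_flip e.cross_flip f.cross_flip
    by (simp_all only: a'.cross_def b'.cross_def e'.cross_def f'.cross_def X_ordered)
  have cross3: "a'.cross' = d24" "b'.cross' = d25" "e'.cross' = d14" "f'.cross' = d15"
    unfolding cross2[symmetric]
    by (simp_all only: a'.cross'_def b'.cross'_def e'.cross'_def f'.cross'_def
      a'.cross_def b'.cross_def e'.cross_def f'.cross_def X_ordered)
  have rows: "d13 + d14 + d15 = 0" "d23 + d24 + d25 = 0" "d34 + d14 + d24 = 0" "d35 + d15 + d25 = 0"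
    using a.row_outer b.row_outer a'.row_outer b'.row_outer
    unfolding cross cross2 cross3 d13 d23 d34 d35 X_ordered by simp_all
  have mid: "d13 + d23 = 0" "d34 + d35 = 0"
    using a.third[of 3 1 2] a.third[of 3 4 5]
    unfolding d13 d23 d34 d35 X_ordered by simp_all
  have pairs: "brk (X 1 2) d34 = 0" "brk (X 1 2) d35 = 0" "brk (X 4 5) d13 = 0" "brk (X 4 5) d23 = 0"
    using a.disjoint_pair e.disjoint_pair a'.disjoint_pair e'.disjoint_pair
    unfolding d13 d23 d34 d35 X_ordered by simp_all
  then have pairs': "brk d34 (X 1 2) = 0" "brk d35 (X 1 2) = 0" "brk d13 (X 4 5) = 0" "brk d23 (X 4 5) = 0"
    using brk_eq_0_swap by blast+
  have adj: "brk d34 (X 1 5) + brk (X 3 4) d15 = 0" "brk d34 (X 2 5) + brk (X 3 4) d25 = 0"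
    "brk d35 (X 1 4) + brk (X 3 5) d14 = 0" "brk d35 (X 2 4) + brk (X 3 5) d24 = 0"
    "brk d13 (X 2 4) + brk (X 1 3) d24 = 0" "brk d13 (X 2 5) + brk (X 1 3) d25 = 0"
    "brk d23 (X 1 4) + brk (X 2 3) d14 = 0" "brk d23 (X 1 5) + brk (X 2 3) d15 = 0"
    using a.disjoint_adjacent b.disjoint_adjacent e.disjoint_adjacent f.disjoint_adjacent
      a'.disjoint_adjacent b'.disjoint_adjacent e'.disjoint_adjacent f'.disjoint_adjacent
    unfolding cross cross3 d13[symmetric] d23[symmetric] d34[symmetric] d35[symmetric]
    by (simp_all only: X_ordered d13 d23 d34 d35)
  have crossing: "brk d14 (X 2 5) + brk (X 1 4) d25 = 0" "brk d15 (X 2 4) + brk (X 1 5) d24 = 0"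
    using a.disjoint_crossing e.disjoint_crossing unfolding cross
    by (simp_all only: d24 d25 X_ordered)
  have sw: "brk u v + brk w z = 0 \<Longrightarrow> brk z w + brk v u = 0" for u v w z :: "'k pp5"
  proof -
    assume h: "brk u v + brk w z = 0"
    have "brk z w + brk v u = - brk w z + - brk u v"
      by (rule arg_cong2[of _ _ _ _ plus]; rule brk_swap)
    also have "\<dots> = - (brk u v + brk w z)" by simp
    finally show ?thesis unfolding h by simp
  qed
  note disjoint = pairs pairs' adj crossing adj[THEN sw] crossing[THEN sw]
  have "\<exists>D. derivation scl_pp D \<and> (\<forall>i\<in>{1..CARD(5)}. \<forall>j\<in>{1..CARD(5)}. D (X i j) = d i j)"
  proof (rule pp_derivation_exists)
    fix i j assume "{i, j} \<subseteq> {1..CARD(5)}"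
    then have "i \<in> {1, 2, 3, 4, 5}" "j \<in> {1, 2, 3, 4, 5}" by (intro range_5; simp)+
    then show "d i j = d j i" by (elim insertE emptyE) (simp_all only: dv)
  next
    fix i j k l assume "{i, j, k, l} \<subseteq> {1..CARD(5)}" and dist: "distinct [i, j, k, l]"
    then have "i \<in> {1, 2, 3, 4, 5}" "j \<in> {1, 2, 3, 4, 5}" "k \<in> {1, 2, 3, 4, 5}" "l \<in> {1, 2, 3, 4, 5}"
      by (intro range_5; simp)+
    then show "brk (d i j) (X k l) + brk (X i j) (d k l) = 0"
      using dist
      by (elim insertE emptyE; (simp; fail)?;
        (simp only: dv X_ordered disjoint brk_zero_left brk_zero_right add_0_left add_0_right; fail)?)
  next
    fix i assume "i \<in> {1..CARD(5)}"
    then have i: "i \<in> {1, 2, 3, 4, 5}" by (intro range_5; simp)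
    have "{1..5} = {1, 2, 3, 4, 5 :: nat}" by auto
    then have "(\<Sum>j=1..5. d i j) = d i 1 + d i 2 + d i 3 + d i 4 + d i 5" by (simp add: add.assoc)
    also have "\<dots> = 0"
      using i rows mid
      by (elim insertE emptyE) (simp_all add: dv add.commute add.left_commute del: One_nat_def)
    finally show "(\<Sum>j=1..CARD(5). d i j) = 0" by simp
    show "d i i = 0" using i by (elim insertE emptyE) (simp_all only: dv)
  qed
  then obtain D where D: "derivation scl_pp D" "\<And>i j. i \<in> {1..5} \<Longrightarrow> j \<in> {1..5} \<Longrightarrow> D (X i j) = d i j"
    by auto
  have "d i i = 0" if "i \<in> {1..5}" for i
    using range_5[OF that] by (elim insertE emptyE) (simp_all only: dv)
  then show ?thesis
    using D by (intro exI[of _ D]) (simp add: dv d13 d23 d14 d24 del: One_nat_def)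
qed

section \<open>From centralisers to the pentagon equation\<close>

lemma (in typed_lie_algebra) sub_minus_swap:
  assumes "c + fla.sub c (fgen E1) (fgen E0) = 0"
  shows "sub c a b = - sub c b a"
proof -
  have "sub (c + fla.sub c (fgen E1) (fgen E0)) b a = 0" unfolding assms by simp
  then show ?thesis by (simp add: sub_sub eq_neg_iff_add_eq_0 add.commute)
qed

text \<open>Inertness at arbitrary arguments is \<open>R\<close>. At \<open>(e1, e0)\<close> it
  yields the third equation; at \<open>(e0, e1)\<close> and \<open>(e1, einf)\<close>, with
  antisymmetry, it turns the bracket of the hexagon with \<open>e0\<close> into a bracket with
  \<open>einf + e0 + e1 = 0\<close>.\<close>

lemma (in rational_scalars) grtI:
  fixes c h :: "'k fl2"
  assumes c: "c \<in> graded 2" and inert: "inert c (fla.sub c xinf (fgen E1))"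
    and anti: "c + fla.sub c (fgen E1) (fgen E0) = 0" and pent: "pentagon c = 0"
  shows "grt c"
proof -
  note sw = fla.sub_minus_swap[OF anti]
  have R: "brk (fla.sub c a b) a + brk (fla.sub c (- a - b) b) (- a - b) = 0" for a b :: "'k fl2"
  proof -
    have "fla.sub (brk c (fgen E0) + brk (fla.sub c xinf (fgen E1)) xinf) a b = 0"
      using inert by (simp add: inert_def)
    then show ?thesis by (simp add: fla.sub_sub)
  qed
  have "brk (fla.sub c (fgen E1) (fgen E0)) (fgen E1) + brk (fla.sub c xinf (fgen E0)) xinf = 0"
    using R[of "fgen E1" "fgen E0"] unfolding minus_diff_commute[of "fgen E1"] .
  moreover have "brk (fla.sub c (fgen E1) (fgen E0)) (fgen E1) = brk (fgen E1) c"
    unfolding sw[of "fgen E1" "fgen E0"] by (subst brk_swap) (simp add: brk_minus_right)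
  moreover have "brk (fla.sub c xinf (fgen E0)) xinf = brk xinf (fla.sub c (fgen E0) xinf)"
    unfolding sw[of xinf "fgen E0"] by (subst brk_swap) (simp add: brk_minus_right)
  ultimately have third: "brk (fgen E1) c + brk xinf (fla.sub c (fgen E0) xinf) = 0"
    by (simp only:)
  let ?S = "c + fla.sub c (fgen E1) xinf + fla.sub c xinf (fgen E0)"
  have 1: "brk c (fgen E0) = brk (fla.sub c (fgen E1) xinf) xinf"
    using R[of "fgen E0" "fgen E1"] sw[of xinf "fgen E1"] by (simp add: brk_minus_left)
  have "brk (fla.sub c (fgen E1) xinf) (fgen E1) + brk (fla.sub c (fgen E0) xinf) (fgen E0) = 0"
    using R[of "fgen E1" xinf] by simp
  then have 2: "brk (fla.sub c xinf (fgen E0)) (fgen E0) = brk (fla.sub c (fgen E1) xinf) (fgen E1)"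
    unfolding sw[of xinf "fgen E0"] by (simp add: brk_minus_left neg_eq_iff_add_eq_0 add.commute)
  have "brk ?S (fgen E0) = brk (fla.sub c (fgen E1) xinf) xinf + brk (fla.sub c (fgen E1) xinf) (fgen E0) +
      brk (fla.sub c (fgen E1) xinf) (fgen E1)"
    unfolding brk_add_left 1 2 ..
  also have "\<dots> = brk (fla.sub c (fgen E1) xinf) (xinf + fgen E0 + fgen E1)"
    by (simp only: brk_add_right)
  also have "\<dots> = 0" by simp
  finally have "?S = 0"
    by (rule commute_fgen_graded_2[rotated]) (intro graded.add c sub_graded_2)
  then show ?thesis
    using third anti pent by (simp add: grt_def)
qed

lemma linpart_eqI:
  assumes "x = y" "linpart x = 0" "linpart y = y"
  shows "y = 0"
  using assms by simp

text \<open>Forgetting the fifth strand in the spherical picture, i.e. dividing by the sums \<open>\<Sum>j. T i j\<close>.\<close>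

definition forget5 :: "nat \<Rightarrow> nat \<Rightarrow> 'k::comm_ring_1 fl2" where
  "forget5 p q = (if {p, q} \<in> {{2, 3}, {1, 4}} then fgen E1 else if {p, q} \<in> {{1, 2}, {3, 4}} then fgen E0
     else xinf)"

lemma forget5_simps:
  "forget5 1 2 = fgen E0" "forget5 3 4 = fgen E0" "forget5 2 3 = fgen E1" "forget5 1 4 = fgen E1"
  "forget5 1 3 = xinf" "forget5 2 4 = xinf"
  "forget5 2 1 = fgen E0" "forget5 4 3 = fgen E0" "forget5 3 2 = fgen E1" "forget5 4 1 = fgen E1"
  "forget5 3 1 = xinf" "forget5 4 2 = xinf"
  by (simp_all add: forget5_def doubleton_eq_iff)

lemma braid_images_forget_strandet5:
  "braid_images scl_fla (forget5 :: nat \<Rightarrow> nat \<Rightarrow> 'k::comm_ring_1 fl2)"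
proof
  fix p q :: nat
  show "forget5 p q = (forget5 q p :: 'k fl2)"
    by (simp add: forget5_def insert_commute)
next
  fix p q s :: nat assume "{p, q, s} \<subseteq> {1..4}" "distinct [p, q, s]"
  moreover from this have "p \<in> {1, 2, 3, 4}" "q \<in> {1, 2, 3, 4}" "s \<in> {1, 2, 3, 4}"
    by (intro range_4; simp)+
  ultimately show "brk (forget5 p q + forget5 p s) (forget5 q s :: 'k fl2) = 0"
    by (elim insertE emptyE)
      (simp_all add: forget5_simps brk_linear brk_self brk_swap[of "fgen E1" "fgen E0"] del: One_nat_def)
next
  fix p q s t :: nat assume "{p, q, s, t} \<subseteq> {1..4}" "distinct [p, q, s, t]"
  moreover from this have "p \<in> {1, 2, 3, 4}" "q \<in> {1, 2, 3, 4}" "s \<in> {1, 2, 3, 4}" "t \<in> {1, 2, 3, 4}"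
    by (intro range_4; simp)+
  ultimately show "brk (forget5 p q) (forget5 s t :: 'k fl2) = 0"
    by (elim insertE emptyE)
      (simp_all add: forget5_simps brk_self del: One_nat_def)
qed

context rational_scalars
begin

lemma labels_TT_instances:
  "labels_TT TYPE('k) 3 4 2 1" "labels_TT TYPE('k) 1 2 3 4" "labels_TT TYPE('k) 2 3 1 4"
  unfolding labels_TT_def labels_TT_axioms_def
  by (intro conjI labelsI; simp add: TT_def T_ordered ac_simps del: One_nat_def)+

lemma centraliser_34:
  "brk x (T 3 4) = 0 \<Longrightarrow> \<exists>r s w. x = scl_tt4 r (T 3 4) + scl_tt4 s TT + tt4.sub w (T 1 2) (T 2 3 + T 2 4 :: 'k tt4)"
  using rational_labels.centraliser[of inv_nat 3 4 2 1 x] labels_TT_instances(1) rational_scalars_axioms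
  unfolding rational_labels_def T_ordered by blast

lemma centraliser_12:
  "brk x (T 1 2) = 0 \<Longrightarrow> \<exists>r s w. x = scl_tt4 r (T 1 2) + scl_tt4 s TT + tt4.sub w (T 3 4) (T 1 3 + T 2 3 :: 'k tt4)"
  using rational_labels.centraliser[of inv_nat 1 2 3 4 x] labels_TT_instances(2) rational_scalars_axioms
  unfolding rational_labels_def by blast

lemma centraliser_23:
  "brk x (T 2 3) = 0 \<Longrightarrow> \<exists>r s w. x = scl_tt4 r (T 2 3) + scl_tt4 s TT + tt4.sub w (T 1 4) (T 1 2 + T 1 3 :: 'k tt4)"
  using rational_labels.centraliser[of inv_nat 2 3 1 4 x] labels_TT_instances(3) rational_scalars_axioms
  unfolding rational_labels_def T_ordered by blast

lemma forget_hom: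
  assumes "labels i j k l"
  obtains p :: "'k tt4 \<Rightarrow> 'k fl2" where "typed_lie_hom scl_tt4 scl_fla p"
    "p (T i j) = fgen E1" "p (T j l) = fgen E0" "p (T i l) = xinf"
    "p (T i k) = 0" "p (T j k) = 0" "p (T l k) = 0"
proof -
  interpret labels i j k l by fact
  interpret b: braid_images scl_fla "forget_strand :: nat \<Rightarrow> nat \<Rightarrow> 'k fl2"
    by (rule braid_images_forget_strand)
  have "fla.tlift (forget_strand :: nat \<Rightarrow> nat \<Rightarrow> 'k fl2) (T a b) = forget_strand a b"
    if "a \<in> {i, j, k, l}" "b \<in> {i, j, k, l}" "a \<noteq> b" for a b
    using that unfolding set_eq[symmetric] by (intro b.tlift_T) auto
  then show thesis
    by (intro that[OF b.tlift_hom]) simp_all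
qed

text \<open>The condition on \<open>y\<close> is peeled in two rounds: \<open>brk (T 1 2) y\<close>
  commutes with \<open>T 3 4\<close>; after a Lie polynomial with the same bracket, up to linear
  terms, is subtracted, the rest of \<open>y\<close> commutes with \<open>T 1 2\<close>.\<close>

lemma decomposition:
  fixes x y :: "'k tt4"
  assumes x: "brk x (T 2 3) = 0" and y: "brk (T 3 4) (brk (T 1 2) y) = 0"
    and xy: "x + y \<in> {z. linpart z = 0}"
  shows "\<exists>u v w. u \<in> graded 2 \<and> v \<in> graded 2 \<and> w \<in> graded 2 \<and>
    x + y = tt4.sub w (T 1 4) (T 1 2 + T 1 3) + tt4.sub u (T 1 2) (T 2 3 + T 2 4) +
      tt4.sub v (T 3 4) (T 1 3 + T 2 3)"
proof -
  let ?z = "brk (T 1 2) y"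
  have tt: "(1, 2) \<in> tt_gens 4" "(1, 3) \<in> tt_gens 4" "(1, 4) \<in> tt_gens 4" "(2, 3) \<in> tt_gens 4"
    "(2, 4) \<in> tt_gens 4" "(3, 4) \<in> tt_gens 4"
    by (simp_all add: tt_gens_def)
  have "brk ?z (T 3 4) = 0" using y brk_eq_0_swap by blast
  then obtain r s w where z: "?z = scl_tt4 r (T 3 4) + scl_tt4 s TT + tt4.sub w (T 1 2) (T 2 3 + T 2 4)"
    using centraliser_34 by blast
  have "labels 3 2 4 1" by (rule labelsI) simp_all
  then obtain p where "typed_lie_hom scl_tt4 scl_fla p" "p (T 3 2 :: 'k tt4) = fgen E1"
    "p (T 2 1) = fgen E0" "p (T 3 1) = xinf" "p (T 3 4) = 0" "p (T 2 4) = 0" "p (T 1 4) = 0"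
    by (rule forget_hom)
  note p = this[unfolded T_ordered]
  interpret p: typed_lie_hom scl_tt4 scl_fla p by (rule p)
  \<comment> \<open>Forgetting strand 4 sends \<open>?z\<close> to \<open>w\<close>; as
    \<open>?z\<close> is a bracket with \<open>T 1 2\<close>, this shows that \<open>w\<close> is a
    bracket with \<open>e0\<close>, the other factor being the image of \<open>y\<close>.\<close>
  define u where "u = p y"
  have "p ?z = w"
    unfolding z by (simp add: p.hom_simps p(2-) TT_def del: One_nat_def)
  then have "w = brk (fgen E0) u"
    unfolding u_def by (simp add: p.hom_brk p(2-) del: One_nat_def)
  then have z': "brk (T 1 2) (y - tt4.sub u (T 1 2) (T 2 3 + T 2 4)) = scl_tt4 r (T 3 4) + scl_tt4 s TT"
    using z by (simp add: brk_diff_right)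
  \<comment> \<open>The left side of \<open>z'\<close> is a bracket, hence has no linear
    part.\<close>
  have "s = 0" "r = 0"
    using arg_cong[OF z', of "lin 1 2"] arg_cong[OF z', of "lin 3 4"]
    by (simp_all add: TT_def lin_T tt del: One_nat_def)
  then have "brk (T 1 2) (y - tt4.sub u (T 1 2) (T 2 3 + T 2 4)) = 0" using z' by simp
  then have "brk (y - tt4.sub u (T 1 2) (T 2 3 + T 2 4)) (T 1 2) = 0" using brk_eq_0_swap by blast
  then obtain r' s' v where y': "y - tt4.sub u (T 1 2) (T 2 3 + T 2 4) =
      scl_tt4 r' (T 1 2) + scl_tt4 s' TT + tt4.sub v (T 3 4) (T 1 3 + T 2 3)"
    using centraliser_12 by blast
  obtain r'' s'' w' where x': "x = scl_tt4 r'' (T 2 3) + scl_tt4 s'' TT + tt4.sub w' (T 1 4) (T 1 2 + T 1 3)"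
    using centraliser_23[OF x] by blast
  obtain u0 u1 u' where u': "u' \<in> graded 2" "u = scl_fla u0 (fgen E0) + scl_fla u1 (fgen E1) + u'"
    using linear_part by blast
  obtain v0 v1 v' where v': "v' \<in> graded 2" "v = scl_fla v0 (fgen E0) + scl_fla v1 (fgen E1) + v'"
    using linear_part by blast
  obtain w0 w1 w'' where w': "w'' \<in> graded 2" "w' = scl_fla w0 (fgen E0) + scl_fla w1 (fgen E1) + w''"
    using linear_part by blast
  \<comment> \<open>All terms of degree one: \<open>R\<close> is its own linear part, while
    \<open>x + y\<close> and \<open>?G\<close> have none.\<close>
  define R where "R = scl_tt4 r' (T 1 2) + scl_tt4 s' TT + scl_tt4 r'' (T 2 3) + scl_tt4 s'' TT +
    scl_tt4 u0 (T 1 2) + scl_tt4 u1 (T 2 3 + T 2 4) + scl_tt4 v0 (T 3 4) + scl_tt4 v1 (T 1 3 + T 2 3) +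
    scl_tt4 w0 (T 1 4) + scl_tt4 w1 (T 1 2 + T 1 3)"
  let ?G = "tt4.sub w'' (T 1 4) (T 1 2 + T 1 3) + tt4.sub u' (T 1 2) (T 2 3 + T 2 4) +
      tt4.sub v' (T 3 4) (T 1 3 + T 2 3)"
  have "y = (y - tt4.sub u (T 1 2) (T 2 3 + T 2 4)) + tt4.sub u (T 1 2) (T 2 3 + T 2 4)" by simp
  then have "x + y = ?G + R"
    unfolding y' unfolding x' u' v' w' R_def by (simp add: ac_simps)
  then have "x + y - ?G = R" by simp
  moreover have "linpart (x + y - ?G) = 0"
    using xy u'(1) v'(1) w'(1) by simp
  moreover have "linpart R = R"
    unfolding R_def TT_def by (simp add: linpart_T tt del: One_nat_def)
  ultimately have "R = 0" by (rule linpart_eqI)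
  then have "x + y = ?G" using \<open>x + y = ?G + R\<close> by simp
  then show ?thesis using u'(1) v'(1) w'(1) by blast
qed

text \<open>Each forgetting map makes the arguments of three of the five terms vanish or commute,
  and so identifies the other two. Two of the maps determine \<open>w\<close>, and comparing the
  results gives antisymmetry.\<close>

lemma pentagon_from_decomposition:
  fixes c h :: "'k fl2"
  assumes c: "c \<in> graded 2" and h: "h \<in> graded 2" and u: "u \<in> graded 2" and v: "v \<in> graded 2"
    and w: "w \<in> graded 2"
    and E: "tt4.sub c (T 3 4) (T 2 3) - tt4.sub h (T 1 3) (T 2 3) =
      tt4.sub w (T 1 4) (T 1 2 + T 1 3) + tt4.sub u (T 1 2) (T 2 3 + T 2 4) +
      tt4.sub v (T 3 4) (T 1 3 + T 2 3)"
  shows "h = fla.sub c xinf (fgen E1)" "c + fla.sub c (fgen E1) (fgen E0) = 0" "pentagon c = 0"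
proof -
  note Z = fla.sub_zero_zero[OF c] fla.sub_zero_zero[OF h] fla.sub_zero_zero[OF u]
    fla.sub_zero_zero[OF v] fla.sub_zero_zero[OF w]
  have h_eq: "fla.sub h xinf (fgen E1) = c"
  proof -
    interpret b: braid_images scl_fla "forget5 :: nat \<Rightarrow> nat \<Rightarrow> 'k fl2"
      by (rule braid_images_forget_strandet5)
    interpret p: typed_lie_hom scl_tt4 scl_fla "fla.tlift (forget5 :: nat \<Rightarrow> nat \<Rightarrow> 'k fl2)"
      by (rule b.tlift_hom)
    show ?thesis
      using arg_cong[OF E, of "fla.tlift (forget5 :: nat \<Rightarrow> nat \<Rightarrow> 'k fl2)"]
      by (simp add: p.hom_simps b.tlift_T forget5_simps Z del: One_nat_def)
  qed
  then show h': "h = fla.sub c xinf (fgen E1)"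
    using fla_sub_involution[of h] by simp
  have u_eq: "u = - c"
  proof -
    have "labels 3 2 4 1" by (rule labelsI) simp_all
    then obtain p where "typed_lie_hom scl_tt4 scl_fla p" "p (T 3 2 :: 'k tt4) = fgen E1"
      "p (T 2 1) = fgen E0" "p (T 3 1) = xinf" "p (T 3 4) = 0" "p (T 2 4) = 0" "p (T 1 4) = 0"
      by (rule forget_hom)
    note p = this[unfolded T_ordered]
    interpret p: typed_lie_hom scl_tt4 scl_fla p by (rule p)
    show ?thesis
      using arg_cong[OF E, of p] by (simp add: p.hom_simps p(2-) Z h_eq del: One_nat_def)
  qed
  have v_eq: "v = c"
  proof -
    have "labels 2 3 1 4" by (rule labelsI) simp_all
    then obtain p where "typed_lie_hom scl_tt4 scl_fla p" "p (T 2 3 :: 'k tt4) = fgen E1"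
      "p (T 3 4) = fgen E0" "p (T 2 4) = xinf" "p (T 2 1) = 0" "p (T 3 1) = 0" "p (T 4 1) = 0"
      by (rule forget_hom)
    note p = this[unfolded T_ordered]
    interpret p: typed_lie_hom scl_tt4 scl_fla p by (rule p)
    show ?thesis
      using arg_cong[OF E, of p] by (simp add: p.hom_simps p(2-) Z del: One_nat_def)
  qed
  have w_eq: "w = - fla.sub c xinf (fgen E1)"
  proof -
    have "labels 3 1 2 4" by (rule labelsI) simp_all
    then obtain p where "typed_lie_hom scl_tt4 scl_fla p" "p (T 3 1 :: 'k tt4) = fgen E1"
      "p (T 1 4) = fgen E0" "p (T 3 4) = xinf" "p (T 3 2) = 0" "p (T 1 2) = 0" "p (T 4 2) = 0"
      by (rule forget_hom)
    note p = this[unfolded T_ordered]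
    interpret p: typed_lie_hom scl_tt4 scl_fla p by (rule p)
    show ?thesis
      using arg_cong[OF E, of p]
      by (simp add: p.hom_simps p(2-) Z v_eq eq_neg_iff_add_eq_0 del: One_nat_def)
  qed
  have w_eq': "w = fla.sub c (fgen E1) xinf"
  proof -
    have "labels 2 1 3 4" by (rule labelsI) simp_all
    then obtain p where "typed_lie_hom scl_tt4 scl_fla p" "p (T 2 1 :: 'k tt4) = fgen E1"
      "p (T 1 4) = fgen E0" "p (T 2 4) = xinf" "p (T 2 3) = 0" "p (T 1 3) = 0" "p (T 4 3) = 0"
      by (rule forget_hom)
    note p = this[unfolded T_ordered]
    interpret p: typed_lie_hom scl_tt4 scl_fla p by (rule p)
    show ?thesis
      using arg_cong[OF E, of p]
      by (simp add: p.hom_simps p(2-) Z u_eq eq_neg_iff_add_eq_0 del: One_nat_def)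
  qed
  have "fla.sub (fla.sub c (fgen E1) xinf + fla.sub c xinf (fgen E1)) xinf (fgen E1) = 0"
    using w_eq w_eq' by (simp add: eq_neg_iff_add_eq_0)
  then show anti: "c + fla.sub c (fgen E1) (fgen E0) = 0"
    by (simp add: fla.sub_sub add.commute)
  note sw = tt4.sub_minus_swap[OF anti]
  \<comment> \<open>The sum \<open>T 1 2 + T 1 3 + T 2 3\<close> commutes with the generators on
    strands 1, 2, 3.\<close>
  have "tt4.sub c (T 1 2) (T 2 3) = tt4.sub c (- T 1 3 - T 2 3) (T 2 3 :: 'k tt4)"
    by (rule tt4.sub_graded_2_cong[OF c])
      (simp_all add: brk_linear T_brk_normal brk_self del: One_nat_def)
  then have hT: "tt4.sub h (T 1 3) (T 2 3) = - tt4.sub c (T 2 3) (T 1 2 :: 'k tt4)"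
    unfolding h' tt4.sub_sub using sw[of "T 1 2" "T 2 3"] by simp
  \<comment> \<open>The first arguments differ by \<open>TT - T 2 3\<close>, and
    \<open>T 2 3\<close> commutes with \<open>T 1 4\<close> and with
    \<open>T 1 2 + T 1 3\<close>.\<close>
  have "tt4.sub c (T 2 4 + T 3 4) (T 1 2 + T 1 3) =
      tt4.sub c (- T 1 4 - (T 1 2 + T 1 3)) (T 1 2 + T 1 3 :: 'k tt4)"
    by (rule tt4.sub_graded_2_cong[OF c])
      (simp_all add: brk_linear T_brk_normal brk_self del: One_nat_def)
  then have wT: "tt4.sub w (T 1 4) (T 1 2 + T 1 3) = - tt4.sub c (T 2 4 + T 3 4) (T 1 2 + T 1 3 :: 'k tt4)"
    unfolding w_eq by (simp add: tt4.sub_sub)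
  have uT: "tt4.sub u (T 1 2) (T 2 3 + T 2 4) = tt4.sub c (T 2 3 + T 2 4) (T 1 2 :: 'k tt4)"
    unfolding u_eq using sw[of "T 2 3 + T 2 4" "T 1 2"] by simp
  show "pentagon c = 0"
    using E unfolding hT wT uT v_eq pentagon_def by (simp add: algebra_simps)
qed

end

text \<open>The relabelling 1, 2, 3, 4 to 2, 3, 1, 4 turns the pentagon 1, 2, 4, 5, 3, which comes out of (a')
  and (b'), into the pentagon 2, 3, 4, 5, 1 of \<open>pent\<close>.\<close>

definition psi_gen :: "nat \<Rightarrow> nat \<Rightarrow> 'k::comm_ring_1 tt4" where
  "psi_gen p q = (let s = (\<lambda>p. if p = 1 then 2 else if p = 2 then 3 else if p = 3 then 1 else 4); S = (\<lambda>p. T p 1 + T p 2 + T p 3 + T p 4) in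
     if p = 5 \<and> q = 5 then TT + TT else if p = 5 then - S (s q) else if q = 5 then - S (s p)
     else T (s p) (s q))"

lemma T_diag: "T p p = 0"
  by (rule T_outside) (simp add: tt_gens_def)

lemma psi_gen_simps:
  "psi_gen 1 1 = 0" "psi_gen 2 2 = 0" "psi_gen 3 3 = 0" "psi_gen 4 4 = 0" "psi_gen 5 5 = TT + TT"
  "psi_gen 1 2 = T 2 3" "psi_gen 2 1 = T 2 3" "psi_gen 1 3 = T 1 2" "psi_gen 3 1 = T 1 2"
  "psi_gen 1 4 = T 2 4" "psi_gen 4 1 = T 2 4" "psi_gen 2 3 = T 1 3" "psi_gen 3 2 = T 1 3"
  "psi_gen 2 4 = T 3 4" "psi_gen 4 2 = T 3 4" "psi_gen 3 4 = T 1 4" "psi_gen 4 3 = T 1 4"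
  "psi_gen 1 5 = - (T 1 2 + T 2 3 + T 2 4)" "psi_gen 5 1 = - (T 1 2 + T 2 3 + T 2 4)"
  "psi_gen 2 5 = - (T 1 3 + T 2 3 + T 3 4)" "psi_gen 5 2 = - (T 1 3 + T 2 3 + T 3 4)"
  "psi_gen 3 5 = - (T 1 2 + T 1 3 + T 1 4)" "psi_gen 5 3 = - (T 1 2 + T 1 3 + T 1 4)"
  "psi_gen 4 5 = - (T 1 4 + T 2 4 + T 3 4)" "psi_gen 5 4 = - (T 1 4 + T 2 4 + T 3 4)"
  by (simp_all add: psi_gen_def Let_def T_diag T_ordered add.commute add.left_commute del: One_nat_def)

text \<open>The first four strands get frame zero, and the row relations then fix the fifth: its
  off-diagonal entries add up to \<open>- (TT + TT)\<close>, whence the central value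
  \<open>TT + TT\<close> at \<open>(5, 5)\<close>.\<close>

lemma sphere_images_psi_gen: "sphere_images TYPE(5) scl_tt4 (psi_gen :: nat \<Rightarrow> nat \<Rightarrow> 'k::comm_ring_1 tt4)"
proof
  {
    fix i j assume "{i, j} \<subseteq> {1..CARD(5)}"
    then have "i \<in> {1, 2, 3, 4, 5}" "j \<in> {1, 2, 3, 4, 5}" by (intro range_5; simp)+
    then show "psi_gen i j = (psi_gen j i :: 'k tt4)"
      by (elim insertE emptyE) (simp_all only: psi_gen_simps)
  next
    fix i j k l assume "{i, j, k, l} \<subseteq> {1..CARD(5)}" and dist: "distinct [i, j, k, l]"
    then have "i \<in> {1, 2, 3, 4, 5}" "j \<in> {1, 2, 3, 4, 5}" "k \<in> {1, 2, 3, 4, 5}" "l \<in> {1, 2, 3, 4, 5}"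
      by (intro range_5; simp)+
    then show "brk (psi_gen i j) (psi_gen k l) = (0 :: 'k tt4)"
      using dist
      by (elim insertE emptyE; (simp; fail)?;
        (simp add: psi_gen_simps brk_linear T_brk_normal brk_self del: One_nat_def; fail)?)
  next
    fix i assume "i \<in> {1..CARD(5)}"
    then have i: "i \<in> {1, 2, 3, 4, 5}" by (intro range_5; simp)
    have "{1..5} = {1, 2, 3, 4, 5 :: nat}" by auto
    then have "(\<Sum>j=1..5. psi_gen i j :: 'k tt4) =
        psi_gen i 1 + psi_gen i 2 + psi_gen i 3 + psi_gen i 4 + psi_gen i 5" by (simp add: add.assoc)
    also have "\<dots> = 0"
      using i by (elim insertE emptyE) (simp_all add: psi_gen_simps TT_def del: One_nat_def)
    finally show "(\<Sum>j=1..CARD(5). psi_gen i j) = (0 :: 'k tt4)" by simp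
  next
    fix i j k assume "{i, j, k} \<subseteq> {1..CARD(5)}"
    then have "i \<in> {1, 2, 3, 4, 5}" by (intro range_5; simp)
    then show "brk (psi_gen i i) (psi_gen j k) = (0 :: 'k tt4)"
      by (elim insertE emptyE) (simp_all add: psi_gen_simps brk_add_left TT_central del: One_nat_def)
  }
qed

lemma intertwine_four:
  fixes D :: "'k::comm_ring_1 pp4 \<Rightarrow> 'k pp4" and E :: "'b::lie_ring \<Rightarrow> 'b"
  assumes h: "typed_lie_hom scl_pp scl h" and D: "derivation scl_pp D" and E: "derivation scl E"
    and gen: "E (h (X 1 1)) = h (D (X 1 1))" "E (h (X 2 2)) = h (D (X 2 2))" "E (h (X 3 3)) = h (D (X 3 3))"
      "E (h (X 1 2)) = h (D (X 1 2))" "E (h (X 1 3)) = h (D (X 1 3))" "E (h (X 2 3)) = h (D (X 2 3))"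
  shows "E (h x) = h (D x)"
proof (rule intertwine_derivations[OF h D E])
  interpret h: typed_lie_hom scl_pp scl h by fact
  interpret D: derivation scl_pp D by fact
  interpret E: derivation scl E by fact
  note closed = h.hom_add h.hom_diff h.hom_minus D.D_add D.D_diff D.D_minus E.D_add E.D_diff E.D_minus
  have "X 1 4 = - X 1 1 - X 1 2 - (X 1 3 :: 'k pp4)"
    "X 2 4 = - X 2 2 - X 1 2 - (X 2 3 :: 'k pp4)" "X 3 4 = - X 3 3 - X 1 3 - (X 2 3 :: 'k pp4)"
    unfolding X4_eq ZZ_def by (simp_all add: algebra_simps)
  then have 4: "E (h (X 1 4)) = h (D (X 1 4))" "E (h (X 2 4)) = h (D (X 2 4))" "E (h (X 3 4)) = h (D (X 3 4))"
    by (simp_all only: closed gen)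
  have "X 4 4 + X 4 1 + X 4 2 + X 4 3 = (0 :: 'k pp4)" by (rule X4_row) simp_all
  then have "X 4 4 = - X 1 4 - X 2 4 - (X 3 4 :: 'k pp4)"
    unfolding X_ordered by (simp add: algebra_simps eq_neg_iff_add_eq_0)
  then have "E (h (X 4 4)) = h (D (X 4 4))"
    by (simp only: closed 4)
  note all = gen 4 this
  fix i j assume "i \<in> {1..CARD(4)}" "j \<in> {1..CARD(4)}"
  then have "i \<in> {1, 2, 3, 4}" "j \<in> {1, 2, 3, 4}" by (intro range_4; simp)+
  then show "E (h (X i j)) = h (D (X i j))"
    by (elim insertE emptyE) (simp_all only: X_ordered all)
qed

lemma lie_PP5:
  "ladd (PP 5) (Rep_pp x) (Rep_pp y) = Rep_pp (x + y :: 'k::comm_ring_1 pp5)"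
  "lbrk (PP 5) (Rep_pp x) (Rep_pp y) = Rep_pp (brk x y :: 'k::comm_ring_1 pp5)"
  using Rep_pp_simps(2,4)[of x y] by simp_all

interpretation pull_a: five_labels 1 2 3 4 5
  by unfold_locales simp_all

interpretation pull_b: five_labels 1 2 4 3 5
  by unfold_locales simp_all

section \<open>The two inclusions\<close>

context rational_scalars
begin

text \<open>The left side is \<open>c\<close> at \<open>- X q r - X p q\<close> and
  \<open>X p q\<close>; the first argument agrees with \<open>X p r\<close> up to an element
  commuting with both generators.\<close>

lemma inert_first:
  fixes c :: "'k fl2"
  assumes "grt c" "{p, q, r} \<subseteq> {1..5}" "distinct [p, q, r]"
  shows "pp.sub (fla.sub c xinf (fgen E1)) (X q r) (X p q) = pp.sub c (X p r) (X p q :: 'k pp5)"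
proof -
  interpret grt_five inv_nat c 1 2 3 4 5 by (rule grt_fiveI) (use assms in simp_all)
  have c: "c \<in> graded 2" using assms(1) by (simp add: grt_def grt_graded_2)
  have z: "brk (X p q + X p r + X q r) (X p q :: 'k pp5) = 0"
    "brk (X p q + X p r + X q r) (X q r :: 'k pp5) = 0"
    by (rule triple_central[OF assms(2,3)])+
  have d: "X p r - (- X q r - X p q) = X p q + X p r + (X q r :: 'k pp5)" by (simp add: algebra_simps)
  have "pp.sub c (X p r) (X p q) = pp.sub c (- X q r - X p q) (X p q :: 'k pp5)"
    by (rule pp.sub_graded_2_cong[OF c]; (unfold d)?) (simp_all add: z brk_diff_right brk_minus_right)
  then show ?thesis by (simp add: pp.sub_sub)
qed

lemma subset_direction:
  fixes c :: "'k fl2"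
  assumes "grt c"
  shows "Rep_fla c \<in> {C \<in> GG_inert. \<exists>D X.
       lie_derivation (PP 5) D \<and> X \<in> lcarrier (PP 5) \<and>
       intertwines (PP 4) (PP_pull 5 [[1], [2], [3], [4, 5]]) (vecD C) D \<and>
       intertwines (PP 4) (PP_pull 5 [[1], [2], [4], [3, 5]]) (vecD C)
         (\<lambda>x. ladd (PP 5) (D x) (lbrk (PP 5) X x))}"
proof -
  define h where "h = fla.sub c xinf (fgen E1)"
  have inert: "inert c h" unfolding h_def using assms by (rule grt_inert)
  have c: "c \<in> graded 2" using assms by (simp add: grt_def grt_graded_2)
  obtain D4 where D4: "four_derivation D4 c h"
    and vecD: "\<And>x :: 'k pp4. vecD (Rep_fla c) (Rep_pp x) = Rep_pp (D4 x)"
    using vecD_spec[OF inert] by blast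
  interpret D4: four_derivation D4 c h by (rule D4)
  obtain D where D: "derivation scl_pp D" "\<And>i. i \<in> {1..5} \<Longrightarrow> D (X i i) = 0" "D (X 1 2) = (0 :: 'k pp5)"
    "D (X 1 3) = brk (pp.sub c (X 1 3) (X 1 2)) (X 1 3)"
    "D (X 2 3) = brk (pp.sub c (X 2 3) (X 1 2)) (X 2 3)"
    "D (X 1 4) = brk (pp.sub c (X 1 4) (X 1 2) + pp.sub c (X 3 5) (X 4 5)) (X 1 4)"
    "D (X 2 4) = brk (pp.sub c (X 2 4) (X 1 2) + pp.sub c (X 3 5) (X 4 5)) (X 2 4)"
    using grt_derivation[OF rational_scalars_axioms assms] by blast
  interpret D: derivation scl_pp D by (rule D)
  \<comment> \<open>\<open>D\<close> belongs to the tree \<open>(12)3(45)\<close>, while (b') asks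
    for \<open>(12)4(35)\<close>: adding \<open>brk x\<close> cancels the term in
    \<open>X 3 5\<close> and \<open>X 4 5\<close> from the values on \<open>X 1 4\<close> and
    \<open>X 2 4\<close>.\<close>
  define x :: "'k pp5" where "x = pp.sub c (X 4 5) (X 3 5)"
  have diag: "D4 (X 1 1) = 0" "D4 (X 2 2) = 0" "D4 (X 3 3) = 0"
    by (rule D4.diag; simp)+
  interpret a: typed_lie_hom scl_pp scl_pp "pp.plift pull_a.merge :: 'k pp4 \<Rightarrow> 'k pp5"
    by (rule pull_a.plift_merge_hom)
  interpret b: typed_lie_hom scl_pp scl_pp "pp.plift pull_b.merge :: 'k pp4 \<Rightarrow> 'k pp5"
    by (rule pull_b.plift_merge_hom)
  have aX: "pp.plift pull_a.merge (X i j :: 'k pp4) = (pull_a.merge i j :: 'k pp5)"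
    if "i \<in> {1..4}" "j \<in> {1..4}" for i j
    by (rule pull_a.plift_merge_X[OF that])
  have bX: "pp.plift pull_b.merge (X i j :: 'k pp4) = (pull_b.merge i j :: 'k pp5)"
    if "i \<in> {1..4}" "j \<in> {1..4}" for i j
    by (rule pull_b.plift_merge_X[OF that])
  have first: "pp.sub h (X 2 3) (X 1 2) = pp.sub c (X 1 3) (X 1 2 :: 'k pp5)"
    "pp.sub h (X 2 4) (X 1 2) = pp.sub c (X 1 4) (X 1 2 :: 'k pp5)"
    unfolding h_def by (rule inert_first[OF assms]; simp)+
  have a: "D (pp.plift pull_a.merge y) = pp.plift pull_a.merge (D4 y)" for y
    by (rule intertwine_four[OF pull_a.plift_merge_hom D4.derivation_axioms D(1)])
      (simp_all add: aX pull_a.merge_simps diag D4.D12 D4.D13 D4.D23 a.hom_simps D first del: One_nat_def)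
  have xc: "brk x (X 1 2) = 0"
  proof -
    have "brk (X 1 2) x = 0"
      unfolding x_def by (rule pp.sub_commute; rule X5_disjoint; simp)
    then show ?thesis using brk_eq_0_swap by blast
  qed
  have x': "x = - pp.sub c (X 3 5) (X 4 5)" unfolding x_def by (rule pp.grt_antisym[OF assms])
  have b: "D (pp.plift pull_b.merge y) + brk x (pp.plift pull_b.merge y) = pp.plift pull_b.merge (D4 y)" for y
  proof (rule intertwine_four[OF pull_b.plift_merge_hom D4.derivation_axioms D.derivation_add_ad])
    have "D (X 1 4) + brk x (X 1 4) = brk (pp.sub c (X 1 4) (X 1 2)) (X 1 4)"
      "D (X 2 4) + brk x (X 2 4) = brk (pp.sub c (X 2 4) (X 1 2)) (X 2 4)"
      unfolding D x' by (simp_all add: brk_add_left brk_minus_left)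
    then show "D (pp.plift pull_b.merge (X 1 3 :: 'k pp4)) +
        brk x (pp.plift pull_b.merge (X 1 3 :: 'k pp4)) =
        pp.plift pull_b.merge (D4 (X 1 3))"
      "D (pp.plift pull_b.merge (X 2 3 :: 'k pp4)) +
        brk x (pp.plift pull_b.merge (X 2 3 :: 'k pp4)) =
        pp.plift pull_b.merge (D4 (X 2 3))"
      by (simp_all add: bX pull_b.merge_simps D4.D13 D4.D23 b.hom_simps first del: One_nat_def)
  qed (simp_all add: bX pull_b.merge_simps diag D4.D12 b.hom_zero D X_central' xc del: One_nat_def)
  have "lie_derivation (PP 5) (\<lambda>y. Rep_pp (D (Abs_pp y)))"
    using lie_derivation_Rep[OF D(1)] by simp
  moreover have "Rep_pp x \<in> lcarrier (PP 5)" using Rep_pp[of x] by simp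
  moreover have "intertwines (PP 4) (PP_pull 5 [[1], [2], [3], [4, 5]]) (vecD (Rep_fla c)) (\<lambda>y. Rep_pp (D (Abs_pp y)))"
    unfolding pull_a.intertwines_merge[OF vecD] by (simp add: Rep_pp_inverse a del: One_nat_def)
  moreover have "intertwines (PP 4) (PP_pull 5 [[1], [2], [4], [3, 5]]) (vecD (Rep_fla c))
      (\<lambda>y. ladd (PP 5) (Rep_pp (D (Abs_pp y))) (lbrk (PP 5) (Rep_pp x) y))"
    unfolding pull_b.intertwines_merge[OF vecD] by (simp add: Rep_pp_inverse lie_PP5 b del: One_nat_def)
  moreover have "Rep_fla c \<in> GG_inert" unfolding GG_inert_iff using c inert by blast
  ultimately show ?thesis by blast
qed

lemma superset_direction:
  fixes c :: "'k fl2"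
  assumes c: "Rep_fla c \<in> GG_inert" and D: "lie_derivation (PP 5) D" and X: "x \<in> lcarrier (PP 5)"
    and a: "intertwines (PP 4) (PP_pull 5 [[1], [2], [3], [4, 5]]) (vecD (Rep_fla c)) D"
    and b: "intertwines (PP 4) (PP_pull 5 [[1], [2], [4], [3, 5]]) (vecD (Rep_fla c))
         (\<lambda>y. ladd (PP 5) (D y) (lbrk (PP 5) x y))"
  shows "grt c"
proof -
  obtain h where inert: "inert c h" and c2: "c \<in> graded 2" using c unfolding GG_inert_iff by blast
  have h2: "h \<in> graded 2" using inert by (simp add: inert_def)
  obtain D4 where D4: "four_derivation D4 c h"
    and vecD: "\<And>x :: 'k pp4. vecD (Rep_fla c) (Rep_pp x) = Rep_pp (D4 x)"
    using vecD_spec[OF inert] by blast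
  interpret D4: four_derivation D4 c h by (rule D4)
  define \<xi> where "\<xi> = (Abs_pp x :: 'k pp5)"
  have \<xi>: "x = Rep_pp \<xi>"
    unfolding \<xi>_def by (rule Abs_pp_inverse[symmetric]) (use X in simp)
  have D': "lie_derivation (PP CARD(5)) D" using D by simp
  define \<delta> where "\<delta> y = (Abs_pp (D (Rep_pp y)) :: 'k pp5)" for y :: "'k pp5"
  interpret \<delta>: derivation scl_pp \<delta> unfolding \<delta>_def by (rule derivation_Abs[OF D'])
  have \<delta>: "D (Rep_pp y) = Rep_pp (\<delta> y)" for y :: "'k pp5"
    unfolding \<delta>_def by (rule derivation_Abs(2)[OF D', symmetric])
  interpret a: typed_lie_hom scl_pp scl_pp "pp.plift pull_a.merge :: 'k pp4 \<Rightarrow> 'k pp5"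
    by (rule pull_a.plift_merge_hom)
  interpret b: typed_lie_hom scl_pp scl_pp "pp.plift pull_b.merge :: 'k pp4 \<Rightarrow> 'k pp5"
    by (rule pull_b.plift_merge_hom)
  have a: "\<delta> (pp.plift pull_a.merge y) = pp.plift pull_a.merge (D4 y)" for y
    using a unfolding pull_a.intertwines_merge[OF vecD] \<delta> Rep_pp_inject by blast
  have b: "\<delta> (pp.plift pull_b.merge y) + brk \<xi> (pp.plift pull_b.merge y) = pp.plift pull_b.merge (D4 y)" for y
    using b unfolding pull_b.intertwines_merge[OF vecD] \<delta> \<xi> lie_PP5 Rep_pp_inject by blast
  have \<delta>12: "\<delta> (X 1 2) = 0"
    using a[of "X 1 2"] by (simp add: pull_a.plift_merge_X pull_a.merge_simps D4.D12 a.hom_zero del: One_nat_def)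
  have \<delta>13: "\<delta> (X 1 3) = brk (pp.sub h (X 2 3) (X 1 2)) (X 1 3)"
    using a[of "X 1 3"]
    by (simp add: pull_a.plift_merge_X pull_a.merge_simps D4.D13 a.hom_simps del: One_nat_def)
  have \<xi>12: "brk \<xi> (X 1 2) = 0"
    using b[of "X 1 2"] \<delta>12
    by (simp add: pull_b.plift_merge_X pull_b.merge_simps D4.D12 b.hom_zero del: One_nat_def)
  \<comment> \<open>The map of (b') sends \<open>X 2 3\<close> to \<open>X 2 4\<close>, so (b')
    determines \<open>\<delta>\<close> there up to the inner part of \<open>\<xi>\<close>.\<close>
  have \<delta>24: "\<delta> (X 2 4) = brk (pp.sub c (X 2 4) (X 1 2) - \<xi>) (X 2 4)"
    using b[of "X 2 3"]
    by (simp add: pull_b.plift_merge_X pull_b.merge_simps D4.D23 b.hom_simps brk_diff_left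
        algebra_simps del: One_nat_def)
  let ?y = "pp.sub c (X 2 4) (X 1 2) - \<xi> - pp.sub h (X 2 3) (X 1 2)"
  have comm: "brk (X 1 3) (X 2 4 :: 'k pp5) = 0" by (rule X5_disjoint) simp_all
  have y: "brk (X 2 4) (brk (X 1 3) ?y) = 0"
  proof -
    let ?v = "pp.sub c (X 2 4) (X 1 2) - \<xi>" and ?u = "pp.sub h (X 2 3) (X 1 2) :: 'k pp5"
    have "brk (brk ?u (X 1 3)) (X 2 4) + brk (X 1 3) (brk ?v (X 2 4)) = 0"
      using arg_cong[OF comm, of \<delta>] unfolding \<delta>.D_brk \<delta>13 \<delta>24 \<delta>.D_zero .
    moreover have "brk (brk ?u (X 1 3)) (X 2 4) = brk (X 2 4) (brk (X 1 3) ?u)"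
      unfolding brk_swap[of ?u "X 1 3"] brk_swap[of "- brk (X 1 3) ?u" "X 2 4"]
      by (simp add: brk_minus_right)
    moreover have "brk (X 1 3) (brk ?v (X 2 4)) = - brk (X 2 4) (brk (X 1 3) ?v)"
    proof -
      have "brk (X 1 3) (brk ?v (X 2 4)) = brk (brk (X 1 3) ?v) (X 2 4)"
        using brk_brk_right[of "X 1 3" ?v "X 2 4"] comm by simp
      then show ?thesis using brk_swap[of "brk (X 1 3) ?v" "X 2 4"] by simp
    qed
    ultimately show ?thesis
      by (simp only: brk_diff_right[of _ ?v ?u] brk_diff_right[of "X 2 4"]) (simp add: algebra_simps eq_neg_iff_add_eq_0)
  qed
  interpret p: sphere_images scl_tt4 "psi_gen :: nat \<Rightarrow> nat \<Rightarrow> 'k tt4" "TYPE(5)"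
    by (rule sphere_images_psi_gen)
  let ?p = "tt4.plift psi_gen :: 'k pp5 \<Rightarrow> 'k tt4"
  interpret q: typed_lie_hom scl_pp scl_tt4 ?p by (rule p.plift_hom)
  have pX: "?p (X i j) = psi_gen i j" if "i \<in> {1..5}" "j \<in> {1..5}" for i j
    using p.plift_X[of i j] that by simp
  have pX': "?p (X 1 2) = T 2 3" "?p (X 2 4) = T 3 4" "?p (X 1 3) = T 1 2" "?p (X 2 3) = T 1 3"
    by (simp_all add: pX psi_gen_simps del: One_nat_def)
  have 1: "brk (?p \<xi>) (T 2 3) = 0"
    using arg_cong[OF \<xi>12, of ?p] by (simp only: q.hom_brk q.hom_zero pX')
  have 2: "brk (T 3 4) (brk (T 1 2) (?p ?y)) = 0"
    using arg_cong[OF y, of ?p] by (simp only: q.hom_brk q.hom_zero pX')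
  have py: "?p ?y = tt4.sub c (T 3 4) (T 2 3) - ?p \<xi> - tt4.sub h (T 1 3) (T 2 3)"
    by (simp only: q.hom_diff q.hom_sub pX')
  \<comment> \<open>The unknown \<open>\<xi>\<close> cancels, leaving a combination of
    \<open>c\<close> and \<open>h\<close>, which has no linear part.\<close>
  have sum: "?p \<xi> + ?p ?y = tt4.sub c (T 3 4) (T 2 3) - tt4.sub h (T 1 3) (T 2 3)"
    unfolding py by simp
  have "?p \<xi> + ?p ?y \<in> {z. linpart z = 0}"
    unfolding sum using c2 h2 by simp
  then obtain u v w where "u \<in> graded 2" "v \<in> graded 2" "w \<in> graded 2"
    "?p \<xi> + ?p ?y = tt4.sub w (T 1 4) (T 1 2 + T 1 3) + tt4.sub u (T 1 2) (T 2 3 + T 2 4) +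
      tt4.sub v (T 3 4) (T 1 3 + T 2 3)"
    using decomposition[OF 1 2] by blast
  then have "h = fla.sub c xinf (fgen E1)" "c + fla.sub c (fgen E1) (fgen E0) = 0" "pentagon c = 0"
    using pentagon_from_decomposition[OF c2 h2, of u v w] unfolding sum by blast+
  then show ?thesis using grtI[OF c2] inert by blast
qed

end

theorem theorem3:
  fixes scaleQ :: "rat \<Rightarrow> 'k::comm_ring_1 \<Rightarrow> 'k"
  assumes "vector_space scaleQ"
    and "\<And>r x y. scaleQ r (x * y) = scaleQ r x * y"
  shows "(grt1 :: ('k, egen) lie_elt set) =
    {C \<in> GG_inert. \<exists>D X.
       lie_derivation (PP 5) D \<and> X \<in> lcarrier (PP 5) \<and>
       intertwines (PP 4) (PP_pull 5 [[1], [2], [3], [4, 5]]) (vecD C) D \<and>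
       intertwines (PP 4) (PP_pull 5 [[1], [2], [4], [3, 5]]) (vecD C)
         (\<lambda>x. ladd (PP 5) (D x) (lbrk (PP 5) X x))}"
proof -
  interpret Q: vector_space scaleQ by fact
  \<comment> \<open>The inverse of \<open>n\<close> in \<open>'k\<close> is the rational
    \<open>1 / n\<close> acting on the unit.\<close>
  have "of_nat n * scaleQ (1 / of_nat n) 1 = (1 :: 'k)" if "n > 0" for n
  proof -
    have *: "scaleQ (of_nat n) y = of_nat n * y" for y
      by (induction n) (simp_all add: Q.scale_left_distrib algebra_simps)
    have "of_nat n * scaleQ (1 / of_nat n) 1 = scaleQ (of_nat n) (scaleQ (1 / of_nat n) 1)"
      by (rule *[symmetric])
    also have "\<dots> = 1" using that by simp
    finally show ?thesis .
  qed
  then interpret rational_scalars "\<lambda>n. scaleQ (1 / of_nat n) 1"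
    by unfold_locales
  show ?thesis (is "_ = ?R")
  proof (intro equalityI subsetI)
    fix C :: "('k, egen) lie_elt" assume C: "C \<in> grt1"
    then have "C \<in> lcarrier flie" by (simp add: grt1_def)
    then obtain c where c: "C = Rep_fla c"
      using Abs_fla_inverse[of C] by (auto simp: flie_def)
    then show "C \<in> ?R" using subset_direction[of c] C by (simp add: grt1_iff)
  next
    fix C :: "('k, egen) lie_elt" assume C: "C \<in> ?R"
    then have "C \<in> GG" by (simp add: GG_inert_def)
    then obtain c where c: "C = Rep_fla c" using GG_subset by auto
    from C obtain D x where "lie_derivation (PP 5) D" "x \<in> lcarrier (PP 5)"
       "intertwines (PP 4) (PP_pull 5 [[1], [2], [3], [4, 5]]) (vecD C) D"
       "intertwines (PP 4) (PP_pull 5 [[1], [2], [4], [3, 5]]) (vecD C)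
         (\<lambda>y. ladd (PP 5) (D y) (lbrk (PP 5) x y))" "C \<in> GG_inert" by blast
    then show "C \<in> grt1" unfolding c grt1_iff using superset_direction by blast
  qed
qed

end
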